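(* Let $\check R(z)=\check R^{\tilde L_1,\tilde L_1}(z)$ be the normalized intertwiner for the $27$-dimensional first fundamental module of the quantum affine algebra of type $E_6^{(1)}$. In terms of projectors for the $U_q(E_6)$-decomposition $L_{\omega_1}\otimes L_{\omega_1}\cong L_{2\omega_1}\oplus L_{\omega_2}\oplus L_{\omega_5}$, $$\check R(z)=P_{2\omega_1}^q-q^{-2}\frac{1-q^2z}{1-q^{-2}z}P_{\omega_2}^q+q^{-10}\frac{(1-q^2z)(1-q^8z)}{(1-q^{-2}z)(1-q^{-8}z)}P^q_{\omega_5}.$$ In terms of matrix units, $$\check R(z)=\big(\check R(z)\big)_{\mathfrak{sl}_{27}}-\frac{(q-q^{-1})(1-z)}{(q-q^{-1}z)(q^4-q^{-4}z)}T(z),$$ where $$\big(\check R(z)\big)_{\mathfrak{sl}_{27}}=\sum_{i}E_{ii}\otimes E_{ii}+\frac{z(q-q^{-1})}{q-q^{-1}z}\sum_{i<j}E_{ii}\otimes E_{jj}+\frac{q-q^{-1}}{q-q^{-1}z}\sum_{i>j}E_{ii}\otimes E_{jj}+\frac{1-z}{q-q^{-1}z}\sum_{i\neq j}E_{ij}\otimes E_{ji}$$ (indices from $1$ to $27$), and $$T(z)=\sum_{s=1}^{27}\Big(zq^{-4}\sum_{<}+\,q^4\sum_{>}+\,\frac{q^{7/2}+q^{-7/2}z}{q^{1/2}+q^{-1/2}}\sum_{=}\Big)\varepsilon^{q,s}_{ik}\varepsilon^{q,s}_{jl}\,E_{ij}\otimes E_{kl},$$ where for each $s$ the sums $\sum_<,\sum_>,\sum_=$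 are over pairs $(i,k),(j,l)\in I_s$ with $|(i,k)|+|(j,l)|$ respectively smaller than, greater than, equal to $11$.
   Context: Conventions. $q\in\mathbb C^\times$ is not a root of unity; $q^{1/2}$ is fixed. The affine Dynkin diagram $E_6^{(1)}$ is the chain $1-2-3-4-5$ with node $6$ attached to $3$ and node $0$ attached to $6$; $\tilde C$ is its Cartan matrix. $U_q\tilde{\mathfrak g}$ (level zero) has generators $E_i,F_i,K_i^{\pm1}$, $0\le i\le6$, with commuting $K_i$, $K_iE_jK_i^{-1}=q^{\tilde C_{ij}}E_j$, $K_iF_jK_i^{-1}=q^{-\tilde C_{ij}}F_j$, $[E_i,F_j]=\delta_{ij}\frac{K_i-K_i^{-1}}{q-q^{-1}}$, $q$-Serre relations, and $\prod K_i^{a_i}=1$ ($a_i$ relatively prime positive integers with $\tilde Ca^t=0$). Coproduct: $\Delta K_i=K_i\otimes K_i$, $\Delta E_i=E_i\otimes K_i^{1/2}+K_i^{-1/2}\otimes E_i$, $\Delta F_i=F_i\otimes K_i^{1/2}+K_i^{-1/2}\otimes F_i$. $U_q(E_6)$ is generated by the generators with $i\neq0$; $L_\lambda$ is its irreducible module of highest weight $\lambda$. The module $V(a)=\tilde L_1(a)$ has basis $v_1,\dots,v_{27}$, is $L_{\omega_1}$ as a $U_q(E_6)$-module with $v_1$ of highest weight $\omega_1$, and $F_k v_i=v_j$ for the following arrows $i\to j$ (all other $F_kv_i$ are zero), $E_k$ being the transpose of $F_k$ for $1\le k\le 6$: $F_1$: $1\to2,12\to15,14\to16,17\to18,19\to21,20\to22$;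 $F_2$: $2\to3,10\to12,11\to14,13\to17,21\to23,22\to24$; $F_3$: $3\to4,7\to10,9\to11,17\to19,18\to21,24\to25$; $F_4$: $4\to6,5\to7,11\to13,14\to17,16\to18,25\to26$; $F_5$: $6\to8,7\to9,10\to11,12\to14,15\to16,26\to27$; $F_6$: $4\to5,6\to7,8\to9,19\to20,21\to22,23\to24$. $E_0(a)$ is $a$ times the operator $v_1\mapsto v_{20}$, $v_2\mapsto v_{22}$, $v_3\mapsto v_{24}$, $v_4\mapsto v_{25}$, $v_6\mapsto v_{26}$, $v_8\mapsto v_{27}$, other $v_i\mapsto0$; $F_0(a)$ is the transpose of $a^{-2}E_0(a)$; $K_0$ is $q^{-1}$ on $v_1,v_2,v_3,v_4,v_6,v_8$, $q$ on $v_{27},v_{26},v_{25},v_{24},v_{22},v_{20}$, and $1$ on the other $v_i$. $\check R(z)\in\mathrm{End}(V\otimes V)$ is the unique operator, rational in $z$, which for generic $z$ intertwines $V(z)\otimes V(1)\to V(1)\otimes V(z)$ and fixes $v_1\otimes v_1$. $P^q_\lambda$ is the projector onto $L_\lambda$ along the other summands. $E_{ij}$ are matrix units: $E_{ij}v_k=\delta_{jk}v_i$. Index sets. $I_s$ ($1\le s\le27$) is an ordered list of $10$ pairs; $|(i,j)|\in\{1,\dots,10\}$ is the position of $(i,j)$ in it. Positions $1,\dots,5$ are occupied by the pairs listed below (all with $i<j$), and $(j,i)$ has position $11-|(i,j)|$. Coordinates: $\varepsilon^{q,s}_{ij}=(-q)^{5-|(i,j)|}$ if $i<j$, and $\varepsilon^{q,s}_{ij}=\varepsilon^{q^{-1},s}_{ji}$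 if $i>j$. (The vectors $\sum_{(i,j)\in I_s}\varepsilon_{ij}^{q,s}v_i\otimes v_j$ form a basis of $L_{\omega_5}\subset L_{\omega_1}^{\otimes2}$.) $s=1$: (1,15),(2,12),(3,10),(4,7),(5,6); 2: (1,16),(2,14),(3,11),(4,9),(5,8); 3: (1,18),(2,17),(3,13),(6,9),(7,8); 4: (1,21),(2,19),(4,13),(6,11),(8,10); 5: (1,22),(2,20),(5,13),(7,11),(9,10); 6: (1,23),(3,19),(4,17),(6,14),(8,12); 7: (1,24),(3,20),(5,17),(7,14),(9,12); 8: (2,23),(3,21),(4,18),(6,16),(8,15); 9: (2,24),(3,22),(5,18),(7,16),(9,15); 10: (1,25),(4,20),(5,19),(10,14),(11,12); 11: (2,25),(4,22),(5,21),(10,16),(11,15); 12: (1,26),(6,20),(7,19),(10,17),(12,13); 13: (3,25),(4,24),(5,23),(12,16),(14,15); 14: (2,26),(6,22),(7,21),(10,18),(13,15); 15: (1,27),(8,20),(9,19),(11,17),(13,14); 16: (2,27),(8,22),(9,21),(11,18),(13,16); 17: (3,26),(6,24),(7,23),(12,18),(15,17); 18: (3,27),(8,24),(9,23),(14,18),(16,17); 19: (4,26),(6,25),(10,23),(12,21),(15,19); 20: (5,26),(7,25),(10,24),(12,22),(15,20); 21: (4,27),(8,25),(11,23),(14,21),(16,19); 22: (5,27),(9,25),(11,24),(14,22),(16,20); 23: (6,27),(8,26),(13,23),(17,21),(18,19); 24: (7,27),(9,26),(13,24),(17,22),(18,20); 25: (10,27),(11,26),(13,25),(19,22),(20,21);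 26: (12,27),(14,26),(17,25),(19,24),(20,23); 27: (15,27),(16,26),(18,25),(21,24),(22,23). *)

theory Defs
  imports
    "HOL-Analysis.Analysis"
    "HOL-Computational_Algebra.Polynomial"
    "HOL-Computational_Algebra.Fraction_Field"
begin

section \<open>Matrices on the 27-dimensional space and on its tensor square\<close>

text \<open>
  The index type has exactly the elements \<open>1, \<dots>, 27\<close>; the library's numeral type \<open>27\<close> is not
  used because there \<open>27 = 0\<close>. All data below refer to basis vectors by their natural number
  labels. The space \<open>V\<close> is \<^typ>\<open>complex ^ 'i\<close> for this index type, and \<open>V \<otimes> V\<close> has
  coordinates indexed by pairs, \<open>v\<^sub>i \<otimes> v\<^sub>j\<close> being the basis vector of index \<open>(i, j)\<close>.
\<close>

typedef ix = "{1..27::nat}"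
  morphisms label of_label
  by (rule exI[of _ 1]) simp

instance ix :: finite
proof
  have "inj label"
    by (auto simp: inj_on_def label_inject)
  moreover have "finite (range label)"
    by (rule finite_subset[of _ "{1..27}"]) (use label in auto)
  ultimately show "finite (UNIV :: ix set)"
    by (rule finite_imageD[rotated])
qed

type_synonym 'a op1 = "'a ^ ix ^ ix"
type_synonym 'a op2 = "'a ^ (ix \<times> ix) ^ (ix \<times> ix)"
type_synonym vec2 = "complex ^ (ix \<times> ix)"

definition munit :: "nat \<Rightarrow> nat \<Rightarrow> 'a::zero_neq_one op1" where
  "munit i j = (\<chi> r c. if label r = i \<and> label c = j then 1 else 0)"

definition smult_mat :: "'a::times \<Rightarrow> 'a ^ 'n ^ 'm \<Rightarrow> 'a ^ 'n ^ 'm" (infixr "*\<^sub>k" 75) where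
  "c *\<^sub>k A = (\<chi> r s. c * A $ r $ s)"

definition kron :: "'a::times op1 \<Rightarrow> 'a op1 \<Rightarrow> 'a op2" (infixr "\<otimes>\<^sub>k" 76) where
  "A \<otimes>\<^sub>k B = (\<chi> r c. A $ fst r $ fst c * B $ snd r $ snd c)"

definition vtensor :: "nat \<Rightarrow> nat \<Rightarrow> vec2" where
  "vtensor i j = (\<chi> r. if label (fst r) = i \<and> label (snd r) = j then 1 else 0)"


section \<open>The evaluation module \<open>V(a)\<close>\<close>

text \<open>A pair \<open>(i, j)\<close> in entry \<open>k\<close> is an arrow \<open>i \<rightarrow> j\<close>, that is, \<open>F\<^sub>k v\<^sub>i = v\<^sub>j\<close>.\<close>

definition F_arrows :: "nat \<Rightarrow> (nat \<times> nat) list" where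
  "F_arrows k = [
    [(1,2), (12,15), (14,16), (17,18), (19,21), (20,22)],
    [(2,3), (10,12), (11,14), (13,17), (21,23), (22,24)],
    [(3,4), (7,10), (9,11), (17,19), (18,21), (24,25)],
    [(4,6), (5,7), (11,13), (14,17), (16,18), (25,26)],
    [(6,8), (7,9), (10,11), (12,14), (15,16), (26,27)],
    [(4,5), (6,7), (8,9), (19,20), (21,22), (23,24)]] ! (k - 1)"

definition E0_arrows :: "(nat \<times> nat) list" where
  "E0_arrows = [(1,20), (2,22), (3,24), (4,25), (6,26), (8,27)]"

definition E_op :: "complex \<Rightarrow> nat \<Rightarrow> complex op1" where
  "E_op a k = (if k = 0 then a *\<^sub>k (\<Sum>(i, j)\<in>set E0_arrows. munit j i)
    else transpose (\<Sum>(i, j)\<in>set (F_arrows k). munit j i))"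

definition F_op :: "complex \<Rightarrow> nat \<Rightarrow> complex op1" where
  "F_op a k = (if k = 0 then transpose (inverse (a ^ 2) *\<^sub>k E_op a 0)
    else (\<Sum>(i, j)\<in>set (F_arrows k). munit j i))"

text \<open>
  \<open>K\<^sub>k v\<^sub>j = q\<^bsup>wt k j\<^esup> v\<^sub>j\<close>. For \<open>k \<noteq> 0\<close> the exponents are forced by the structure of
  \<open>L\<^bsub>\<omega>\<^sub>1\<^esub>\<close> as a \<open>U\<^sub>q(E\<^sub>6)\<close>-module, every \<open>F\<^sub>k\<close>-string having length at most two:
  a vector on which \<open>F\<^sub>k\<close> (respectively \<open>E\<^sub>k\<close>) does not vanish has exponent \<open>1\<close> (respectively \<open>-1\<close>).
\<close>

definition wt :: "nat \<Rightarrow> nat \<Rightarrow> int" where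
  "wt k j =
    (if k = 0 then
       (if j \<in> {1, 2, 3, 4, 6, 8} then -1 else if j \<in> {27, 26, 25, 24, 22, 20} then 1 else 0)
     else
       (if j \<in> fst ` set (F_arrows k) then 1 else if j \<in> snd ` set (F_arrows k) then -1 else 0))"

text \<open>\<open>K_op q k\<close> is \<open>K\<^sub>k\<close>; with \<open>qh\<close> the fixed square root of \<open>q\<close>, the operators
  \<open>K_op qh k\<close> and \<open>K_op (inverse qh) k\<close> are \<open>K\<^sub>k\<^bsup>1/2\<^esup>\<close> and \<open>K\<^sub>k\<^bsup>-1/2\<^esup>\<close>.\<close>

definition K_op :: "complex \<Rightarrow> nat \<Rightarrow> complex op1" where
  "K_op t k = (\<chi> r c. if r = c then t powi wt k (label r) else 0)"


section \<open>The action on \<open>V(a) \<otimes> V(b)\<close> and intertwiners\<close>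

definition E2 :: "complex \<Rightarrow> complex \<Rightarrow> complex \<Rightarrow> nat \<Rightarrow> complex op2" where
  "E2 qh a b k = E_op a k \<otimes>\<^sub>k K_op qh k + K_op (inverse qh) k \<otimes>\<^sub>k E_op b k"

definition F2 :: "complex \<Rightarrow> complex \<Rightarrow> complex \<Rightarrow> nat \<Rightarrow> complex op2" where
  "F2 qh a b k = F_op a k \<otimes>\<^sub>k K_op qh k + K_op (inverse qh) k \<otimes>\<^sub>k F_op b k"

definition K2 :: "complex \<Rightarrow> nat \<Rightarrow> complex op2" where
  "K2 qh k = K_op (qh ^ 2) k \<otimes>\<^sub>k K_op (qh ^ 2) k"

definition affine_intertwiner :: "complex \<Rightarrow> complex \<Rightarrow> complex \<Rightarrow> complex op2 \<Rightarrow> bool" where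
  "affine_intertwiner qh a b A \<longleftrightarrow> (\<forall>k\<in>{0..6}.
     A ** E2 qh a b k = E2 qh b a k ** A \<and>
     A ** F2 qh a b k = F2 qh b a k ** A \<and>
     A ** K2 qh k = K2 qh k ** A)"

text \<open>Operators depending rationally on \<open>z\<close> are matrices over the field \<open>\<complex>(z)\<close>. The value at
  \<open>z\<close> is meaningful only where \<open>f\<close> is regular, i.e. outside a finite set of points.\<close>

type_synonym ratfun = "complex poly fract"

definition rconst :: "complex \<Rightarrow> ratfun" where
  "rconst c = Fract [:c:] 1"

definition rvar :: ratfun where
  "rvar = Fract [:0, 1:] 1"

definition reval :: "ratfun \<Rightarrow> complex \<Rightarrow> complex" where
  "reval f z = (THE v. \<exists>n d. f = Fract n d \<and> poly d z \<noteq> 0 \<and> v = poly n z / poly d z)"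

definition normalized_intertwiner :: "complex \<Rightarrow> ratfun op2 \<Rightarrow> bool" where
  "normalized_intertwiner qh R \<longleftrightarrow> (\<forall>\<^sub>F z in cofinite.
     affine_intertwiner qh z 1 (map_matrix (\<lambda>f. reval f z) R) \<and>
     map_matrix (\<lambda>f. reval f z) R *v vtensor 1 1 = vtensor 1 1)"

definition R_check :: "complex \<Rightarrow> ratfun op2" where
  "R_check qh = (THE R. normalized_intertwiner qh R)"


section \<open>The decomposition of \<open>V \<otimes> V\<close> over \<open>U\<^sub>q(E\<^sub>6)\<close>\<close>

text \<open>The generators of \<open>U\<^sub>q(E\<^sub>6)\<close> are those with \<open>k \<noteq> 0\<close>, on which the evaluation parameters have
  no influence. Stability under \<open>K\<^sub>k\<^sup>-\<^sup>1\<close> is automatic in finite dimension.\<close>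

definition submodule2 :: "complex \<Rightarrow> vec2 set \<Rightarrow> bool" where
  "submodule2 qh W \<longleftrightarrow> vec.subspace W \<and> (\<forall>k\<in>{1..6}. \<forall>w\<in>W.
     E2 qh 1 1 k *v w \<in> W \<and> F2 qh 1 1 k *v w \<in> W \<and> K2 qh k *v w \<in> W)"

definition irreducible2 :: "complex \<Rightarrow> vec2 set \<Rightarrow> bool" where
  "irreducible2 qh W \<longleftrightarrow> submodule2 qh W \<and> W \<noteq> {0} \<and>
     (\<forall>U. submodule2 qh U \<longrightarrow> U \<subseteq> W \<longrightarrow> U = {0} \<or> U = W)"

text \<open>An integral weight is given by its coefficients on the fundamental weights.\<close>

definition fund_weight :: "nat \<Rightarrow> nat \<Rightarrow> int" ("\<omega>") where
  "\<omega> i = (\<lambda>k. if k = i then 1 else 0)"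

definition highest_weight_vector :: "complex \<Rightarrow> (nat \<Rightarrow> int) \<Rightarrow> vec2 \<Rightarrow> bool" where
  "highest_weight_vector qh lam w \<longleftrightarrow> w \<noteq> 0 \<and>
     (\<forall>k\<in>{1..6}. E2 qh 1 1 k *v w = 0 \<and> K2 qh k *v w = ((qh ^ 2) powi lam k) *s w)"

definition is_L :: "complex \<Rightarrow> (nat \<Rightarrow> int) \<Rightarrow> vec2 set \<Rightarrow> bool" where
  "is_L qh lam W \<longleftrightarrow> irreducible2 qh W \<and> (\<exists>w\<in>W. highest_weight_vector qh lam w)"

definition L_sub :: "complex \<Rightarrow> (nat \<Rightarrow> int) \<Rightarrow> vec2 set" where
  "L_sub qh lam = (THE W. is_L qh lam W)"

definition two_omega1 :: "nat \<Rightarrow> int" where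
  "two_omega1 = (\<lambda>k. 2 * \<omega> 1 k)"

definition direct_sum3 :: "vec2 set \<Rightarrow> vec2 set \<Rightarrow> vec2 set \<Rightarrow> bool" where
  "direct_sum3 U V W \<longleftrightarrow>
     (\<forall>x. \<exists>!t. fst t \<in> U \<and> fst (snd t) \<in> V \<and> snd (snd t) \<in> W \<and>
                x = fst t + fst (snd t) + snd (snd t))"

definition proj :: "complex \<Rightarrow> (nat \<Rightarrow> int) \<Rightarrow> complex op2" where
  "proj qh lam = (THE P. \<forall>\<mu>\<in>{two_omega1, \<omega> 2, \<omega> 5}. \<forall>w\<in>L_sub qh \<mu>.
     P *v w = (if \<mu> = lam then w else 0))"

abbreviation rproj :: "complex \<Rightarrow> (nat \<Rightarrow> int) \<Rightarrow> ratfun op2" where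
  "rproj qh lam \<equiv> map_matrix rconst (proj qh lam)"


section \<open>The matrix unit formula\<close>

text \<open>The first five pairs of \<open>I\<^sub>s\<close>, for \<open>s = 1, \<dots>, 27\<close>.\<close>

definition I_half :: "nat \<Rightarrow> (nat \<times> nat) list" where
  "I_half s = [
    [(1,15), (2,12), (3,10), (4,7), (5,6)],
    [(1,16), (2,14), (3,11), (4,9), (5,8)],
    [(1,18), (2,17), (3,13), (6,9), (7,8)],
    [(1,21), (2,19), (4,13), (6,11), (8,10)],
    [(1,22), (2,20), (5,13), (7,11), (9,10)],
    [(1,23), (3,19), (4,17), (6,14), (8,12)],
    [(1,24), (3,20), (5,17), (7,14), (9,12)],
    [(2,23), (3,21), (4,18), (6,16), (8,15)],
    [(2,24), (3,22), (5,18), (7,16), (9,15)],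
    [(1,25), (4,20), (5,19), (10,14), (11,12)],
    [(2,25), (4,22), (5,21), (10,16), (11,15)],
    [(1,26), (6,20), (7,19), (10,17), (12,13)],
    [(3,25), (4,24), (5,23), (12,16), (14,15)],
    [(2,26), (6,22), (7,21), (10,18), (13,15)],
    [(1,27), (8,20), (9,19), (11,17), (13,14)],
    [(2,27), (8,22), (9,21), (11,18), (13,16)],
    [(3,26), (6,24), (7,23), (12,18), (15,17)],
    [(3,27), (8,24), (9,23), (14,18), (16,17)],
    [(4,26), (6,25), (10,23), (12,21), (15,19)],
    [(5,26), (7,25), (10,24), (12,22), (15,20)],
    [(4,27), (8,25), (11,23), (14,21), (16,19)],
    [(5,27), (9,25), (11,24), (14,22), (16,20)],
    [(6,27), (8,26), (13,23), (17,21), (18,19)],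
    [(7,27), (9,26), (13,24), (17,22), (18,20)],
    [(10,27), (11,26), (13,25), (19,22), (20,21)],
    [(12,27), (14,26), (17,25), (19,24), (20,23)],
    [(15,27), (16,26), (18,25), (21,24), (22,23)]] ! (s - 1)"

definition I_list :: "nat \<Rightarrow> (nat \<times> nat) list" where
  "I_list s = I_half s @ rev (map prod.swap (I_half s))"

text \<open>The position \<open>|(i, j)|\<close>, counted from 1.\<close>

definition pos :: "nat \<Rightarrow> nat \<times> nat \<Rightarrow> nat" where
  "pos s p = Suc (length (takeWhile (\<lambda>x. x \<noteq> p) (I_list s)))"

definition eps :: "'a::field \<Rightarrow> nat \<Rightarrow> nat \<times> nat \<Rightarrow> 'a" where
  "eps q s = (\<lambda>(i, j). if i < j then (- q) powi (5 - int (pos s (i, j)))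
                        else (- inverse q) powi (5 - int (pos s (j, i))))"

text \<open>In \<open>T_sum\<close> and in the two definitions after it, \<open>q\<close>, \<open>qh\<close> and \<open>z\<close> are elements of one and
  the same field, namely \<open>\<complex>(z)\<close> in the theorem. The sum runs over pairs \<open>(i, k), (j, l) \<in> I\<^sub>s\<close>,
  and its term involves \<open>E\<^sub>i\<^sub>j \<otimes> E\<^sub>k\<^sub>l\<close>.\<close>

definition T_sum :: "(nat \<Rightarrow> nat \<Rightarrow> bool) \<Rightarrow> 'a::field \<Rightarrow> nat \<Rightarrow> 'a op2" where
  "T_sum rel q s =
     (\<Sum>((i, k), (j, l)) \<in> {(x, y). x \<in> set (I_list s) \<and> y \<in> set (I_list s) \<and>
                                   rel (pos s x + pos s y) 11}.
        (eps q s (i, k) * eps q s (j, l)) *\<^sub>k (munit i j \<otimes>\<^sub>k munit k l))"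

definition T_op :: "'a::field \<Rightarrow> 'a \<Rightarrow> 'a \<Rightarrow> 'a op2" where
  "T_op q qh z = (\<Sum>s = 1..27.
     (z * q powi (-4)) *\<^sub>k T_sum (<) q s + (q ^ 4) *\<^sub>k T_sum (>) q s +
     ((qh ^ 7 + qh powi (-7) * z) / (qh + inverse qh)) *\<^sub>k T_sum (=) q s)"

definition R_sl27 :: "'a::field \<Rightarrow> 'a \<Rightarrow> 'a op2" where
  "R_sl27 q z =
     (\<Sum>i = 1..27. munit i i \<otimes>\<^sub>k munit i i)
     + (z * (q - inverse q) / (q - inverse q * z)) *\<^sub>k
         (\<Sum>(i, j) \<in> {(i, j). i \<in> {1..27} \<and> j \<in> {1..27} \<and> i < j}. munit i i \<otimes>\<^sub>k munit j j)
     + ((q - inverse q) / (q - inverse q * z)) *\<^sub>k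
         (\<Sum>(i, j) \<in> {(i, j). i \<in> {1..27} \<and> j \<in> {1..27} \<and> i > j}. munit i i \<otimes>\<^sub>k munit j j)
     + ((1 - z) / (q - inverse q * z)) *\<^sub>k
         (\<Sum>(i, j) \<in> {(i, j). i \<in> {1..27} \<and> j \<in> {1..27} \<and> i \<noteq> j}. munit i j \<otimes>\<^sub>k munit j i)"

end

theory Submission
  imports Defs
begin

text \<open>
  Call the right hand side of the matrix unit formula \<open>R(z)\<close>. The proof has three parts: \<open>R(z)\<close>
  is an intertwiner, every normalized intertwiner is equal to it, and its eigenvalues are the
  coefficients of the spectral formula.

  The module \<open>V\<close> is minuscule, so \<open>E_k\<close> is a partial injection on the basis of \<open>V\<close>, and the weight
  spaces of \<open>V \<otimes> V\<close> are of three kinds: the lines through \<open>v_i \<otimes> v_i\<close>, the planes spanned by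
  \<open>v_i \<otimes> v_j\<close> and \<open>v_j \<otimes> v_i\<close> with \<open>(i, j)\<close> in no \<open>I_s\<close> (called free pairs here), and 27 spaces of
  dimension 10, whose basis vectors are labelled by the pairs of one \<open>I_s\<close> (called blocks). On a
  plane, \<open>R(z)\<close> is the middle block of the R-matrix of affine \<open>sl_2\<close>, and on all blocks it is the same
  10 by 10 matrix, with rows and columns indexed by positions. The operators \<open>E_k\<close> connect these spaces
  in a few patterns only: between a line and a plane, between two planes, between two blocks, and
  between a block and a plane. For each pattern the intertwining property is an identity between
  entries of the local matrices, which holds for all blocks at once (\<open>commute_equal\<close>, \<open>commute_free\<close>,
  \<open>commute_block\<close>). The identities for blocks are \<open>block_entry_shift\<close>, \<open>block_entry_cover_less\<close> and
  \<open>block_entry_cover_greater\<close>. That no other pattern occurs is a finite check on the labels. As \<open>R(z)\<close>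
  is symmetric and \<open>F_k\<close> is a transpose of \<open>E_k\<close>, the relations for \<open>F_k\<close> follow by transposition.

  The decomposition of \<open>V \<otimes> V\<close> is obtained from two facts. First, the vectors killed by
  \<open>E_1, \<dots>, E_6\<close> are the combinations of three explicit vectors, of weights \<open>2 \<omega>_1\<close>, \<open>\<omega>_2\<close>, \<open>\<omega>_5\<close>
  (\<open>singular_decomposition\<close>); so every nonzero submodule contains one of these three vectors. Second, they
  are not isotropic for the bilinear form with orthonormal basis \<open>v_i \<otimes> v_j\<close>, for which \<open>E_k\<close> and \<open>F_k\<close>
  are adjoint. Passing to orthogonal complements, a submodule that contains all three vectors is the whole
  space (\<open>submodule2_eq_UNIV\<close>). The operator \<open>R(0)\<close> commutes with \<open>U_q(E_6)\<close> and has three different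
  eigenvalues on the three vectors. Hence its eigenspaces are irreducible, their sum is direct and equal to
  \<open>V \<otimes> V\<close>, and operators that commute with \<open>U_q(E_6)\<close> act on them by scalars. For \<open>R(z)\<close> the scalars
  are read off from the three vectors, which is the spectral formula (\<open>R_mat_spectral\<close>).

  The difference of two normalized intertwiners acts by scalars, too, and the scalar on the summand
  of \<open>v_1 \<otimes> v_1\<close> is 0. The action of \<open>E_0\<close> leads from this summand to the other two, so that all
  scalars are 0 (\<open>affine_intertwiner_unique\<close>). All this is for one value of \<open>z\<close> outside a finite set,
  and a rational function is determined by such values.
\<close>

section \<open>Tables of the finite data\<close>

text \<open>
  Rewriting rules that replace \<open>1\<close> by \<open>Suc 0\<close> would hide the entries of the tables
  from the simplifier.
\<close>

declare One_nat_def [simp del]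

abbreviation (input) labels :: "nat list" where
  "labels \<equiv> [1,2,3,4,5,6,7,8,9,10,11,12,13,14,15,16,17,18,19,20,21,22,23,24,25,26,27]"

text \<open>
  The pairs \<open>(u, v)\<close> with \<open>E_k v_u = v_v\<close>; for \<open>k = 0\<close> this is up to the evaluation parameter.
\<close>

definition E_arrows :: "nat \<Rightarrow> (nat \<times> nat) list" where
  "E_arrows k = (if k = 0 then E0_arrows else map prod.swap (F_arrows k))"

text \<open>
  The action of \<open>E_k\<close> on labels. It is a partial injection, because \<open>L_{\<omega>_1}\<close> is minuscule: every
  \<open>E_k\<close>-string has at most two elements. This makes every column of \<open>E_k \<otimes> K + K \<otimes> E_k\<close> have at most
  two nonzero entries.
\<close>

definition raise :: "nat \<Rightarrow> nat \<Rightarrow> nat option" where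
  "raise k = map_of (E_arrows k)"

text \<open>
  The automorphism of the affine Dynkin diagram that fixes the nodes 0, 3 and 6. The blocks \<open>I_s\<close>
  are the weights of \<open>L_{\<omega>_5}\<close>, which is \<open>L_{\<omega>_1}\<close> twisted by this automorphism, and they are numbered
  accordingly: \<open>E_k\<close> takes the block \<open>s\<close> to the block \<open>raise (dual k) s\<close>.
\<close>

definition dual :: "nat \<Rightarrow> nat" where
  "dual k = (if k \<in> {1..5} then 6 - k else k)"

text \<open>
  Statements about all labels, all nodes and all positions become conjunctions over explicit lists,
  which are then decided by rewriting with the tables below.
\<close>

lemma all_upto_27: "(\<forall>s\<in>{1..27::nat}. P s) \<longleftrightarrow> list_all P labels"
proof -
  have "{1..27::nat} = set [1..<28]" by auto
  also have "[1..<28] = labels"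
    by (simp add: upt_conv_Cons)
  finally show ?thesis by (simp only: list_all_iff)
qed

lemma all_upto_6: "(\<forall>k\<le>6::nat. P k) \<longleftrightarrow> list_all P [0,1,2,3,4,5,6]"
proof -
  have "(\<forall>k\<le>6::nat. P k) \<longleftrightarrow> (\<forall>k\<in>set [0..<7]. P k)" by auto
  also have "[0..<7] = [0,1,2,3,4,5,6::nat]" by (simp add: upt_conv_Cons)
  finally show ?thesis by (simp only: list_all_iff)
qed

lemma all_below_10: "(\<forall>p<10::nat. P p) \<longleftrightarrow> list_all P [0,1,2,3,4,5,6,7,8,9]"
proof -
  have "(\<forall>k<10::nat. P k) \<longleftrightarrow> (\<forall>k\<in>set [0..<10]. P k)" by auto
  also have "[0..<10] = [0,1,2,3,4,5,6,7,8,9::nat]" by (simp add: upt_conv_Cons)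
  finally show ?thesis by (simp only: list_all_iff)
qed

lemmas I_half_table =
  I_half_def[of 1, simplified] I_half_def[of 2, simplified] I_half_def[of 3, simplified]
  I_half_def[of 4, simplified] I_half_def[of 5, simplified] I_half_def[of 6, simplified]
  I_half_def[of 7, simplified] I_half_def[of 8, simplified] I_half_def[of 9, simplified]
  I_half_def[of 10, simplified] I_half_def[of 11, simplified] I_half_def[of 12, simplified]
  I_half_def[of 13, simplified] I_half_def[of 14, simplified] I_half_def[of 15, simplified]
  I_half_def[of 16, simplified] I_half_def[of 17, simplified] I_half_def[of 18, simplified]
  I_half_def[of 19, simplified] I_half_def[of 20, simplified] I_half_def[of 21, simplified]
  I_half_def[of 22, simplified] I_half_def[of 23, simplified] I_half_def[of 24, simplified]
  I_half_def[of 25, simplified] I_half_def[of 26, simplified] I_half_def[of 27, simplified]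

lemmas I_list_table = I_half_table[THEN arg_cong[where f = "\<lambda>l. l @ rev (map prod.swap l)"],
  folded I_list_def, simplified]

lemmas E_arrows_table =
  E_arrows_def[of 0, unfolded E0_arrows_def, simplified]
  E_arrows_def[of 1, unfolded F_arrows_def, simplified]
  E_arrows_def[of 2, unfolded F_arrows_def, simplified]
  E_arrows_def[of 3, unfolded F_arrows_def, simplified]
  E_arrows_def[of 4, unfolded F_arrows_def, simplified]
  E_arrows_def[of 5, unfolded F_arrows_def, simplified]
  E_arrows_def[of 6, unfolded F_arrows_def, simplified]

text \<open>
  \<open>E_k\<close> moves the left or the right factor of the basis vector with labels \<open>x\<close> and gives the one
  with labels \<open>y\<close>. The other factor has weight 0, so that the coproduct contributes no power of \<open>q\<close>.
\<close>

definition raise_step :: "nat \<Rightarrow> bool \<Rightarrow> nat \<times> nat \<Rightarrow> nat \<times> nat \<Rightarrow> bool" where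
  "raise_step k left x y \<longleftrightarrow>
     (if left then raise k (fst x) = Some (fst y) \<and> snd y = snd x \<and> wt k (snd x) = 0
      else raise k (snd x) = Some (snd y) \<and> fst y = fst x \<and> wt k (fst x) = 0)"

lemma wt_via_arrows:
  assumes "k \<le> 6"
  shows "wt k j = (if j \<in> snd ` set (E_arrows k) then 1
                   else if j \<in> fst ` set (E_arrows k) then -1 else 0)"
proof (cases "k = 0")
  case True
  then show ?thesis by (auto simp: wt_def E_arrows_def E0_arrows_def)
next
  case False
  then have "fst ` set (F_arrows k) = snd ` set (E_arrows k)" "snd ` set (F_arrows k) = fst ` set (E_arrows k)"
    by (simp_all add: E_arrows_def image_image)
  with False show ?thesis by (simp add: wt_def)
qed

lemma arrows_distinct:
  assumes "k \<le> 6"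
  shows "distinct (map fst (E_arrows k) @ map snd (E_arrows k))"
proof -
  have "\<forall>k\<le>6. distinct (map fst (E_arrows k) @ map snd (E_arrows k))"
    unfolding all_upto_6 by (simp add: E_arrows_table)
  with assms show ?thesis by blast
qed

lemma raise_eq_Some: "k \<le> 6 \<Longrightarrow> raise k u = Some v \<longleftrightarrow> (u, v) \<in> set (E_arrows k)"
  using arrows_distinct[of k] by (simp add: raise_def)

lemma raise_eq_None: "k \<le> 6 \<Longrightarrow> raise k u = None \<longleftrightarrow> u \<notin> fst ` set (E_arrows k)"
  by (simp add: raise_def map_of_eq_None_iff)

lemma raise_Some_wt:
  assumes "k \<le> 6" "raise k u = Some v"
  shows "wt k u = -1" "wt k v = 1"
proof -
  have m: "(u, v) \<in> set (E_arrows k)" using assms raise_eq_Some by blast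
  have d: "set (map fst (E_arrows k)) \<inter> set (map snd (E_arrows k)) = {}"
    using arrows_distinct[OF assms(1)] by (simp only: distinct_append)
  from m d show "wt k u = -1" "wt k v = 1" by (force simp: wt_via_arrows[OF assms(1)])+
qed

text \<open>
  Each label is a bottom, a top or a fixed point of \<open>E_k\<close>, and its weight says which.
\<close>

lemma wt_cases:
  assumes "k \<le> 6"
  obtains (bottom) v where "wt k j = -1" "raise k j = Some v"
    | (top) u where "wt k j = 1" "raise k u = Some j" "raise k j = None"
    | (neutral) "wt k j = 0" "raise k j = None"
proof (cases "raise k j")
  case (Some v)
  then show ?thesis using bottom raise_Some_wt[OF assms] by blast
next
  case None
  show ?thesis
  proof (cases "j \<in> snd ` set (E_arrows k)")
    case True
    then obtain u where "(u, j) \<in> set (E_arrows k)" by force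
    with None True show ?thesis using top assms by (simp add: raise_eq_Some wt_via_arrows)
  next
    case False
    with None neutral show ?thesis using assms by (simp add: raise_eq_None wt_via_arrows)
  qed
qed

lemma raise_inj:
  assumes "k \<le> 6" "raise k u = Some v" "raise k u' = Some v"
  shows "u = u'"
proof -
  have "inj_on snd (set (E_arrows k))"
    using arrows_distinct[OF assms(1)] by (simp add: distinct_map)
  with assms show ?thesis by (metis raise_eq_Some inj_onD snd_conv fst_conv)
qed

lemma raise_order:
  assumes "k \<le> 6" "raise k u = Some v"
  shows "u \<in> {1..27}" "v \<in> {1..27}" "if k = 0 then u < v else v < u"
proof -
  have *: "\<forall>k\<le>6. list_all (\<lambda>(u, v). u \<in> {1..27} \<and> v \<in> {1..27} \<and> (if k = 0 then u < v else v < u)) (E_arrows k)"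
    unfolding all_upto_6 by (simp add: E_arrows_table)
  show "u \<in> {1..27}" "v \<in> {1..27}" "if k = 0 then u < v else v < u"
    using *[rule_format, OF assms(1)] assms by (auto simp: list_all_iff raise_eq_Some)
qed

lemma wt_unfold:
  "k \<le> 6 \<Longrightarrow> list_all (\<lambda>j. wt k j =
     (if j \<in> snd ` set (E_arrows k) then 1 else if j \<in> fst ` set (E_arrows k) then -1 else 0)) labels"
  by (simp add: wt_via_arrows)

lemma raise_unfold:
  "list_all (\<lambda>j. raise k j = map_of (E_arrows k) j) labels"
  by (simp add: raise_def)

lemmas wt_table =
  wt_unfold[of 0, unfolded E_arrows_table, simplified]
  wt_unfold[of 1, unfolded E_arrows_table, simplified]
  wt_unfold[of 2, unfolded E_arrows_table, simplified]
  wt_unfold[of 3, unfolded E_arrows_table, simplified]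
  wt_unfold[of 4, unfolded E_arrows_table, simplified]
  wt_unfold[of 5, unfolded E_arrows_table, simplified]
  wt_unfold[of 6, unfolded E_arrows_table, simplified]

lemmas raise_table =
  raise_unfold[of 0, unfolded E_arrows_table, simplified]
  raise_unfold[of 1, unfolded E_arrows_table, simplified]
  raise_unfold[of 2, unfolded E_arrows_table, simplified]
  raise_unfold[of 3, unfolded E_arrows_table, simplified]
  raise_unfold[of 4, unfolded E_arrows_table, simplified]
  raise_unfold[of 5, unfolded E_arrows_table, simplified]
  raise_unfold[of 6, unfolded E_arrows_table, simplified]

lemma dual_table: "dual 0 = 0" "dual 1 = 5" "dual 2 = 4" "dual 3 = 3" "dual 4 = 2" "dual 5 = 1" "dual 6 = 6"
  by (simp_all add: dual_def)

lemma nth10: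
  "[a,b,c,d,e,f,g,h,i,j] ! 0 = a" "[a,b,c,d,e,f,g,h,i,j] ! 1 = b" "[a,b,c,d,e,f,g,h,i,j] ! 2 = c"
  "[a,b,c,d,e,f,g,h,i,j] ! 3 = d" "[a,b,c,d,e,f,g,h,i,j] ! 4 = e" "[a,b,c,d,e,f,g,h,i,j] ! 5 = f"
  "[a,b,c,d,e,f,g,h,i,j] ! 6 = g" "[a,b,c,d,e,f,g,h,i,j] ! 7 = h" "[a,b,c,d,e,f,g,h,i,j] ! 8 = i"
  "[a,b,c,d,e,f,g,h,i,j] ! 9 = j"
  by simp_all

section \<open>The blocks of ten pairs\<close>

text \<open>
  All pairs of \<open>I_s\<close> have the same weight, the weight of the basis vector \<open>s\<close> in the twisted
  representation.
\<close>

lemma half_block_entries: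
  "\<forall>k\<le>6. \<forall>s\<in>{1..27}. list_all (\<lambda>(i, j). wt k i + wt k j = wt (dual k) s) (I_half s)"
  unfolding all_upto_6 all_upto_27 by (simp add: I_half_table wt_table dual_table)

lemma half_block_shape:
  "\<forall>s\<in>{1..27}. length (I_half s) = 5 \<and> distinct (I_half s) \<and>
     list_all (\<lambda>(i, j). 1 \<le> i \<and> i < j \<and> j \<le> 27) (I_half s)"
  unfolding all_upto_27 by (simp add: I_half_table)

lemma weights_separate:
  assumes "s \<in> {1..27}" "t \<in> {1..27}" "\<And>k. k \<le> 6 \<Longrightarrow> wt k s = wt k t"
  shows "s = t"
proof -
  have "\<forall>s\<in>{1..27}. \<forall>t\<in>{1..27}. list_all (\<lambda>k. wt k s = wt k t) [0,1,2,3,4,5,6] \<longrightarrow> s = t"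
    unfolding all_upto_27 by (simp add: wt_table)
  with assms show ?thesis by (simp flip: all_upto_6)
qed

lemma I_list_length: "s \<in> {1..27} \<Longrightarrow> length (I_list s) = 10"
  using half_block_shape by (simp add: I_list_def)

lemma I_list_nth_less_5: "s \<in> {1..27} \<Longrightarrow> p < 5 \<Longrightarrow> I_list s ! p = I_half s ! p"
  using half_block_shape by (simp add: I_list_def nth_append)

lemma I_list_nth_swap:
  assumes "s \<in> {1..27}" "p < 10"
  shows "I_list s ! (9 - p) = prod.swap (I_list s ! p)"
proof -
  have l: "length (I_half s) = 5" using assms half_block_shape by blast
  show ?thesis
  proof (cases "p < 5")
    case True
    then have "\<not> 9 - p < 5" "5 - Suc (9 - p - 5) = p" by auto
    with True l show ?thesis by (simp add: I_list_def nth_append rev_nth)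
  next
    case False
    with assms(2) have "9 - p < 5" "5 - Suc (p - 5) = 9 - p" by auto
    with False l assms(2) show ?thesis by (simp add: I_list_def nth_append rev_nth)
  qed
qed

lemma I_list_nth_order:
  assumes "s \<in> {1..27}" "p < 10" "I_list s ! p = (i, j)"
  shows "i \<in> {1..27}" "j \<in> {1..27}" "i \<noteq> j" "i < j \<longleftrightarrow> p < 5"
proof -
  have h: "1 \<le> fst (I_list s ! r) \<and> fst (I_list s ! r) < snd (I_list s ! r) \<and> snd (I_list s ! r) \<le> 27" if "r < 5" for r
  proof -
    have "list_all (\<lambda>(i, j). 1 \<le> i \<and> i < j \<and> j \<le> 27) (I_half s)" "length (I_half s) = 5"
      using half_block_shape assms(1) by blast+
    with that have "case I_half s ! r of (i, j) \<Rightarrow> 1 \<le> i \<and> i < j \<and> j \<le> 27"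
      by (simp add: list_all_length)
    with that assms(1) show ?thesis by (simp add: I_list_nth_less_5 split: prod.splits)
  qed
  have "i \<in> {1..27} \<and> j \<in> {1..27} \<and> i \<noteq> j \<and> (i < j \<longleftrightarrow> p < 5)"
  proof (cases "p < 5")
    case True
    with h[OF this] assms(3) show ?thesis by auto
  next
    case False
    then have "9 - p < 5" using assms(2) by simp
    from h[OF this] I_list_nth_swap[OF assms(1,2)] False assms(3) show ?thesis by auto
  qed
  then show "i \<in> {1..27}" "j \<in> {1..27}" "i \<noteq> j" "i < j \<longleftrightarrow> p < 5" by auto
qed

lemma I_list_distinct:
  assumes "s \<in> {1..27}"
  shows "distinct (I_list s)"
proof -
  have d: "distinct (I_half s)" and "list_all (\<lambda>(i, j). 1 \<le> i \<and> i < j \<and> j \<le> 27) (I_half s)"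
    using half_block_shape assms by blast+
  then have less: "i < j" if "(i, j) \<in> set (I_half s)" for i j
    using that by (auto simp: list_all_iff)
  have "set (I_half s) \<inter> prod.swap ` set (I_half s) = {}"
  proof -
    have False if "(i, j) \<in> set (I_half s)" "(j, i) \<in> set (I_half s)" for i j
      using less[OF that(1)] less[OF that(2)] by simp
    then show ?thesis by auto
  qed
  with d show ?thesis by (simp add: I_list_def distinct_map)
qed

lemma I_list_set: "s \<in> {1..27} \<Longrightarrow> set (I_list s) = (!) (I_list s) ` {..<10}"
  using I_list_length by (auto simp: set_conv_nth)

lemma I_list_inj: "s \<in> {1..27} \<Longrightarrow> inj_on ((!) (I_list s)) {..<10}"
  using I_list_length I_list_distinct by (auto simp: inj_on_def nth_eq_iff_index_eq)

lemma I_list_swap: "s \<in> {1..27} \<Longrightarrow> (i, j) \<in> set (I_list s) \<longleftrightarrow> (j, i) \<in> set (I_list s)"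
  by (auto simp: I_list_def)

lemma I_list_wt:
  assumes "k \<le> 6" "s \<in> {1..27}" "(i, j) \<in> set (I_list s)"
  shows "wt k i + wt k j = wt (dual k) s"
  using half_block_entries assms by (force simp: I_list_def list_all_iff)

lemma dual_dual: "dual (dual k) = k" and dual_le: "k \<le> 6 \<Longrightarrow> dual k \<le> 6"
  by (auto simp: dual_def)

text \<open>
  Two blocks that share a pair have equal weights at all nodes, and these determine the block.
\<close>

lemma I_list_disjoint:
  assumes "s \<in> {1..27}" "t \<in> {1..27}" "(i, j) \<in> set (I_list s)" "(i, j) \<in> set (I_list t)"
  shows "s = t"
proof (rule weights_separate[OF assms(1,2)])
  fix k :: nat assume "k \<le> 6"
  then show "wt k s = wt k t"
    using I_list_wt[of "dual k" _ i j] assms by (metis dual_dual dual_le)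
qed

lemma pos_nth:
  assumes "s \<in> {1..27}" "p < 10"
  shows "pos s (I_list s ! p) = Suc p"
proof -
  have "takeWhile (\<lambda>x. x \<noteq> I_list s ! p) (I_list s) = take p (I_list s)"
    using assms I_list_length I_list_distinct
    by (intro takeWhile_eq_take_P_nth) (auto simp: nth_eq_iff_index_eq)
  with assms show ?thesis by (simp add: pos_def I_list_length)
qed

text \<open>
  The coordinate \<open>\<epsilon>\<close> of the pair at position \<open>p\<close>, with positions counted from 0 instead of 1. It does not
  depend on the block, so that all blocks can be treated at once.
\<close>

definition coord :: "'a::field \<Rightarrow> nat \<Rightarrow> 'a" where
  "coord q p = (if p < 5 then (- q) ^ (4 - p) else (- inverse q) ^ (p - 5))"

lemma eps_nth:
  assumes "s \<in> {1..27}" "p < 10"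
  shows "eps q s (I_list s ! p) = coord q p"
proof (cases "I_list s ! p")
  case (Pair i j)
  note o = I_list_nth_order[OF assms Pair]
  show ?thesis
  proof (cases "p < 5")
    case True
    have "pos s (i, j) = Suc p" using pos_nth[OF assms] Pair by simp
    then have "5 - int (pos s (i, j)) = int (4 - p)" using True by simp
    then have "(- q) powi (5 - int (pos s (i, j))) = (- q) ^ (4 - p)" by (simp only: power_int_of_nat)
    with True o(4) show ?thesis by (simp add: eps_def coord_def Pair)
  next
    case False
    have "pos s (j, i) = Suc (9 - p)"
      using pos_nth[OF assms(1), of "9 - p"] I_list_nth_swap[OF assms] Pair by simp
    then have "5 - int (pos s (j, i)) = int (p - 5)" using False assms(2) by simp
    then have "(- inverse q) powi (5 - int (pos s (j, i))) = (- inverse q) ^ (p - 5)" by (simp only: power_int_of_nat)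
    with False o(4) show ?thesis by (simp add: eps_def coord_def Pair)
  qed
qed

text \<open>
  The pairs whose weight space in \<open>V \<otimes> V\<close> is spanned by \<open>v_i \<otimes> v_j\<close> and \<open>v_j \<otimes> v_i\<close>. The weight spaces
  of \<open>V \<otimes> V\<close> have dimension 1 (equal labels), 2 (free pairs) or 10 (blocks).
\<close>

definition free :: "nat \<Rightarrow> nat \<Rightarrow> bool" where
  "free i j \<longleftrightarrow> i \<noteq> j \<and> (\<forall>s\<in>{1..27}. (i, j) \<notin> set (I_list s))"

lemma free_sym: "free i j \<longleftrightarrow> free j i"
  unfolding free_def using I_list_swap by blast

section \<open>The raising operators on pairs of labels\<close>

text \<open>
  In a block of \<open>k\<close>-weight 0, exactly four pairs are moved by \<open>E_k\<close>. They occupy the positions \<open>i\<close>, \<open>j\<close>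
  and their mirror images \<open>9 - j\<close>, \<open>9 - i\<close>, and \<open>E_k\<close> sends the first two to one vector and the last two
  to another. For \<open>k \<noteq> 0\<close> the possible \<open>(i, j)\<close> are the covering relations in the upper half of the weight
  poset of the ten-dimensional vector representation of \<open>D_5\<close>, which has the two incomparable elements 4
  and 5 in the middle; \<open>(8, 0)\<close> is the additional edge of the affine diagram.
\<close>

definition covers :: "nat \<Rightarrow> (nat \<times> nat) list" where
  "covers k = (if k = 0 then [(8, 0)] else [(0, 1), (1, 2), (2, 3), (3, 4), (3, 5)])"

lemmas covers_table = covers_def[of 0, simplified] covers_def[of 1, simplified]
  covers_def[of 2, simplified] covers_def[of 3, simplified] covers_def[of 4, simplified]
  covers_def[of 5, simplified] covers_def[of 6, simplified]

text \<open>
  Exchanging the two incomparable positions. Which of the two pairs comes first is a matter of the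
  convention \<open>i < j\<close> in the first half of a block, and \<open>E_k\<close> does not always respect it.
\<close>

definition twist :: "nat \<Rightarrow> nat" where
  "twist p = (if p = 4 then 5 else if p = 5 then 4 else p)"

text \<open>
  How a block of \<open>k\<close>-weight \<open>-1\<close> is moved onto another block. For \<open>k \<noteq> 0\<close> positions are kept, up to
  the twist. \<open>E_0\<close> goes from low to high labels and so exchanges the roles of the two halves.
\<close>

definition shift :: "nat \<Rightarrow> nat \<Rightarrow> nat" where
  "shift k p = (if k = 0 then [5, 6, 7, 8, 0, 9, 1, 2, 3, 4] ! p else p)"

text \<open>
  The positions 0, 1, 2, 3, 5 are those where \<open>E_0\<close> acts on the left factor, which matters because only
  that factor carries the evaluation parameter.
\<close>

definition block_step :: "nat \<Rightarrow> nat \<Rightarrow> nat \<Rightarrow> (nat \<Rightarrow> nat) \<Rightarrow> (nat \<Rightarrow> nat) \<Rightarrow> bool" where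
  "block_step k s t f g \<longleftrightarrow> list_all (\<lambda>p.
     (k = 0 \<longrightarrow> p \<in> {0,1,2,3,5}) \<and> raise_step k True (I_list s ! f p) (I_list t ! g (shift k p)) \<or>
     (k = 0 \<longrightarrow> p \<notin> {0,1,2,3,5}) \<and> raise_step k False (I_list s ! f p) (I_list t ! g (shift k p)))
     [0,1,2,3,4,5,6,7,8,9]"

lemma block_step_all:
  "\<forall>k\<le>6. list_all (\<lambda>(s, t). block_step k s t id id \<or>
     block_step k s t twist (if k = 0 then twist else id)) (E_arrows (dual k))"
  unfolding all_upto_6
  apply (simp only: list.pred_inject E_arrows_table dual_table prod.case)
  apply (simp add: block_step_def)
  apply (simp add: raise_step_def shift_def twist_def)
  apply (simp only: I_list_table nth10)
  apply (simp only: wt_table raise_table fst_conv snd_conv)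
  apply simp
  done

definition block_cover :: "nat \<Rightarrow> nat \<Rightarrow> bool" where
  "block_cover k s \<longleftrightarrow> list_ex (\<lambda>(i, j).
     raise k (fst (I_list s ! j)) = Some (fst (I_list s ! i)) \<and>
     raise k (snd (I_list s ! i)) = Some (snd (I_list s ! j)) \<and>
     fst (I_list s ! j) < snd (I_list s ! i) \<and> fst (I_list s ! i) < snd (I_list s ! j) \<and>
     list_all (\<lambda>p. p = i \<or> p = j \<or> p = 9 - i \<or> p = 9 - j \<or>
       raise k (fst (I_list s ! p)) = None \<and> raise k (snd (I_list s ! p)) = None)
       [0,1,2,3,4,5,6,7,8,9]) (covers k)"

lemma block_cover_all:
  "\<forall>k\<le>6. \<forall>s\<in>{1..27}. if wt (dual k) s = 0 then block_cover k s
     else if wt (dual k) s = 1 then list_all (\<lambda>(i, j). raise k i = None \<and> raise k j = None) (I_half s)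
     else True"
  unfolding all_upto_6 all_upto_27
  apply (simp only: list.pred_inject dual_table wt_table)
  apply simp
  apply (intro conjI TrueI)
  apply (simp_all only: block_cover_def covers_table list_ex_Nil_iff list_ex_Cons_iff prod.case
    list.pred_inject I_half_table I_list_table fst_conv snd_conv raise_table nth10
    option.inject option.distinct HOL.simp_thms)
  apply simp_all
  done

text \<open>
  The matrix entries of the R-matrix at a free pair \<open>(u, l)\<close> depend only on which label is smaller.
  If \<open>l\<close> has weight 0, the raising operators of \<open>E_6\<close> preserve the order, while \<open>E_0\<close> always reverses it.
  The labels for which this fails are in a block together with \<open>u\<close>.
\<close>

lemma neutral_order_all:
  "\<forall>k\<le>6. list_all (\<lambda>(u, v). \<forall>l\<in>{1..27}. wt k l = 0 \<longrightarrow>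
     (if (if k = 0 then u < l \<and> l < v else (u < l) = (v < l)) then True
      else list_ex (\<lambda>s. (u, l) \<in> set (I_list s)) labels)) (E_arrows k)"
  unfolding all_upto_6 all_upto_27
  apply (simp add: wt_table E_arrows_table del: list_ex_Cons_iff)
  apply (simp add: I_list_table)
  done

lemma cover_pairs_all:
  "\<forall>k\<le>6. list_all (\<lambda>(u, v). list_all (\<lambda>(u', v'). u < u' \<longrightarrow>
     v < v' \<and> list_ex (\<lambda>s. list_ex (\<lambda>(i, j). I_list s ! i = (v, u') \<and> I_list s ! j = (u, v')) (covers k))
      labels) (E_arrows k)) (E_arrows k)"
  unfolding all_upto_6
  apply (simp only: E_arrows_table list.pred_inject prod.case)
  apply (simp del: list_ex_Cons_iff)
  apply (intro conjI)
  apply (simp_all only: list_ex_Nil_iff list_ex_Cons_iff covers_table prod.case I_list_table nth10 prod.inject)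
  apply simp_all
  done

lemma covers_bounds:
  assumes "(i, j) \<in> set (covers k)"
  shows "i < 10" "j < 10" "i \<noteq> j" "i \<noteq> 9 - j" "i \<noteq> 9 - i" "j \<noteq> 9 - j"
  using assms by (auto simp: covers_def split: if_splits)

text \<open>
  Blocks of weight \<open>-1\<close>: all ten basis vectors are moved, and their images form another block.
\<close>

lemma block_step_obtain:
  assumes "k \<le> 6" "raise (dual k) s = Some t"
  obtains f g where "f \<in> {id, twist}" "g \<in> {id, twist}"
    "\<And>p. p < 10 \<Longrightarrow> \<exists>left. (k = 0 \<longrightarrow> left = (p \<in> {0,1,2,3,5})) \<and>
       raise_step k left (I_list s ! f p) (I_list t ! g (shift k p))"
proof -
  have "(s, t) \<in> set (E_arrows (dual k))"
    using assms by (simp add: raise_eq_Some dual_le)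
  with block_step_all assms(1)
  have "block_step k s t id id \<or> block_step k s t twist (if k = 0 then twist else id)"
    by (fastforce simp: list_all_iff)
  moreover have step: "\<exists>left. (k = 0 \<longrightarrow> left = (p \<in> {0,1,2,3,5})) \<and>
       raise_step k left (I_list s ! f p) (I_list t ! g (shift k p))"
    if "block_step k s t f g" "p < 10" for f g p
  proof -
    have "\<forall>p<10. (k = 0 \<longrightarrow> p \<in> {0,1,2,3,5}) \<and> raise_step k True (I_list s ! f p) (I_list t ! g (shift k p)) \<or>
     (k = 0 \<longrightarrow> p \<notin> {0,1,2,3,5}) \<and> raise_step k False (I_list s ! f p) (I_list t ! g (shift k p))"
      unfolding all_below_10 using that(1) unfolding block_step_def .
    from this[rule_format, OF that(2)] show ?thesis
    proof (elim disjE)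
      assume "(k = 0 \<longrightarrow> p \<in> {0,1,2,3,5}) \<and> raise_step k True (I_list s ! f p) (I_list t ! g (shift k p))"
      then show ?thesis by (intro exI[of _ True]) simp
    next
      assume "(k = 0 \<longrightarrow> p \<notin> {0,1,2,3,5}) \<and> raise_step k False (I_list s ! f p) (I_list t ! g (shift k p))"
      then show ?thesis by (intro exI[of _ False]) simp
    qed
  qed
  ultimately show ?thesis
  proof (elim disjE)
    assume "block_step k s t id id"
    show ?thesis by (rule that[of id id, OF _ _ step[OF \<open>block_step k s t id id\<close>]]) auto
  next
    assume "block_step k s t twist (if k = 0 then twist else id)"
    show ?thesis by (rule that[of twist "if k = 0 then twist else id", OF _ _ step[OF \<open>block_step k s t twist _\<close>]]) auto
  qed
qed

text \<open>
  Blocks of weight 0: two doublets \<open>u \<rightarrow> v\<close> and \<open>u' \<rightarrow> v'\<close> of \<open>E_k\<close> account for all pairs that are moved.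
\<close>

lemma block_cover_obtain:
  assumes "k \<le> 6" "s \<in> {1..27}" "wt (dual k) s = 0"
  obtains i j u v u' v' where "(i, j) \<in> set (covers k)"
    "raise k u = Some v" "raise k u' = Some v'" "u < u'" "v < v'"
    "I_list s ! i = (v, u')" "I_list s ! j = (u, v')"
    "I_list s ! (9 - j) = (v', u)" "I_list s ! (9 - i) = (u', v)"
    "\<And>p. p < 10 \<Longrightarrow> p \<notin> {i, j, 9 - j, 9 - i} \<Longrightarrow>
       raise k (fst (I_list s ! p)) = None \<and> raise k (snd (I_list s ! p)) = None"
proof -
  have "block_cover k s" using block_cover_all assms by auto
  then obtain i j where ij: "(i, j) \<in> set (covers k)"
    and a: "raise k (fst (I_list s ! j)) = Some (fst (I_list s ! i))"
     "raise k (snd (I_list s ! i)) = Some (snd (I_list s ! j))"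
     "fst (I_list s ! j) < snd (I_list s ! i)" "fst (I_list s ! i) < snd (I_list s ! j)"
    and n: "\<forall>p<10. p = i \<or> p = j \<or> p = 9 - i \<or> p = 9 - j \<or>
       raise k (fst (I_list s ! p)) = None \<and> raise k (snd (I_list s ! p)) = None"
    unfolding block_cover_def list_ex_iff all_below_10 by blast
  note b = covers_bounds[OF ij]
  show ?thesis
  proof (rule that[OF ij a(1,2,3,4)])
    show "I_list s ! (9 - j) = (snd (I_list s ! j), fst (I_list s ! j))"
      "I_list s ! (9 - i) = (snd (I_list s ! i), fst (I_list s ! i))"
      using I_list_nth_swap[OF assms(2)] b by (auto simp: prod.swap_def)
  qed (use n in auto)
qed

text \<open>
  Blocks of weight 1 are killed by \<open>E_k\<close>.
\<close>

lemma block_neutral_or_top: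
  assumes "k \<le> 6" "s \<in> {1..27}" "wt (dual k) s = 1" "p < 10"
  shows "raise k (fst (I_list s ! p)) = None \<and> raise k (snd (I_list s ! p)) = None"
proof -
  have h: "list_all (\<lambda>(i, j). raise k i = None \<and> raise k j = None) (I_half s)"
    using block_cover_all assms by fastforce
  have "I_list s ! p \<in> set (I_list s)" using assms I_list_length by auto
  with h show ?thesis by (auto simp: I_list_def list_all_iff)
qed

lemma free_arrow:
  assumes k: "k \<le> 6" and r: "raise k u = Some v"
  shows "free u v"
proof -
  note w = raise_Some_wt[OF k r]
  have False if s: "s \<in> {1..27}" and m: "(u, v) \<in> set (I_list s)" for s
  proof -
    have "wt (dual k) s = 0" using I_list_wt[OF k s m] w by simp
    from block_cover_obtain[OF k s this] obtain i j u1 v1 u2 v2 where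
      c: "(i, j) \<in> set (covers k)" "raise k u1 = Some v1" "raise k u2 = Some v2" "u1 < u2" "v1 < v2"
      "I_list s ! i = (v1, u2)" "I_list s ! j = (u1, v2)"
      "I_list s ! (9 - j) = (v2, u1)" "I_list s ! (9 - i) = (u2, v1)"
      and n: "\<And>p. p < 10 \<Longrightarrow> p \<notin> {i, j, 9 - j, 9 - i} \<Longrightarrow>
       raise k (fst (I_list s ! p)) = None \<and> raise k (snd (I_list s ! p)) = None" by metis
    from m obtain p where p: "p < 10" "I_list s ! p = (u, v)"
      using I_list_set[OF s] by auto
    have "p \<in> {i, j, 9 - j, 9 - i}" using n[OF p(1)] p(2) r by auto
    then show False
      using c p(2) r w raise_Some_wt(2)[OF k c(2)] raise_Some_wt(2)[OF k c(3)] by auto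
  qed
  moreover have "u \<noteq> v" using w by auto
  ultimately show ?thesis unfolding free_def by blast
qed

lemma wt_range: "k \<le> 6 \<Longrightarrow> wt k j \<in> {-1, 0, 1}"
  by (simp add: wt_via_arrows)

lemma free_same_wt:
  assumes "k \<le> 6" "wt k i = wt k j" "wt k i \<noteq> 0" "i \<noteq> j"
  shows "free i j"
  unfolding free_def
proof (intro conjI ballI notI)
  fix s :: nat assume "s \<in> {1..27}" "(i, j) \<in> set (I_list s)"
  from I_list_wt[OF assms(1) this] have "2 * wt k i = wt (dual k) s" using assms(2) by simp
  with assms(1,3) wt_range[of "dual k" s] wt_range[of k i] show False by (auto simp: dual_le)
qed (use assms in simp)

text \<open>
  If \<open>(v, l)\<close> were in a block, that block would have weight 1 and thus be the image under \<open>E_k\<close> of a block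
  which contains \<open>(u, l)\<close>.
\<close>

lemma free_neutral:
  assumes k: "k \<le> 6" and r: "raise k u = Some v" and l: "l \<in> {1..27}" "wt k l = 0" and f: "free u l"
  shows "free v l" "if k = 0 then u < l \<and> l < v else (u < l) = (v < l)"
proof -
  note w = raise_Some_wt[OF k r]
  have False if t: "t \<in> {1..27}" and m: "(v, l) \<in> set (I_list t)" for t
  proof -
    have "wt (dual k) t = 1" using I_list_wt[OF k t m] w l by simp
    then obtain s where s: "raise (dual k) s = Some t"
      using wt_cases[of "dual k" t] dual_le[OF k] by (metis one_neq_neg_one zero_neq_one)
    obtain f g where fg: "f \<in> {id, twist}" "g \<in> {id, twist}"
      and st: "\<And>p. p < 10 \<Longrightarrow> \<exists>left. (k = 0 \<longrightarrow> left = (p \<in> {0,1,2,3,5})) \<and>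
       raise_step k left (I_list s ! f p) (I_list t ! g (shift k p))"
      using block_step_obtain[OF k s] by metis
    from m obtain p' where p': "p' < 10" "I_list t ! p' = (v, l)"
      using I_list_set[OF t] by auto
    have "\<exists>p<10. f p < 10 \<and> g (shift k p) = p'"
    proof -
      have "\<forall>p'<10. \<exists>p\<in>{0,1,2,3,4,5,6,7,8,9}. f p < 10 \<and> g (shift k p) = p'"
        unfolding all_below_10 using fg
        by (cases "k = 0"; elim insertE emptyE) (simp_all add: shift_def twist_def)
      from this[rule_format, OF p'(1)] obtain p where
        "p \<in> {0,1,2,3,4,5,6,7,8,9}" "f p < 10" "g (shift k p) = p'" by blast
      moreover from this(1) have "p < 10" by auto
      ultimately show ?thesis by blast
    qed
    then obtain p where p: "p < 10" "f p < 10" "g (shift k p) = p'" by blast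
    have s27: "s \<in> {1..27}" using raise_order(1)[OF dual_le[OF k] s] .
    from st[OF p(1)] p(3) p' obtain left where "raise_step k left (I_list s ! f p) (v, l)" by auto
    then have "I_list s ! f p = (u, l)"
    proof (cases left)
      case True
      with \<open>raise_step k left _ _\<close> show ?thesis
        using raise_inj[OF k r] by (auto simp: raise_step_def prod_eq_iff)
    next
      case False
      with \<open>raise_step k left _ _\<close> have "wt k l = 1"
        using raise_Some_wt(2)[OF k] by (auto simp: raise_step_def)
      with l show ?thesis by simp
    qed
    then have "(u, l) \<in> set (I_list s)" using p(2) I_list_length[OF s27] nth_mem by metis
    with f s27 show False by (auto simp: free_def)
  qed
  moreover have "v \<noteq> l" using w l by auto
  ultimately show "free v l" unfolding free_def by blast
  show "if k = 0 then u < l \<and> l < v else (u < l) = (v < l)"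
  proof (rule ccontr)
    assume c: "\<not> ?thesis"
    have "(u, v) \<in> set (E_arrows k)" using r k by (simp add: raise_eq_Some)
    with neutral_order_all k l c
    have "list_ex (\<lambda>s. (u, l) \<in> set (I_list s)) labels"
      by (fastforce simp: list_all_iff simp del: list_ex_Cons_iff)
    then obtain s where "s \<in> set labels"
      and m: "(u, l) \<in> set (I_list s)" unfolding list_ex_iff by blast
    then have "s \<in> {1..27}" by auto
    with m f show False by (auto simp: free_def)
  qed
qed

text \<open>
  Conversely, every two doublets of \<open>E_k\<close> come from a block of weight 0.
\<close>

lemma cover_of_arrows:
  assumes k: "k \<le> 6" and r: "raise k u = Some v" "raise k u' = Some v'" and less: "u < u'"
  obtains s i j where "s \<in> {1..27}" "(i, j) \<in> set (covers k)" "v < v'"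
    "I_list s ! i = (v, u')" "I_list s ! j = (u, v')"
    "I_list s ! (9 - j) = (v', u)" "I_list s ! (9 - i) = (u', v)"
proof -
  have "(u, v) \<in> set (E_arrows k)" "(u', v') \<in> set (E_arrows k)"
    using r k by (simp_all add: raise_eq_Some)
  with cover_pairs_all k less
  have vv: "v < v'" and "list_ex (\<lambda>s. list_ex (\<lambda>(i, j). I_list s ! i = (v, u') \<and> I_list s ! j = (u, v')) (covers k))
      labels"
    unfolding list_all_iff by (fastforce simp del: list_ex_Cons_iff)+
  then obtain s i j where s: "s \<in> set labels"
    and c: "(i, j) \<in> set (covers k)" "I_list s ! i = (v, u')" "I_list s ! j = (u, v')"
    unfolding list_ex_iff by blast
  from s have s': "s \<in> {1..27}" by auto
  show ?thesis
    using that[OF s' c(1) vv c(2,3)] I_list_nth_swap[OF s'] c covers_bounds(1,2)[OF c(1)] by auto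
qed

lemma bottom_top_not_free:
  assumes k: "k \<le> 6" and r: "raise k u = Some v" "raise k u' = Some v'" and ne: "u \<noteq> u'"
  shows "\<not> free u v'"
proof -
  have *: "\<not> free a d \<and> \<not> free b c" if ab: "raise k a = Some c" "raise k b = Some d" "a < b" for a b c d
  proof -
    from cover_of_arrows[OF k ab] obtain s i j where s: "s \<in> {1..27}" and c: "(i, j) \<in> set (covers k)"
      "I_list s ! j = (a, d)" "I_list s ! (9 - i) = (b, c)" by metis
    have "(a, d) \<in> set (I_list s)" "(b, c) \<in> set (I_list s)"
      using c covers_bounds(1,2)[OF c(1)] I_list_length[OF s] nth_mem[of j "I_list s"] nth_mem[of "9 - i" "I_list s"]
      by simp_all
    with s show ?thesis by (auto simp: free_def)
  qed
  show ?thesis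
  proof (cases "u < u'")
    case True
    then show ?thesis using *[OF r] by simp
  next
    case False
    with ne have "u' < u" by simp
    then show ?thesis using *[OF r(2,1)] by simp
  qed
qed

section \<open>The R-matrix on a weight space\<close>

definition diag_less :: "complex \<Rightarrow> complex \<Rightarrow> complex" where
  "diag_less q z = z * (q - inverse q) / (q - inverse q * z)"
definition diag_greater :: "complex \<Rightarrow> complex \<Rightarrow> complex" where
  "diag_greater q z = (q - inverse q) / (q - inverse q * z)"
definition exch :: "complex \<Rightarrow> complex \<Rightarrow> complex" where
  "exch q z = (1 - z) / (q - inverse q * z)"
definition T_coeff :: "complex \<Rightarrow> complex \<Rightarrow> complex" where
  "T_coeff q z = (q - inverse q) * (1 - z) / ((q - inverse q * z) * (q ^ 4 - q powi (-4) * z))"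
text \<open>
  The coefficient of \<open>\<epsilon> \<epsilon>\<close> in \<open>T(z)\<close> for positions counted from 0: the two positions sum to 9 here
  where they sum to 11 in the definition of \<open>T(z)\<close>. The middle coefficient is
  \<open>(q^{7/2} + q^{-7/2} z) / (q^{1/2} + q^{-1/2})\<close> written without square roots.
\<close>

definition T_weight :: "complex \<Rightarrow> complex \<Rightarrow> nat \<Rightarrow> nat \<Rightarrow> complex" where
  "T_weight q z p p' = (if p + p' < 9 then z * q powi (-4) else if p + p' > 9 then q ^ 4
     else (q ^ 4 + inverse q ^ 3 * z) / (1 + q))"
text \<open>
  The R-matrix on the ten-dimensional weight space of a block. It is the same matrix for all blocks.
\<close>

definition block_entry :: "complex \<Rightarrow> complex \<Rightarrow> nat \<Rightarrow> nat \<Rightarrow> complex" where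
  "block_entry q z p p' =
     (if p = p' then (if p < 5 then diag_less q z else diag_greater q z) else 0)
     + (if p + p' = 9 then exch q z else 0)
     - T_coeff q z * T_weight q z p p' * coord q p * coord q p'"

text \<open>
  The factor by which the evaluation parameter enters \<open>E_k\<close>.
\<close>

definition par :: "nat \<Rightarrow> complex \<Rightarrow> complex" where
  "par k a = (if k = 0 then a else 1)"

lemma less_10_cases: "(p::nat) < 10 \<Longrightarrow> p \<in> {0,1,2,3,4,5,6,7,8,9}" by auto

text \<open>
  The poles \<open>z = q^2\<close> and \<open>z = q^8\<close> of the R-matrix are excluded, and \<open>1 + q \<noteq> 0\<close> is needed for the
  middle coefficient of \<open>T(z)\<close>.
\<close>

definition regular :: "complex \<Rightarrow> complex \<Rightarrow> bool" where
  "regular q z \<longleftrightarrow> q \<noteq> 0 \<and> 1 + q \<noteq> 0 \<and> q ^ 2 - z \<noteq> 0 \<and> q ^ 8 - z \<noteq> 0"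

context
  fixes q z :: complex
  assumes reg: "regular q z"
begin

lemma regular_facts: "q \<noteq> 0" "1 + q \<noteq> 0" "q ^ 2 - z \<noteq> 0" "q ^ 8 - z \<noteq> 0"
  using reg by (auto simp: regular_def)

lemma coeffs_simplified:
  "diag_less q z = z * (q ^ 2 - 1) / (q ^ 2 - z)"
  "diag_greater q z = (q ^ 2 - 1) / (q ^ 2 - z)"
  "exch q z = q * (1 - z) / (q ^ 2 - z)"
  "T_coeff q z = q ^ 4 * (q ^ 2 - 1) * (1 - z) / ((q ^ 2 - z) * (q ^ 8 - z))"
proof -
  have e: "q - inverse q * z = (q ^ 2 - z) / q"
    using regular_facts by (simp add: field_simps power2_eq_square)
  have e4: "q ^ 4 - q powi (-4) * z = (q ^ 8 - z) / q ^ 4"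
    using regular_facts by (simp add: field_simps power_int_minus)
  have e1: "q - inverse q = (q ^ 2 - 1) / q"
    using regular_facts by (simp add: field_simps power2_eq_square)
  show "diag_less q z = z * (q ^ 2 - 1) / (q ^ 2 - z)"
    "diag_greater q z = (q ^ 2 - 1) / (q ^ 2 - z)"
    "exch q z = q * (1 - z) / (q ^ 2 - z)"
    "T_coeff q z = q ^ 4 * (q ^ 2 - 1) * (1 - z) / ((q ^ 2 - z) * (q ^ 8 - z))"
    unfolding diag_less_def diag_greater_def exch_def T_coeff_def e e4 e1
    using regular_facts by simp_all
qed

lemma coord_table: "map (coord q) [0,1,2,3,4,5,6,7,8,9] =
  [q ^ 4, - (q ^ 3), q ^ 2, - q, 1, 1, - (1 / q), 1 / q ^ 2, - (1 / q ^ 3), 1 / q ^ 4]"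
  by (simp add: coord_def field_simps)

lemmas coord_values = coord_table[unfolded list.map list.inject]

lemma T_weight_simplified:
  "T_weight q z p p' = (if p + p' < 9 then z / q ^ 4 else if p + p' > 9 then q ^ 4
     else (q ^ 7 + z) / ((1 + q) * q ^ 3))"
  using regular_facts by (auto simp: T_weight_def power_int_minus field_simps)

lemma block_entry_sym: "block_entry q z p p' = block_entry q z p' p"
  by (simp add: block_entry_def T_weight_def add.commute mult.assoc mult.commute)

text \<open>
  The only entries to compare are the diagonal ones at the two middle positions. One of them is of the kind
  for \<open>i < j\<close> and the other one of the kind for \<open>i > j\<close>, but the contributions of \<open>T(z)\<close> make them equal.
\<close>

lemma block_entry_twist:
  assumes "p < 10" "p' < 10"
  shows "block_entry q z (twist p) (twist p') = block_entry q z p p'"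
  using assms[THEN less_10_cases]
  apply (elim insertE emptyE)
  apply (simp_all add: twist_def block_entry_def T_weight_simplified coord_values)
  using regular_facts
  apply (simp_all add: coeffs_simplified divide_simps)
  apply (simp_all add: algebra_simps power_numeral_reduce)
  done

text \<open>
  The intertwining property on a block of weight \<open>-1\<close>. It says that rotating the block multiplies the
  entry by the quotient of the evaluation parameters that \<open>E_0\<close> picks up in its row and its column.
\<close>

lemma block_entry_shift:
  assumes "p < 10" "p' < 10"
  shows "(if p' \<in> {0,1,2,3,5} then par k z else 1) * block_entry q z (shift k p) (shift k p')
   = (if p \<in> {0,1,2,3,5} then 1 else par k z) * block_entry q z p p'"
proof (cases "k = 0")
  case True
  show ?thesis
    unfolding True using assms[THEN less_10_cases]
    apply (elim insertE emptyE)
    apply (simp_all add: par_def shift_def block_entry_def T_weight_simplified coord_values)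
    using regular_facts
    apply (simp_all add: coeffs_simplified divide_simps)
    apply (simp_all add: algebra_simps power_numeral_reduce)
    done
qed (simp add: par_def shift_def)

text \<open>
  The intertwining property between a block of weight 0 and a free pair, together with the next lemma.
  Both directions lead to the same identity, since the block matrix is symmetric: reading it along \<open>p\<close>
  as a column gives \<open>E_k\<close> from the block to the free pair, reading it as a row gives the way back.
\<close>

lemma block_entry_cover_less:
  assumes "p < 10" "(i, j) \<in> set (covers k)"
  shows "par k z * block_entry q z i p + q * block_entry q z j p =
     diag_less q z * ((if p = i then 1 else 0) + par k z * q * (if p = j then 1 else 0))
     + exch q z * ((if p = 9 - j then 1 else 0) + par k z * q * (if p = 9 - i then 1 else 0))"
proof (cases "k = 0")
  case True
  then have ij: "i = 8" "j = 0" using assms(2) by (simp_all add: covers_def)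
  show ?thesis
    unfolding True ij using assms(1)[THEN less_10_cases]
    apply (elim insertE emptyE)
    apply (simp_all add: par_def block_entry_def T_weight_simplified coord_values flip: One_nat_def)
    using regular_facts
    apply (simp_all add: coeffs_simplified divide_simps)
    apply (simp_all add: algebra_simps power_numeral_reduce)
    done
next
  case False
  then have x: "par k z = 1" by (simp add: par_def)
  have "(i, j) \<in> {(0,1),(1,2),(2,3),(3,4),(3,5)}"
    using assms(2) False by (simp add: covers_def)
  then show ?thesis
    unfolding x using assms(1)[THEN less_10_cases]
    apply (elim insertE emptyE)
    apply (simp_all add: par_def block_entry_def T_weight_simplified coord_values flip: One_nat_def)
    using regular_facts
    apply (simp_all add: coeffs_simplified divide_simps)
    apply (simp_all add: algebra_simps power_numeral_reduce)
    done
qed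

lemma block_entry_cover_greater:
  assumes "p < 10" "(i, j) \<in> set (covers k)"
  shows "par k z * block_entry q z (9 - j) p + q * block_entry q z (9 - i) p =
     exch q z * ((if p = i then 1 else 0) + par k z * q * (if p = j then 1 else 0))
     + diag_greater q z * ((if p = 9 - j then 1 else 0) + par k z * q * (if p = 9 - i then 1 else 0))"
proof (cases "k = 0")
  case True
  then have ij: "i = 8" "j = 0" using assms(2) by (simp_all add: covers_def)
  show ?thesis
    unfolding True ij using assms(1)[THEN less_10_cases]
    apply (elim insertE emptyE)
    apply (simp_all add: par_def block_entry_def T_weight_simplified coord_values flip: One_nat_def)
    using regular_facts
    apply (simp_all add: coeffs_simplified divide_simps)
    apply (simp_all add: algebra_simps power_numeral_reduce)
    done
next
  case False
  then have x: "par k z = 1" by (simp add: par_def)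
  have "(i, j) \<in> {(0,1),(1,2),(2,3),(3,4),(3,5)}"
    using assms(2) False by (simp add: covers_def)
  then show ?thesis
    unfolding x using assms(1)[THEN less_10_cases]
    apply (elim insertE emptyE)
    apply (simp_all add: par_def block_entry_def T_weight_simplified coord_values flip: One_nat_def)
    using regular_facts
    apply (simp_all add: coeffs_simplified divide_simps)
    apply (simp_all add: algebra_simps power_numeral_reduce)
    done
qed

text \<open>
  The vector of coordinates \<open>\<epsilon>\<close> is an eigenvector, and its eigenvalue is the coefficient of the
  projector to \<open>L_{\<omega>_5}\<close>.
\<close>

lemma block_entry_eigenvector:
  assumes "p < 10"
  shows "(\<Sum>p'<10. block_entry q z p p' * coord q p') =
    (q powi (-10) * (((1 - q ^ 2 * z) * (1 - q ^ 8 * z)) /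
      ((1 - q powi (-2) * z) * (1 - q powi (-8) * z)))) * coord q p"
proof -
  have e: "{..<10::nat} = {0,1,2,3,4,5,6,7,8,9}" by auto
  have d2: "1 - q powi (-2) * z = (q ^ 2 - z) / q ^ 2" "1 - q powi (-8) * z = (q ^ 8 - z) / q ^ 8"
    using regular_facts by (simp_all add: power_int_minus field_simps)
  show ?thesis
    unfolding e d2 using assms[THEN less_10_cases]
    apply (elim insertE emptyE)
    apply (simp_all add: block_entry_def T_weight_simplified coord_values power_int_minus flip: One_nat_def)
    using regular_facts
    apply (simp_all add: coeffs_simplified divide_simps)
    apply (simp_all add: algebra_simps power_numeral_reduce)
    done
qed

lemma diag_less_greater: "diag_less q z = z * diag_greater q z"
  by (simp add: diag_less_def diag_greater_def)

text \<open>
  The vector \<open>v_i \<otimes> v_j + q v_j \<otimes> v_i\<close> is fixed, for \<open>i < j\<close> free.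
\<close>

lemma R_matrix_sl2:
  "diag_less q z + q * exch q z = 1" "exch q z + q * diag_greater q z = q"
  using regular_facts
  by (simp_all add: coeffs_simplified divide_simps)
     (simp_all add: algebra_simps power2_eq_square)

lemma R_matrix_sl2_affine:
  assumes "if k = 0 then d = diag_greater q z \<and> d' = diag_less q z
           else d = diag_less q z \<and> d' = diag_greater q z"
  shows "par k z * d + q * exch q z = 1" "par k z * exch q z + q * d' = par k z * q"
proof -
  show "par k z * d + q * exch q z = 1"
    using assms R_matrix_sl2(1) by (auto simp: par_def diag_less_greater split: if_splits)
  have "z * exch q z + q * (z * diag_greater q z) = z * (exch q z + q * diag_greater q z)"
    by (simp add: algebra_simps)
  then show "par k z * exch q z + q * d' = par k z * q"
    using assms R_matrix_sl2(2) by (auto simp: par_def diag_less_greater split: if_splits)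
qed

text \<open>
  The vector \<open>v_i \<otimes> v_j - q^{-1} v_j \<otimes> v_i\<close>, for \<open>i < j\<close> free, is an eigenvector with the coefficient of the
  projector to \<open>L_{\<omega>_2}\<close> as its eigenvalue.
\<close>

lemma R_matrix_antisym:
  "diag_less q z - inverse q * exch q z = - (q powi (-2) * ((1 - q ^ 2 * z) / (1 - q powi (-2) * z)))"
  "exch q z - inverse q * diag_greater q z
    = - (q powi (-2) * ((1 - q ^ 2 * z) / (1 - q powi (-2) * z))) * (- inverse q)"
proof -
  have d2: "1 - q powi (-2) * z = (q ^ 2 - z) / q ^ 2"
    using regular_facts by (simp_all add: power_int_minus field_simps)
  show "diag_less q z - inverse q * exch q z = - (q powi (-2) * ((1 - q ^ 2 * z) / (1 - q powi (-2) * z)))"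
   "exch q z - inverse q * diag_greater q z
    = - (q powi (-2) * ((1 - q ^ 2 * z) / (1 - q powi (-2) * z))) * (- inverse q)"
    unfolding d2 using regular_facts
    by (simp_all add: coeffs_simplified power_int_minus divide_simps)
       (simp_all add: algebra_simps power2_eq_square)
qed

end

section \<open>Columns of the operators\<close>

lemma label_range: "label r \<in> {1..27}"
  using label by simp

lemma label_of_label [simp]: "i \<in> {1..27} \<Longrightarrow> label (of_label i) = i"
  by (simp add: of_label_inverse)

lemma label_eq_iff: "i \<in> {1..27} \<Longrightarrow> label r = i \<longleftrightarrow> r = of_label i"
  by (metis label_inverse label_of_label)

lemma mult_vtensor:
  assumes "i \<in> {1..27}" "j \<in> {1..27}"
  shows "(A *v vtensor i j) $ r = A $ r $ (of_label i, of_label j)"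
proof -
  have "label (fst c) = i \<and> label (snd c) = j \<longleftrightarrow> c = (of_label i, of_label j)" for c
    by (simp only: label_eq_iff[OF assms(1)] label_eq_iff[OF assms(2)] prod_eq_iff fst_conv snd_conv)
  then have "(A *v vtensor i j) $ r = (\<Sum>c\<in>UNIV. if c = (of_label i, of_label j) then A $ r $ c else 0)"
    unfolding matrix_vector_mult_def vtensor_def by (simp add: if_distrib cong: if_cong)
  then show ?thesis by simp
qed

lemma vtensor_nth: "vtensor i j $ r = (if label (fst r) = i \<and> label (snd r) = j then 1 else 0)"
  by (simp add: vtensor_def)

lemma op2_eqI:
  fixes A B :: "complex op2"
  assumes "\<And>i j. i \<in> {1..27} \<Longrightarrow> j \<in> {1..27} \<Longrightarrow> A *v vtensor i j = B *v vtensor i j"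
  shows "A = B"
proof -
  have "A $ r $ (c, d) = B $ r $ (c, d)" for r c d
    using arg_cong[OF assms[of "label c" "label d"], of "\<lambda>v. v $ r"] label_range
    by (simp add: mult_vtensor label_inverse)
  then show ?thesis by (auto simp: vec_eq_iff)
qed

lemma kron_munit_vtensor:
  assumes "c \<in> {1..27}" "d \<in> {1..27}"
  shows "(munit i j \<otimes>\<^sub>k munit k l) *v vtensor c d = (if j = c \<and> l = d then vtensor i k else 0)"
  using assms by (auto simp: vec_eq_iff mult_vtensor[OF assms] kron_def munit_def vtensor_nth)

lemma smult_mat_mult: "(c *\<^sub>k A) *v x = c *s (A *v (x :: complex ^ 'n))"
  by (simp add: vec_eq_iff smult_mat_def matrix_vector_mult_def sum_distrib_left mult.assoc)

lemma sum_matrix_mult: "(\<Sum>i\<in>S. A i) *v x = (\<Sum>i\<in>S. A i *v (x :: complex ^ 'n))"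
  by (induction S rule: infinite_finite_induct) (auto simp: matrix_vector_mult_add_rdistrib)

lemma mult_sum_vec: "A *v (\<Sum>i\<in>S. f i) = (\<Sum>i\<in>S. A *v (f i :: complex ^ 'n))"
  by (induction S rule: infinite_finite_induct) (auto simp: matrix_vector_right_distrib)

lemma transpose_sum_munit: "(\<Sum>(i, j)\<in>S. munit j i :: complex op1) $ r $ c
    = (if (label c, label r) \<in> S then 1 else 0)" if "finite S"
proof -
  have "(\<Sum>(i, j)\<in>S. munit j i :: complex op1) $ r $ c
    = (\<Sum>x\<in>S. if x = (label c, label r) then 1 else 0)"
    by (auto simp: munit_def sum_component intro!: sum.cong)
  then show ?thesis using that by simp
qed

lemma E_op_entry:
  assumes "k \<le> 6"
  shows "E_op a k $ r $ c = par k a * (if raise k (label c) = Some (label r) then 1 else 0)"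
proof (cases "k = 0")
  case True
  have "E_op a k $ r $ c = a * (\<Sum>(i, j)\<in>set E0_arrows. munit j i :: complex op1) $ r $ c"
    using True by (simp add: E_op_def smult_mat_def del: sum_component)
  then show ?thesis unfolding transpose_sum_munit[OF finite_set]
    using assms True by (simp add: par_def raise_eq_Some E_arrows_def)
next
  case False
  have "E_op a k $ r $ c = (if (label r, label c) \<in> set (F_arrows k) then 1 else 0)"
    using transpose_sum_munit[OF finite_set, of "F_arrows k" c r] False
    by (simp add: E_op_def transpose_def del: sum_component)
  also have "(label r, label c) \<in> set (F_arrows k) \<longleftrightarrow> (label c, label r) \<in> set (E_arrows k)"
    using False by (force simp: E_arrows_def)
  finally show ?thesis using False assms by (simp add: par_def raise_eq_Some)
qed

definition E2_column :: "complex \<Rightarrow> complex \<Rightarrow> complex \<Rightarrow> nat \<Rightarrow> nat \<Rightarrow> nat \<Rightarrow> vec2" where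
  "E2_column h a b k c d =
     (case raise k c of None \<Rightarrow> 0 | Some c' \<Rightarrow> (par k a * h powi wt k d) *s vtensor c' d)
     + (case raise k d of None \<Rightarrow> 0 | Some d' \<Rightarrow> (par k b * inverse h powi wt k c) *s vtensor c d')"

lemma E2_vtensor:
  assumes "k \<le> 6" "c \<in> {1..27}" "d \<in> {1..27}"
  shows "E2 h a b k *v vtensor c d = E2_column h a b k c d"
proof -
  have 1: "(E_op a k \<otimes>\<^sub>k K_op h k) *v vtensor c d =
     (case raise k c of None \<Rightarrow> 0 | Some c' \<Rightarrow> (par k a * h powi wt k d) *s vtensor c' d)"
    using assms by (auto simp: vec_eq_iff mult_vtensor kron_def E_op_entry K_op_def vtensor_nth
        label_eq_iff split: option.splits)
  have 2: "(K_op (inverse h) k \<otimes>\<^sub>k E_op b k) *v vtensor c d =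
     (case raise k d of None \<Rightarrow> 0 | Some d' \<Rightarrow> (par k b * inverse h powi wt k c) *s vtensor c d')"
    using assms by (auto simp: vec_eq_iff mult_vtensor kron_def E_op_entry K_op_def vtensor_nth
        label_eq_iff split: option.splits)
  show ?thesis by (simp add: E2_def E2_column_def matrix_vector_mult_add_rdistrib 1 2)
qed

lemma K2_vtensor:
  assumes "k \<le> 6" "c \<in> {1..27}" "d \<in> {1..27}"
  shows "K2 h k *v vtensor c d = ((h ^ 2) powi wt k c * (h ^ 2) powi wt k d) *s vtensor c d"
  using assms by (auto simp: K2_def vec_eq_iff mult_vtensor kron_def K_op_def vtensor_nth label_eq_iff)

text \<open>
  The right hand side of the matrix unit formula. It is used over \<open>\<complex>(z)\<close> and over the complex numbers.
\<close>

definition R_mat :: "'a::field \<Rightarrow> 'a \<Rightarrow> 'a \<Rightarrow> 'a op2" where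
  "R_mat q h z = R_sl27 q z
     - ((q - inverse q) * (1 - z) / ((q - inverse q * z) * (q ^ 4 - q powi (-4) * z))) *\<^sub>k T_op q h z"

definition diag_entry :: "complex \<Rightarrow> complex \<Rightarrow> nat \<Rightarrow> nat \<Rightarrow> complex" where
  "diag_entry q z i j = (if i < j then diag_less q z else diag_greater q z)"

lemma sum_kron_munit_vtensor:
  assumes "c \<in> {1..27}" "d \<in> {1..27}" "finite S"
  shows "(\<Sum>(i, j)\<in>S. munit i i \<otimes>\<^sub>k munit j j) *v vtensor c d = (if (c, d) \<in> S then vtensor c d else 0)"
    "(\<Sum>(i, j)\<in>S. munit i j \<otimes>\<^sub>k munit j i) *v vtensor c d = (if (d, c) \<in> S then vtensor d c else 0)"
proof -
  have "(\<Sum>(i, j)\<in>S. munit i i \<otimes>\<^sub>k munit j j) *v vtensor c d = (\<Sum>x\<in>S. if x = (c, d) then vtensor c d else 0)"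
    unfolding sum_matrix_mult
    by (intro sum.cong refl) (auto simp: kron_munit_vtensor[OF assms(1,2)] split: prod.splits)
  then show "(\<Sum>(i, j)\<in>S. munit i i \<otimes>\<^sub>k munit j j) *v vtensor c d = (if (c, d) \<in> S then vtensor c d else 0)"
    using assms(3) by simp
  have "(\<Sum>(i, j)\<in>S. munit i j \<otimes>\<^sub>k munit j i) *v vtensor c d = (\<Sum>x\<in>S. if x = (d, c) then vtensor d c else 0)"
    unfolding sum_matrix_mult
    by (intro sum.cong refl) (auto simp: kron_munit_vtensor[OF assms(1,2)] split: prod.splits)
  then show "(\<Sum>(i, j)\<in>S. munit i j \<otimes>\<^sub>k munit j i) *v vtensor c d = (if (d, c) \<in> S then vtensor d c else 0)"
    using assms(3) by simp
qed

lemma R_sl27_vtensor: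
  assumes "c \<in> {1..27}" "d \<in> {1..27}"
  shows "R_sl27 q z *v vtensor c d = (if c = d then vtensor c c
           else diag_entry q z c d *s vtensor c d + exch q z *s vtensor d c)"
proof -
  have f: "finite {(i, j). i \<in> {1..27::nat} \<and> j \<in> {1..27::nat} \<and> Q i j}" for Q
    by (rule finite_subset[of _ "{1..27} \<times> {1..27}"]) auto
  have "(\<Sum>i = 1..27. munit i i \<otimes>\<^sub>k munit i i) *v vtensor c d
      = (\<Sum>i = 1..27. if i = c then (if c = d then vtensor c c else 0) else 0)"
    unfolding sum_matrix_mult
    by (intro sum.cong refl) (auto simp: kron_munit_vtensor[OF assms])
  also have "\<dots> = (if c = d then vtensor c c else 0)" using assms by simp
  finally show ?thesis
    unfolding R_sl27_def matrix_vector_mult_add_rdistrib smult_mat_mult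
      sum_kron_munit_vtensor[OF assms f]
    using assms by (auto simp: diag_entry_def diag_less_def diag_greater_def exch_def)
qed

lemma T_sum_vtensor_outside:
  assumes "c \<in> {1..27}" "d \<in> {1..27}" "(c, d) \<notin> set (I_list s)"
  shows "T_sum rel q s *v vtensor c d = 0"
  unfolding T_sum_def sum_matrix_mult
  by (rule sum.neutral) (use assms(3) in \<open>auto simp: smult_mat_mult kron_munit_vtensor[OF assms(1,2)]\<close>)

lemma T_sum_vtensor:
  assumes s: "s \<in> {1..27}" and p: "p < 10"
  shows "T_sum rel q s *v case_prod vtensor (I_list s ! p) =
    (\<Sum>p'<10. (if rel (p' + p + 2) 11 then coord q p' * coord q p else 0) *s case_prod vtensor (I_list s ! p'))"
proof -
  obtain c d where cd: "I_list s ! p = (c, d)" by (cases "I_list s ! p")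
  note r = I_list_nth_order(1,2)[OF s p cd]
  have m: "(c, d) \<in> set (I_list s)" using s p cd I_list_length nth_mem by metis
  let ?P = "{(x, y). x \<in> set (I_list s) \<and> y \<in> set (I_list s) \<and> rel (pos s x + pos s y) 11}"
  have fin: "finite ?P"
    by (rule finite_subset[of _ "set (I_list s) \<times> set (I_list s)"]) auto
  have "T_sum rel q s *v vtensor c d = (\<Sum>(x, y)\<in>?P. if y = (c, d) then (eps q s x * eps q s y) *s case_prod vtensor x else 0)"
    unfolding T_sum_def sum_matrix_mult
    by (intro sum.cong refl)
       (auto simp: smult_mat_mult kron_munit_vtensor[OF r] split: prod.splits)
  also have "\<dots> = (\<Sum>(x, y)\<in>set (I_list s) \<times> set (I_list s).
      if y = (c, d) \<and> rel (pos s x + pos s y) 11 then (eps q s x * eps q s y) *s case_prod vtensor x else 0)"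
    by (intro sum.mono_neutral_cong_left) (auto split: if_splits)
  also have "\<dots> = (\<Sum>x\<in>set (I_list s). \<Sum>y\<in>set (I_list s).
      if y = (c, d) then (if rel (pos s x + pos s y) 11 then (eps q s x * eps q s y) *s case_prod vtensor x else 0) else 0)"
    unfolding sum.cartesian_product by (intro sum.cong refl) auto
  also have "\<dots> = (\<Sum>x\<in>set (I_list s). if rel (pos s x + pos s (c, d)) 11
      then (eps q s x * eps q s (c, d)) *s case_prod vtensor x else 0)"
    using m by (intro sum.cong refl) (simp add: sum.delta')
  also have "\<dots> = (\<Sum>p'<10. if rel (pos s (I_list s ! p') + pos s (c, d)) 11
      then (eps q s (I_list s ! p') * eps q s (c, d)) *s case_prod vtensor (I_list s ! p') else 0)"
    unfolding I_list_set[OF s] by (subst sum.reindex[OF I_list_inj[OF s]]) simp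
  also have "\<dots> = (\<Sum>p'<10. (if rel (p' + p + 2) 11 then coord q p' * coord q p else 0) *s case_prod vtensor (I_list s ! p'))"
    by (intro sum.cong refl) (use s p in \<open>auto simp: cd[symmetric] pos_nth eps_nth\<close>)
  finally show ?thesis by (simp add: cd)
qed

lemma T_op_middle_coeff:
  fixes q h z :: complex
  assumes "regular q z" "h ^ 2 = q"
  shows "(h ^ 7 + h powi (-7) * z) / (h + inverse h) = (q ^ 4 + inverse q ^ 3 * z) / (1 + q)"
proof -
  note r = regular_facts[OF assms(1)]
  have h: "h \<noteq> 0" using r(1) assms(2) by auto
  have "1 + h ^ 2 \<noteq> 0" using r(2) assms(2) by simp
  have a: "h + inverse h = (1 + h ^ 2) / h" using h by (simp add: field_simps power2_eq_square)
  have b: "(h ^ 7 + h powi (-7) * z) * h = (h ^ 2) ^ 4 + inverse (h ^ 2) ^ 3 * z"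
    using h by (simp add: power_int_minus field_simps power_numeral_reduce)
  have "(h ^ 7 + h powi (-7) * z) / (h + inverse h) = (h ^ 7 + h powi (-7) * z) * h / (1 + h ^ 2)"
    unfolding a using h by (simp add: divide_simps)
  also have "\<dots> = (q ^ 4 + inverse q ^ 3 * z) / (1 + q)" unfolding b assms(2) ..
  finally show ?thesis .
qed

lemma T_op_vtensor:
  fixes q h z :: complex
  assumes "regular q z" "h ^ 2 = q" "s \<in> {1..27}" "p < 10"
  shows "T_op q h z *v case_prod vtensor (I_list s ! p) =
    (\<Sum>p'<10. (T_weight q z p' p * coord q p' * coord q p) *s case_prod vtensor (I_list s ! p'))"
proof -
  let ?v = "case_prod vtensor (I_list s ! p)"
  let ?S = "\<lambda>rel t. T_sum rel q t *v ?v"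
  let ?e = "\<lambda>t. (z * q powi (-4)) *s ?S (<) t + (q ^ 4) *s ?S (>) t
      + ((q ^ 4 + inverse q ^ 3 * z) / (1 + q)) *s ?S (=) t"
  obtain c d where cd: "I_list s ! p = (c, d)" by (cases "I_list s ! p")
  note r = I_list_nth_order(1,2)[OF assms(3,4) cd]
  have m: "(c, d) \<in> set (I_list s)" using assms cd I_list_length nth_mem by metis
  have other: "?e t = 0" if "t \<in> {1..27}" "t \<noteq> s" for t
  proof -
    have "(c, d) \<notin> set (I_list t)" using I_list_disjoint[OF assms(3) that(1) m] that(2) by blast
    from T_sum_vtensor_outside[OF r this] show ?thesis by (simp add: cd)
  qed
  have "T_op q h z *v ?v = (\<Sum>t = 1..27. ?e t)"
    unfolding T_op_def sum_matrix_mult matrix_vector_mult_add_rdistrib smult_mat_mult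
      T_op_middle_coeff[OF assms(1,2)] ..
  also have "\<dots> = ?e s"
    using other assms(3) by (subst sum.remove[of _ s]) (auto intro!: sum.neutral)
  also have "\<dots> = (\<Sum>p'<10. (T_weight q z p' p * coord q p' * coord q p) *s case_prod vtensor (I_list s ! p'))"
    unfolding T_sum_vtensor[OF assms(3,4)] vec.scale_sum_right sum.distrib[symmetric]
  proof (intro sum.cong refl)
    fix p' :: nat
    let ?w = "case_prod vtensor (I_list s ! p')"
    show "(z * q powi (-4)) *s ((if p' + p + 2 < 11 then coord q p' * coord q p else 0) *s ?w)
      + (q ^ 4) *s ((if p' + p + 2 > 11 then coord q p' * coord q p else 0) *s ?w)
      + ((q ^ 4 + inverse q ^ 3 * z) / (1 + q)) *s ((if p' + p + 2 = 11 then coord q p' * coord q p else 0) *s ?w)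
      = (T_weight q z p' p * coord q p' * coord q p) *s ?w"
      by (cases "p' + p + 2 = 11"; cases "p' + p + 2 < 11") (auto simp: T_weight_def mult.assoc)
  qed
  finally show ?thesis .
qed

lemma T_op_vtensor_outside:
  fixes q h z :: complex
  assumes "c \<in> {1..27}" "d \<in> {1..27}" "\<And>s. s \<in> {1..27} \<Longrightarrow> (c, d) \<notin> set (I_list s)"
  shows "T_op q h z *v vtensor c d = 0"
  unfolding T_op_def sum_matrix_mult matrix_vector_mult_add_rdistrib smult_mat_mult
  by (rule sum.neutral) (use assms in \<open>auto simp: T_sum_vtensor_outside\<close>)

section \<open>Transposition and bookkeeping\<close>

lemma sum_two_deltas:
  fixes g :: "nat \<Rightarrow> complex"
  assumes "i < 10" "j < 10"
  shows "(\<Sum>p<10. g p * (a * (if p = i then 1 else 0) + b * (if p = j then 1 else 0))) = a * g i + b * g j"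
proof -
  have "(\<Sum>p<10. g p * (a * (if p = i then 1 else 0) + b * (if p = j then 1 else 0)))
    = (\<Sum>p<10. if p = i then a * g p else 0) + (\<Sum>p<10. if p = j then b * g p else 0)"
    unfolding sum.distrib[symmetric] by (intro sum.cong refl) (simp add: algebra_simps)
  then show ?thesis using assms by simp
qed

lemma sum_two_delta_vectors:
  fixes w :: "nat \<Rightarrow> complex ^ 'n"
  assumes "i < 10" "j < 10"
  shows "(\<Sum>p<10. (c * (a * (if p = i then 1 else 0) + b * (if p = j then 1 else 0))) *s w p)
    = (c * a) *s w i + (c * b) *s w j"
proof -
  have "(\<Sum>p<10. (c * (a * (if p = i then 1 else 0) + b * (if p = j then 1 else 0))) *s w p)
    = (\<Sum>p<10. if p = i then (c * a) *s w p else 0) + (\<Sum>p<10. if p = j then (c * b) *s w p else 0)"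
    unfolding sum.distrib[symmetric]
    by (intro sum.cong refl) (auto simp: vec.scale_left_distrib algebra_simps)
  then show ?thesis using assms by simp
qed

lemma shift_twist_bij:
  assumes "g \<in> {id, twist}"
  shows "bij_betw g {..<10} {..<10}" "bij_betw (\<lambda>p. g (shift k p)) {..<10} {..<10}"
    "p < 10 \<Longrightarrow> g (g p) = p" "p < 10 \<Longrightarrow> g p < 10" "p < 10 \<Longrightarrow> shift k p < 10"
proof -
  have e: "{..<10::nat} = set [0,1,2,3,4,5,6,7,8,9]" by auto
  have bij: "bij_betw f {..<10} {..<10::nat}" if "set (map f [0,1,2,3,4,5,6,7,8,9]) = {..<10}" for f :: "nat \<Rightarrow> nat"
  proof -
    have "f ` {..<10} = {..<10}" using that unfolding e set_map .
    then show ?thesis by (simp add: bij_betw_def finite_surj_inj)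
  qed
  show b: "bij_betw g {..<10} {..<10}"
    using assms by (intro bij) (auto simp: twist_def e)
  have "bij_betw (shift k) {..<10} {..<10}"
    by (intro bij) (auto simp: shift_def e)
  from bij_betw_trans[OF this b] show "bij_betw (\<lambda>p. g (shift k p)) {..<10} {..<10}"
    by (simp add: o_def)
  from \<open>bij_betw (shift k) {..<10} {..<10}\<close> show "p < 10 \<Longrightarrow> shift k p < 10"
    by (auto simp: bij_betw_def)
  show "p < 10 \<Longrightarrow> g (g p) = p" "p < 10 \<Longrightarrow> g p < 10" using assms by (auto simp: twist_def)
qed

lemma par_1: "par k 1 = 1" by (simp add: par_def)

lemma pair_cases:
  assumes "i \<in> {1..27}" "j \<in> {1..27}"
  obtains (equal) "i = j" | (free) "free i j" | (block) s p where "s \<in> {1..27}" "p < 10" "I_list s ! p = (i, j)"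
  using that assms unfolding free_def by (metis I_list_set imageE lessThan_iff)

lemma transpose_munit: "transpose (munit i j :: 'a::zero_neq_one op1) = munit j i"
  by (auto simp: transpose_def munit_def vec_eq_iff)

lemma transpose_kron: "transpose (A \<otimes>\<^sub>k B) = transpose A \<otimes>\<^sub>k transpose B"
  by (simp add: transpose_def kron_def vec_eq_iff)

lemma transpose_smult_mat: "transpose (c *\<^sub>k A) = c *\<^sub>k transpose A"
  by (simp add: transpose_def smult_mat_def vec_eq_iff)

lemma transpose_add: "transpose (A + B) = transpose A + transpose B"
  by (simp add: transpose_def vec_eq_iff)

lemma transpose_minus: "transpose (A - B) = transpose A - transpose B"
  by (simp add: transpose_def vec_eq_iff)

lemma transpose_sum: "transpose (\<Sum>i\<in>S. A i) = (\<Sum>i\<in>S. transpose (A i))"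
  by (induction S rule: infinite_finite_induct) (simp_all add: transpose_add, simp_all add: transpose_def vec_eq_iff)

text \<open>
  Exchanging the two pairs of the summation index transposes a term and keeps its coefficient.
\<close>

lemma transpose_T_sum:
  fixes q :: "'a::field"
  assumes "\<And>a b. rel (a + b) 11 \<longleftrightarrow> rel (b + a) (11::nat)"
  shows "transpose (T_sum rel q s) = (T_sum rel q s :: 'a op2)"
  unfolding T_sum_def transpose_sum
  by (rule sum.reindex_bij_witness[of _ prod.swap prod.swap])
     (auto simp: transpose_smult_mat transpose_kron transpose_munit mult.commute add.commute)

lemma transpose_R_mat: "transpose (R_mat q h z) = R_mat q h z"
proof -
  have "transpose (\<Sum>(i, j) \<in> {(i, j). i \<in> {1..27} \<and> j \<in> {1..27} \<and> i \<noteq> j}. munit i j \<otimes>\<^sub>k munit j i)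
     = (\<Sum>(i, j) \<in> {(i, j). i \<in> {1..27} \<and> j \<in> {1..27} \<and> i \<noteq> j}. munit i j \<otimes>\<^sub>k munit j i :: 'a op2)"
    unfolding transpose_sum
    by (rule sum.reindex_bij_witness[of _ prod.swap prod.swap]) (auto simp: transpose_kron transpose_munit)
  then show ?thesis
    unfolding R_mat_def R_sl27_def T_op_def transpose_minus transpose_add transpose_smult_mat transpose_sum
    by (simp add: case_prod_unfold transpose_kron transpose_munit transpose_T_sum add.commute)
qed

lemma F_op_eq_transpose: "a \<noteq> 0 \<Longrightarrow> F_op a k = transpose (E_op (inverse a) k)"
  by (simp add: F_op_def E_op_def transpose_smult_mat vec_eq_iff smult_mat_def power2_eq_square)
     (simp add: transpose_def)

text \<open>
  The convention for \<open>F_0(a)\<close> turns it into the transpose of \<open>E_0(a^{-1})\<close>.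
\<close>

lemma F2_eq_transpose:
  assumes "a \<noteq> 0" "b \<noteq> 0"
  shows "F2 h a b k = transpose (E2 h (inverse a) (inverse b) k)"
proof -
  have K: "transpose (K_op t k) = K_op t k" for t
    by (auto simp: transpose_def K_op_def vec_eq_iff)
  show ?thesis
    using assms by (simp add: F2_def E2_def transpose_add transpose_kron F_op_eq_transpose K)
qed

lemma E2_scale: "E2 h (c * a) (c * b) k = par k c *\<^sub>k E2 h a b k"
  by (auto simp: E2_def E_op_def par_def vec_eq_iff smult_mat_def kron_def algebra_simps)

section \<open>The R-matrix is an intertwiner\<close>

context
  fixes q h z :: complex
  assumes reg: "regular q z" and h: "h ^ 2 = q"
begin

lemma h_nonzero: "h \<noteq> 0"
  using regular_facts(1)[OF reg] h by auto

lemma R_mat_split: "R_mat q h z *v x = R_sl27 q z *v x - T_coeff q z *s (T_op q h z *v x)"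
  by (simp add: R_mat_def T_coeff_def matrix_vector_mult_diff_rdistrib smult_mat_mult)

lemma R_mat_equal:
  assumes "i \<in> {1..27}"
  shows "R_mat q h z *v vtensor i i = vtensor i i"
proof -
  have "(i, i) \<notin> set (I_list s)" if s: "s \<in> {1..27}" for s
  proof
    assume "(i, i) \<in> set (I_list s)"
    then obtain p where "p < 10" "I_list s ! p = (i, i)" unfolding I_list_set[OF s] by auto
    from I_list_nth_order(3)[OF s this] show False by simp
  qed
  then have "T_op q h z *v vtensor i i = 0" by (rule T_op_vtensor_outside[OF assms assms])
  then show ?thesis using assms by (simp add: R_mat_split R_sl27_vtensor)
qed

lemma R_mat_free:
  assumes "i \<in> {1..27}" "j \<in> {1..27}" "free i j"
  shows "R_mat q h z *v vtensor i j = diag_entry q z i j *s vtensor i j + exch q z *s vtensor j i"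
proof -
  have "T_op q h z *v vtensor i j = 0"
    using assms by (intro T_op_vtensor_outside) (auto simp: free_def)
  moreover have "i \<noteq> j" using assms(3) by (simp add: free_def)
  ultimately show ?thesis using assms by (simp add: R_mat_split R_sl27_vtensor)
qed

lemma R_mat_block:
  assumes s: "s \<in> {1..27}" and p: "p < 10"
  shows "R_mat q h z *v case_prod vtensor (I_list s ! p) =
    (\<Sum>p'<10. block_entry q z p' p *s case_prod vtensor (I_list s ! p'))"
proof -
  let ?w = "\<lambda>p'. case_prod vtensor (I_list s ! p')"
  obtain c d where cd: "I_list s ! p = (c, d)" by (cases "I_list s ! p")
  note r = I_list_nth_order[OF s p cd]
  have swap: "?w (9 - p) = vtensor d c" using I_list_nth_swap[OF s p] cd by simp
  have "R_sl27 q z *v ?w p = (if p < 5 then diag_less q z else diag_greater q z) *s ?w p + exch q z *s ?w (9 - p)"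
    using r R_sl27_vtensor[OF r(1,2)] by (auto simp: cd swap diag_entry_def)
  also have "\<dots> = (\<Sum>p'<10. (if p' = p then (if p < 5 then diag_less q z else diag_greater q z) else 0) *s ?w p')
      + (\<Sum>p'<10. (if p' = 9 - p then exch q z else 0) *s ?w p')"
    using p by (simp add: if_distrib[of "\<lambda>c. c *s _"] sum.delta cong: if_cong)
  also have "\<dots> = (\<Sum>p'<10. ((if p' = p then (if p < 5 then diag_less q z else diag_greater q z) else 0)
      + (if p' = 9 - p then exch q z else 0)) *s ?w p')"
    by (simp add: vec.scale_left_distrib sum.distrib)
  finally have R: "R_sl27 q z *v ?w p = \<dots>" .
  have T: "T_coeff q z *s (T_op q h z *v ?w p)
     = (\<Sum>p'<10. (T_coeff q z * T_weight q z p' p * coord q p' * coord q p) *s ?w p')"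
    unfolding T_op_vtensor[OF reg h s p] vec.scale_sum_right by (simp add: mult.assoc)
  show ?thesis
    unfolding R_mat_split R T sum_subtractf[symmetric]
  proof (intro sum.cong refl)
    fix p' :: nat assume "p' \<in> {..<10}"
    then have "p' = 9 - p \<longleftrightarrow> p' + p = 9" using p by auto
    then have "(if p' = p then (if p < 5 then diag_less q z else diag_greater q z) else 0)
      + (if p' = 9 - p then exch q z else 0) - T_coeff q z * T_weight q z p' p * coord q p' * coord q p
      = block_entry q z p' p"
      by (simp add: block_entry_def)
    then show "((if p' = p then (if p < 5 then diag_less q z else diag_greater q z) else 0)
      + (if p' = 9 - p then exch q z else 0)) *s ?w p' -
      (T_coeff q z * T_weight q z p' p * coord q p' * coord q p) *s ?w p' = block_entry q z p' p *s ?w p'"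
      by (simp only: vec.scale_left_diff_distrib[symmetric])
  qed
qed

lemma inverse_h_q: "inverse h * q = h" "h * inverse h = 1" "h * h = q" "inverse h * (q * x) = h * x"
  "q * (inverse h * x) = h * x"
  using h h_nonzero by (auto simp: power2_eq_square)

text \<open>
  The following lemmas give \<open>R E_k = E_k' R\<close> on \<open>v_c \<otimes> v_d\<close>, where the evaluation parameter is
  in the left factor for \<open>E_k\<close> and in the right factor for \<open>E_k'\<close>. If the labels are equal, this is the
  intertwining property of the R-matrix of affine \<open>sl_2\<close>.
\<close>

lemma commute_equal:
  assumes k: "k \<le> 6" and c: "c \<in> {1..27}"
  shows "R_mat q h z *v E2_column h z 1 k c c = E2_column h 1 z k c c"
proof (cases rule: wt_cases[OF k, of c])
  case (1 v)
  note o = raise_order[OF k 1(2)]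
  have f: "free v c" "free c v" using free_arrow[OF k 1(2)] free_sym by blast+
  have Rv: "R_mat q h z *v vtensor v c = diag_entry q z v c *s vtensor v c + exch q z *s vtensor c v"
    "R_mat q h z *v vtensor c v = diag_entry q z c v *s vtensor c v + exch q z *s vtensor v c"
    using R_mat_free f o by auto
  have d: "if k = 0 then diag_entry q z v c = diag_greater q z \<and> diag_entry q z c v = diag_less q z
           else diag_entry q z v c = diag_less q z \<and> diag_entry q z c v = diag_greater q z"
    using o(3) by (auto simp: diag_entry_def split: if_splits)
  note id = R_matrix_sl2_affine[OF reg d]
  have "R_mat q h z *v E2_column h z 1 k c c
     = (par k z * inverse h) *s (diag_entry q z v c *s vtensor v c + exch q z *s vtensor c v)
       + h *s (diag_entry q z c v *s vtensor c v + exch q z *s vtensor v c)"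
    using 1 by (simp add: E2_column_def matrix_vector_right_distrib vector_scalar_commute Rv par_1)
  also have "\<dots> = (inverse h * (par k z * diag_entry q z v c + q * exch q z)) *s vtensor v c
      + (inverse h * (par k z * exch q z + q * diag_entry q z c v)) *s vtensor c v"
    by (simp add: vec_eq_iff algebra_simps inverse_h_q)
  also have "\<dots> = E2_column h 1 z k c c"
    unfolding id using 1 by (simp add: E2_column_def par_1 algebra_simps inverse_h_q)
  finally show ?thesis .
qed (simp_all add: E2_column_def)

lemma diag_entry_swap:
  assumes "i \<noteq> j"
  shows "diag_entry q z i j = (if i < j then diag_less q z else diag_greater q z)"
    "diag_entry q z j i = (if i < j then diag_greater q z else diag_less q z)"
  using assms by (auto simp: diag_entry_def)

text \<open>
  Both labels are moved, so that the image lies in a block of weight 0.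
\<close>

lemma commute_bottom_bottom:
  assumes k: "k \<le> 6" and r: "raise k c = Some v" "raise k d = Some v'" and ne: "c \<noteq> d"
  shows "R_mat q h z *v E2_column h z 1 k c d
    = diag_entry q z c d *s E2_column h 1 z k c d + exch q z *s E2_column h 1 z k d c"
proof -
  note w = raise_Some_wt[OF k r(1)] raise_Some_wt[OF k r(2)]
  have E: "E2_column h z 1 k c d = (par k z * inverse h) *s vtensor v d + h *s vtensor c v'"
    "E2_column h 1 z k c d = inverse h *s vtensor v d + (par k z * h) *s vtensor c v'"
    "E2_column h 1 z k d c = inverse h *s vtensor v' c + (par k z * h) *s vtensor d v"
    using r w by (simp_all add: E2_column_def par_1)
  consider "c < d" | "d < c" using ne by linarith
  then show ?thesis
  proof cases
    case 1
    from cover_of_arrows[OF k r 1] obtain s i j where s: "s \<in> {1..27}" and ij: "(i, j) \<in> set (covers k)"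
      and b: "I_list s ! i = (v, d)" "I_list s ! j = (c, v')" "I_list s ! (9 - j) = (v', c)" "I_list s ! (9 - i) = (d, v)"
      by metis
    note bd = covers_bounds[OF ij]
    let ?w = "\<lambda>p. case_prod vtensor (I_list s ! p)"
    have b': "vtensor v d = ?w i" "vtensor c v' = ?w j" "vtensor v' c = ?w (9 - j)" "vtensor d v = ?w (9 - i)"
      using b by simp_all
    have "R_mat q h z *v E2_column h z 1 k c d
        = (par k z * inverse h) *s (\<Sum>p<10. block_entry q z p i *s ?w p) + h *s (\<Sum>p<10. block_entry q z p j *s ?w p)"
      unfolding E b' using R_mat_block[OF s] bd
      by (simp only: matrix_vector_right_distrib vector_scalar_commute)
    also have "\<dots> = (\<Sum>p<10. (inverse h * (par k z * block_entry q z i p + q * block_entry q z j p)) *s ?w p)"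
      unfolding vec.scale_sum_right sum.distrib[symmetric] vec.scale_scale
        vec.scale_left_distrib[symmetric]
      by (intro sum.cong refl arg_cong2[where f = "(*s)"])
         (simp add: algebra_simps inverse_h_q block_entry_sym[OF reg, of _ i] block_entry_sym[OF reg, of _ j])
    also have "\<dots> = (\<Sum>p<10. ((inverse h * diag_less q z) * (1 * (if p = i then 1 else 0) + (par k z * q) * (if p = j then 1 else 0))) *s ?w p)
        + (\<Sum>p<10. ((inverse h * exch q z) * (1 * (if p = 9 - j then 1 else 0) + (par k z * q) * (if p = 9 - i then 1 else 0))) *s ?w p)"
      unfolding sum.distrib[symmetric] vec.scale_left_distrib[symmetric]
      by (intro sum.cong refl arg_cong2[where f = "(*s)"])
         (use block_entry_cover_less[OF reg _ ij] in \<open>simp add: algebra_simps\<close>)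
    also have "\<dots> = diag_entry q z c d *s E2_column h 1 z k c d + exch q z *s E2_column h 1 z k d c"
      using bd 1 unfolding E b'
      by (subst (1 2) sum_two_delta_vectors) (auto simp: vec.scale_right_distrib diag_entry_def algebra_simps inverse_h_q)
    finally show ?thesis .
  next
    case 2
    from cover_of_arrows[OF k r(2,1) 2] obtain s i j where s: "s \<in> {1..27}" and ij: "(i, j) \<in> set (covers k)"
      and b: "I_list s ! i = (v', c)" "I_list s ! j = (d, v)" "I_list s ! (9 - j) = (v, d)" "I_list s ! (9 - i) = (c, v')"
      by metis
    note bd = covers_bounds[OF ij]
    let ?w = "\<lambda>p. case_prod vtensor (I_list s ! p)"
    have b': "vtensor v d = ?w (9 - j)" "vtensor c v' = ?w (9 - i)" "vtensor v' c = ?w i" "vtensor d v = ?w j"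
      using b by simp_all
    have "R_mat q h z *v E2_column h z 1 k c d
        = (par k z * inverse h) *s (\<Sum>p<10. block_entry q z p (9 - j) *s ?w p) + h *s (\<Sum>p<10. block_entry q z p (9 - i) *s ?w p)"
      unfolding E b' using R_mat_block[OF s, of "9 - j"] R_mat_block[OF s, of "9 - i"]
      by (simp add: matrix_vector_right_distrib vector_scalar_commute)
    also have "\<dots> = (\<Sum>p<10. (inverse h * (par k z * block_entry q z (9 - j) p + q * block_entry q z (9 - i) p)) *s ?w p)"
      unfolding vec.scale_sum_right sum.distrib[symmetric] vec.scale_scale
        vec.scale_left_distrib[symmetric]
      by (intro sum.cong refl arg_cong2[where f = "(*s)"])
         (simp add: algebra_simps inverse_h_q block_entry_sym[OF reg, of _ "9 - i"] block_entry_sym[OF reg, of _ "9 - j"])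
    also have "\<dots> = (\<Sum>p<10. ((inverse h * exch q z) * (1 * (if p = i then 1 else 0) + (par k z * q) * (if p = j then 1 else 0))) *s ?w p)
        + (\<Sum>p<10. ((inverse h * diag_greater q z) * (1 * (if p = 9 - j then 1 else 0) + (par k z * q) * (if p = 9 - i then 1 else 0))) *s ?w p)"
      unfolding sum.distrib[symmetric] vec.scale_left_distrib[symmetric]
      by (intro sum.cong refl arg_cong2[where f = "(*s)"])
         (use block_entry_cover_greater[OF reg _ ij] in \<open>simp add: algebra_simps\<close>)
    also have "\<dots> = diag_entry q z c d *s E2_column h 1 z k c d + exch q z *s E2_column h 1 z k d c"
      using bd 2 unfolding E b'
      by (subst (1 2) sum_two_delta_vectors) (auto simp: vec.scale_right_distrib diag_entry_def algebra_simps inverse_h_q)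
    finally show ?thesis .
  qed
qed

text \<open>
  The pair is moved to another free pair. As \<open>diag_less = z diag_greater\<close>, the reversal of order
  under \<open>E_0\<close> is compensated by the evaluation parameter.
\<close>

lemma commute_bottom_neutral:
  assumes k: "k \<le> 6" and r: "raise k c = Some v" and d: "d \<in> {1..27}" "wt k d = 0" "raise k d = None" and f: "free c d"
  shows "R_mat q h z *v E2_column h z 1 k c d
      = diag_entry q z c d *s E2_column h 1 z k c d + exch q z *s E2_column h 1 z k d c"
    "R_mat q h z *v E2_column h z 1 k d c
      = diag_entry q z d c *s E2_column h 1 z k d c + exch q z *s E2_column h 1 z k c d"
proof -
  note n = free_neutral[OF k r d(1,2) f]
  note o = raise_order[OF k r]
  have E: "E2_column h z 1 k c d = par k z *s vtensor v d" "E2_column h 1 z k c d = vtensor v d"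
    "E2_column h z 1 k d c = vtensor d v" "E2_column h 1 z k d c = par k z *s vtensor d v"
    using r d by (simp_all add: E2_column_def par_1)
  have ne: "v \<noteq> d" "c \<noteq> d" using n(1) f by (auto simp: free_def)
  have e: "par k z * diag_entry q z v d = diag_entry q z c d" "diag_entry q z d v = par k z * diag_entry q z d c"
    using n(2) ne by (auto simp: diag_entry_swap par_def diag_less_greater[OF reg] diag_entry_def split: if_splits)
  have Rv: "R_mat q h z *v vtensor v d = diag_entry q z v d *s vtensor v d + exch q z *s vtensor d v"
    "R_mat q h z *v vtensor d v = diag_entry q z d v *s vtensor d v + exch q z *s vtensor v d"
    using R_mat_free n(1) free_sym[of v d] o d by auto
  show "R_mat q h z *v E2_column h z 1 k c d
      = diag_entry q z c d *s E2_column h 1 z k c d + exch q z *s E2_column h 1 z k d c"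
    unfolding E e(1)[symmetric] by (simp add: vector_scalar_commute Rv vec.scale_right_distrib mult.commute)
  show "R_mat q h z *v E2_column h z 1 k d c
      = diag_entry q z d c *s E2_column h 1 z k d c + exch q z *s E2_column h 1 z k c d"
    unfolding E Rv e(2) by (simp add: mult.commute)
qed

text \<open>
  The pair is a doublet and is sent to a multiple of \<open>v_v \<otimes> v_v\<close>.
\<close>

lemma commute_bottom_top:
  assumes k: "k \<le> 6" and r: "raise k c = Some v"
  shows "R_mat q h z *v E2_column h z 1 k c v
      = diag_entry q z c v *s E2_column h 1 z k c v + exch q z *s E2_column h 1 z k v c"
    "R_mat q h z *v E2_column h z 1 k v c
      = diag_entry q z v c *s E2_column h 1 z k v c + exch q z *s E2_column h 1 z k c v"
proof -
  note o = raise_order[OF k r]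
  note w = raise_Some_wt[OF k r]
  have vn: "raise k v = None"
    using w raise_Some_wt(1)[OF k, of v] by (cases "raise k v") auto
  have E: "E2_column h z 1 k c v = (par k z * h) *s vtensor v v" "E2_column h 1 z k c v = h *s vtensor v v"
    "E2_column h z 1 k v c = inverse h *s vtensor v v" "E2_column h 1 z k v c = (par k z * inverse h) *s vtensor v v"
    using r w vn by (simp_all add: E2_column_def par_1)
  have d: "if k = 0 then diag_entry q z v c = diag_greater q z \<and> diag_entry q z c v = diag_less q z
           else diag_entry q z v c = diag_less q z \<and> diag_entry q z c v = diag_greater q z"
    using o(3) by (auto simp: diag_entry_def split: if_splits)
  note id = R_matrix_sl2_affine[OF reg d]
  have "R_mat q h z *v E2_column h z 1 k c v = (inverse h * (par k z * q)) *s vtensor v v"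
    unfolding E vector_scalar_commute R_mat_equal[OF o(2)] by (simp add: inverse_h_q algebra_simps)
  also have "\<dots> = diag_entry q z c v *s E2_column h 1 z k c v + exch q z *s E2_column h 1 z k v c"
    unfolding E id(2)[symmetric] vec.scale_scale vec.scale_left_distrib[symmetric]
    by (intro arg_cong2[where f = "(*s)"] refl) (simp add: algebra_simps inverse_h_q)
  finally show "R_mat q h z *v E2_column h z 1 k c v
      = diag_entry q z c v *s E2_column h 1 z k c v + exch q z *s E2_column h 1 z k v c" .
  have "R_mat q h z *v E2_column h z 1 k v c = (inverse h * (par k z * diag_entry q z v c + q * exch q z)) *s vtensor v v"
    unfolding E vector_scalar_commute R_mat_equal[OF o(2)] id(1) by simp
  also have "\<dots> = diag_entry q z v c *s E2_column h 1 z k v c + exch q z *s E2_column h 1 z k c v"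
    unfolding E vec.scale_scale vec.scale_left_distrib[symmetric]
    by (intro arg_cong2[where f = "(*s)"] refl) (simp add: algebra_simps inverse_h_q)
  finally show "R_mat q h z *v E2_column h z 1 k v c
      = diag_entry q z v c *s E2_column h 1 z k v c + exch q z *s E2_column h 1 z k c v" .
qed

text \<open>
  A free pair with one label moved and the other one a top must be a single doublet, because the
  pairs coming from two different doublets lie in blocks.
\<close>

lemma commute_free:
  assumes k: "k \<le> 6" and c: "c \<in> {1..27}" and d: "d \<in> {1..27}" and f: "free c d"
  shows "R_mat q h z *v E2_column h z 1 k c d
    = diag_entry q z c d *s E2_column h 1 z k c d + exch q z *s E2_column h 1 z k d c"
proof -
  have ne: "c \<noteq> d" and f': "free d c" using f free_sym by (auto simp: free_def)
  show ?thesis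
  proof (cases rule: wt_cases[OF k, of c])
    case (1 v)
    show ?thesis
    proof (cases rule: wt_cases[OF k, of d])
      case d1: (1 v')
      show ?thesis using commute_bottom_bottom[OF k 1(2) d1(2) ne] .
    next
      case d2: (2 u)
      then have "u = c" using bottom_top_not_free[OF k 1(2) d2(2)] f by blast
      then show ?thesis using commute_bottom_top(1)[OF k 1(2)] 1 d2 by simp
    next
      case d3: 3
      show ?thesis using commute_bottom_neutral(1)[OF k 1(2) d d3 f] .
    qed
  next
    case c2: (2 u)
    show ?thesis
    proof (cases rule: wt_cases[OF k, of d])
      case d1: (1 v')
      then have "d = u" using bottom_top_not_free[OF k d1(2) c2(2)] f' by blast
      then show ?thesis using commute_bottom_top(2)[OF k d1(2)] c2 d1 by simp
    qed (use c2 in \<open>simp_all add: E2_column_def\<close>)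
  next
    case c3: 3
    show ?thesis
    proof (cases rule: wt_cases[OF k, of d])
      case d1: (1 v')
      show ?thesis using commute_bottom_neutral(2)[OF k d1(2) c c3 f'] .
    qed (use c3 in \<open>simp_all add: E2_column_def\<close>)
  qed
qed

text \<open>
  With the two target vectors as a basis, \<open>E_k\<close> is given by the two rows of coefficients at the
  positions \<open>i, j\<close> and \<open>9 - j, 9 - i\<close>.
\<close>

lemma commute_block_cover:
  assumes k: "k \<le> 6" and s: "s \<in> {1..27}" "wt (dual k) s = 0" and p: "p < 10"
  shows "R_mat q h z *v case_prod (E2_column h z 1 k) (I_list s ! p)
    = (\<Sum>p'<10. block_entry q z p' p *s case_prod (E2_column h 1 z k) (I_list s ! p'))"
proof -
  note hq = inverse_h_q
  from block_cover_obtain[OF k s] obtain i j u v u' v' where ij: "(i, j) \<in> set (covers k)"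
    and r: "raise k u = Some v" "raise k u' = Some v'" and less: "u < u'" "v < v'"
    and b: "I_list s ! i = (v, u')" "I_list s ! j = (u, v')"
      "I_list s ! (9 - j) = (v', u)" "I_list s ! (9 - i) = (u', v)"
    and rest: "\<And>p. p < 10 \<Longrightarrow> p \<notin> {i, j, 9 - j, 9 - i} \<Longrightarrow>
       raise k (fst (I_list s ! p)) = None \<and> raise k (snd (I_list s ! p)) = None"
    by metis
  note bd = covers_bounds[OF ij]
  note w = raise_Some_wt[OF k r(1)] raise_Some_wt[OF k r(2)]
  have top: "raise k v = None" "raise k v' = None"
    using w raise_Some_wt(1)[OF k, of v] raise_Some_wt(1)[OF k, of v']
    by (cases "raise k v"; cases "raise k v'"; auto)+
  let ?x = "vtensor v v'" and ?y = "vtensor v' v"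
  let ?d = "\<lambda>p i j a b. a * (if p = i then 1 else 0) + b * (if p = j then 1 else 0) :: complex"
  have E: "case_prod (E2_column h a b k) (I_list s ! p)
      = (inverse h * ?d p i j (par k b) (par k a * q)) *s ?x
        + (inverse h * ?d p (9 - j) (9 - i) (par k b) (par k a * q)) *s ?y"
    if "p < 10" for a b p
  proof -
    have ne: "i \<noteq> 9 - j" "j \<noteq> 9 - i" "i \<noteq> 9 - i" "j \<noteq> 9 - j" "i \<noteq> j" "9 - i \<noteq> 9 - j"
      using bd by auto
    consider "p = i" | "p = j" | "p = 9 - j" | "p = 9 - i" | "p \<notin> {i, j, 9 - j, 9 - i}" by blast
    then show ?thesis
    proof cases
      case 5
      then show ?thesis using rest[OF that]
        by (cases "I_list s ! p") (simp add: E2_column_def)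
    qed (use b r w top ne in \<open>simp_all add: E2_column_def hq algebra_simps\<close>)
  qed
  have Rx: "R_mat q h z *v ?x = diag_less q z *s ?x + exch q z *s ?y"
    "R_mat q h z *v ?y = exch q z *s ?x + diag_greater q z *s ?y"
  proof -
    have "free v v'" "free v' v"
      using free_same_wt[OF k, of v v'] free_same_wt[OF k, of v' v] w less by auto
    then show "R_mat q h z *v ?x = diag_less q z *s ?x + exch q z *s ?y"
      "R_mat q h z *v ?y = exch q z *s ?x + diag_greater q z *s ?y"
      using R_mat_free raise_order[OF k r(1)] raise_order[OF k r(2)] less
      by (auto simp: diag_entry_def add.commute)
  qed
  have "R_mat q h z *v case_prod (E2_column h z 1 k) (I_list s ! p)
     = (inverse h * ?d p i j 1 (par k z * q)) *s (diag_less q z *s ?x + exch q z *s ?y)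
       + (inverse h * ?d p (9 - j) (9 - i) 1 (par k z * q)) *s (exch q z *s ?x + diag_greater q z *s ?y)"
    unfolding E[OF p] matrix_vector_right_distrib vector_scalar_commute Rx par_1 ..
  also have "\<dots> = (inverse h * (diag_less q z * ?d p i j 1 (par k z * q)
         + exch q z * ?d p (9 - j) (9 - i) 1 (par k z * q))) *s ?x
     + (inverse h * (exch q z * ?d p i j 1 (par k z * q)
         + diag_greater q z * ?d p (9 - j) (9 - i) 1 (par k z * q))) *s ?y"
    by (simp add: vec_eq_iff algebra_simps)
  also have "diag_less q z * ?d p i j 1 (par k z * q) + exch q z * ?d p (9 - j) (9 - i) 1 (par k z * q)
      = par k z * block_entry q z i p + q * block_entry q z j p"
    using block_entry_cover_less[OF reg p ij] by simp
  also have "exch q z * ?d p i j 1 (par k z * q) + diag_greater q z * ?d p (9 - j) (9 - i) 1 (par k z * q)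
      = par k z * block_entry q z (9 - j) p + q * block_entry q z (9 - i) p"
    using block_entry_cover_greater[OF reg p ij] by simp
  also have "(inverse h * (par k z * block_entry q z i p + q * block_entry q z j p)) *s ?x
      + (inverse h * (par k z * block_entry q z (9 - j) p + q * block_entry q z (9 - i) p)) *s ?y
    = (\<Sum>p'<10. block_entry q z p' p *s case_prod (E2_column h 1 z k) (I_list s ! p'))"
  proof -
    have "(\<Sum>p'<10. block_entry q z p' p *s case_prod (E2_column h 1 z k) (I_list s ! p'))
      = (\<Sum>p'<10. (inverse h * (block_entry q z p' p * ?d p' i j (par k z) q)) *s ?x
         + (inverse h * (block_entry q z p' p * ?d p' (9 - j) (9 - i) (par k z) q)) *s ?y)"
      by (intro sum.cong refl) (simp add: E par_1 vec_eq_iff algebra_simps)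
    also have "\<dots> = (inverse h * (\<Sum>p'<10. block_entry q z p' p * ?d p' i j (par k z) q)) *s ?x
       + (inverse h * (\<Sum>p'<10. block_entry q z p' p * ?d p' (9 - j) (9 - i) (par k z) q)) *s ?y"
      by (simp only: sum.distrib vec.scale_sum_left sum_distrib_left)
    also have "(\<Sum>p'<10. block_entry q z p' p * ?d p' i j (par k z) q)
        = par k z * block_entry q z i p + q * block_entry q z j p"
      by (rule sum_two_deltas) (use bd in auto)
    also have "(\<Sum>p'<10. block_entry q z p' p * ?d p' (9 - j) (9 - i) (par k z) q)
        = par k z * block_entry q z (9 - j) p + q * block_entry q z (9 - i) p"
      by (rule sum_two_deltas) (use bd in auto)
    finally show ?thesis by simp
  qed
  finally show ?thesis .
qed

text \<open>
  Both blocks are reindexed by the same positions. Then \<open>E_k\<close> becomes diagonal and the block matrix is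
  replaced by its shifted version.
\<close>

lemma commute_block_step:
  assumes k: "k \<le> 6" and s: "s \<in> {1..27}" "wt (dual k) s = -1" and p: "p < 10"
  shows "R_mat q h z *v case_prod (E2_column h z 1 k) (I_list s ! p)
    = (\<Sum>p'<10. block_entry q z p' p *s case_prod (E2_column h 1 z k) (I_list s ! p'))"
proof -
  obtain t where t: "raise (dual k) s = Some t"
    using wt_cases[of "dual k" s] dual_le[OF k] s(2) by (metis one_neq_neg_one zero_neq_neg_one)
  have t27: "t \<in> {1..27}" using raise_order(2)[OF dual_le[OF k] t] .
  obtain f g where fg: "f \<in> {id, twist}" "g \<in> {id, twist}"
    and st: "\<And>p. p < 10 \<Longrightarrow> \<exists>left. (k = 0 \<longrightarrow> left = (p \<in> {0,1,2,3,5})) \<and>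
       raise_step k left (I_list s ! f p) (I_list t ! g (shift k p))"
    using block_step_obtain[OF k t] by metis
  let ?L = "\<lambda>p. p \<in> {0,1,2,3,5::nat}"
  let ?w = "\<lambda>p. case_prod vtensor (I_list t ! g (shift k p))"
  note f = shift_twist_bij[OF fg(1)] and g = shift_twist_bij[OF fg(2)]
  have E: "case_prod (E2_column h a b k) (I_list s ! f r) = (if ?L r then par k a else par k b) *s ?w r"
    if "r < 10" for a b r
  proof -
    obtain c d c' d' where cd: "I_list s ! f r = (c, d)" "I_list t ! g (shift k r) = (c', d')"
      by (metis surj_pair)
    from st[OF that] obtain left where l: "k = 0 \<longrightarrow> left = ?L r" "raise_step k left (c, d) (c', d')"
      unfolding cd by blast
    have neutral: "wt k x = 0 \<Longrightarrow> raise k x = None" for x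
      using raise_Some_wt(1)[OF k, of x] by (cases "raise k x") auto
    have "E2_column h a b k c d = (if left then par k a else par k b) *s vtensor c' d'"
      using l(2) neutral by (auto simp: raise_step_def E2_column_def)
    then show ?thesis using l(1) unfolding cd by (auto simp: par_def)
  qed
  define r where "r = f p"
  have r: "r < 10" "f r = p" using f(3,4)[OF p] by (auto simp: r_def)
  have "R_mat q h z *v case_prod (E2_column h z 1 k) (I_list s ! p)
     = (if ?L r then par k z else 1) *s (\<Sum>p'<10. block_entry q z p' (g (shift k r)) *s case_prod vtensor (I_list t ! p'))"
    using E[OF r(1), of z 1] R_mat_block[OF t27, of "g (shift k r)"] g(4,5) r
    by (simp add: vector_scalar_commute par_1)
  also have "(\<Sum>p'<10. block_entry q z p' (g (shift k r)) *s case_prod vtensor (I_list t ! p'))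
      = (\<Sum>p'<10. block_entry q z (g (shift k p')) (g (shift k r)) *s ?w p')"
    by (rule sum.reindex_bij_betw[OF g(2), symmetric])
  also have "\<dots> = (\<Sum>p'<10. block_entry q z (shift k p') (shift k r) *s ?w p')"
    by (intro sum.cong refl) (use fg(2) g(5) r(1) block_entry_twist[OF reg] in auto)
  also have "(if ?L r then par k z else 1) *s \<dots>
      = (\<Sum>p'<10. ((if ?L p' then 1 else par k z) * block_entry q z p' r) *s ?w p')"
    unfolding vec.scale_sum_right vec.scale_scale
    by (intro sum.cong refl arg_cong2[where f = "(*s)"] block_entry_shift[OF reg]) (use r(1) in auto)
  also have "\<dots> = (\<Sum>p'<10. block_entry q z (f p') (f r) *s case_prod (E2_column h 1 z k) (I_list s ! f p'))"
    by (intro sum.cong refl) (use E[of _ 1 z] fg(1) r(1) block_entry_twist[OF reg] in \<open>auto simp: par_1 mult.commute\<close>)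
  also have "\<dots> = (\<Sum>p'<10. block_entry q z p' p *s case_prod (E2_column h 1 z k) (I_list s ! p'))"
    unfolding r(2) by (rule sum.reindex_bij_betw[OF f(1), where g = "\<lambda>p'. block_entry q z p' p *s case_prod (E2_column h 1 z k) (I_list s ! p')"])
  finally show ?thesis .
qed

lemma commute_block:
  assumes k: "k \<le> 6" and s: "s \<in> {1..27}" and p: "p < 10"
  shows "R_mat q h z *v case_prod (E2_column h z 1 k) (I_list s ! p)
    = (\<Sum>p'<10. block_entry q z p' p *s case_prod (E2_column h 1 z k) (I_list s ! p'))"
proof -
  consider "wt (dual k) s = -1" | "wt (dual k) s = 0" | "wt (dual k) s = 1"
    using wt_range[OF dual_le[OF k]] by blast
  then show ?thesis
  proof cases
    case 3
    have "case_prod (E2_column h a b k) (I_list s ! p') = 0" if "p' < 10" for a b p'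
      using block_neutral_or_top[OF k s 3 that] by (cases "I_list s ! p'") (simp add: E2_column_def)
    with p show ?thesis by simp
  qed (use commute_block_step commute_block_cover k s p in auto)
qed

lemma R_mat_commutes_E2:
  assumes k: "k \<le> 6"
  shows "R_mat q h z ** E2 h z 1 k = E2 h 1 z k ** R_mat q h z"
proof (rule op2_eqI, unfold matrix_vector_mul_assoc[symmetric])
  fix c d :: nat assume c: "c \<in> {1..27}" and d: "d \<in> {1..27}"
  note E = E2_vtensor[OF k]
  show "R_mat q h z *v (E2 h z 1 k *v vtensor c d) = E2 h 1 z k *v (R_mat q h z *v vtensor c d)"
  proof (cases rule: pair_cases[OF c d])
    case 1
    then show ?thesis
      using commute_equal[OF k c] c by (simp add: E R_mat_equal)
  next
    case 2
    then show ?thesis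
      using commute_free[OF k c d] c d
      by (simp add: E R_mat_free matrix_vector_right_distrib vector_scalar_commute)
  next
    case (3 s p)
    have "E2 h 1 z k *v (R_mat q h z *v vtensor c d)
      = (\<Sum>p'<10. block_entry q z p' p *s (E2 h 1 z k *v case_prod vtensor (I_list s ! p')))"
      using R_mat_block[OF 3(1,2)] 3(3) by (simp add: mult_sum_vec vector_scalar_commute)
    also have "\<dots> = (\<Sum>p'<10. block_entry q z p' p *s case_prod (E2_column h 1 z k) (I_list s ! p'))"
    proof (intro sum.cong refl arg_cong2[where f = "(*s)"])
      fix p' :: nat assume "p' \<in> {..<10}"
      then show "E2 h 1 z k *v case_prod vtensor (I_list s ! p') = case_prod (E2_column h 1 z k) (I_list s ! p')"
        using I_list_nth_order(1,2)[OF 3(1), of p'] E by (cases "I_list s ! p'") auto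
    qed
    finally show ?thesis using commute_block[OF k 3(1,2)] 3(3) E[OF c d] by simp
  qed
qed

text \<open>
  Transposing the relation for \<open>E_k\<close> gives the one for \<open>F_k\<close>, as the R-matrix is symmetric. The
  evaluation parameters are inverted, but a common factor of both of them only multiplies
  the operators by a scalar.
\<close>

lemma R_mat_commutes_F2:
  assumes k: "k \<le> 6" and z: "z \<noteq> 0"
  shows "R_mat q h z ** F2 h z 1 k = F2 h 1 z k ** R_mat q h z"
proof -
  have F: "F2 h z 1 k = par k (inverse z) *\<^sub>k transpose (E2 h 1 z k)"
    "F2 h 1 z k = par k (inverse z) *\<^sub>k transpose (E2 h z 1 k)"
    using F2_eq_transpose[of z 1 h k] F2_eq_transpose[of 1 z h k]
      E2_scale[of h "inverse z" 1 z k] E2_scale[of h "inverse z" z 1 k] z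
    by (simp_all add: transpose_smult_mat)
  have mult: "A ** (c *\<^sub>k B) = c *\<^sub>k (A ** B)" "(c *\<^sub>k A) ** B = c *\<^sub>k (A ** B)" for A B :: "complex op2" and c
    by (simp_all add: matrix_matrix_mult_def smult_mat_def vec_eq_iff sum_distrib_left algebra_simps)
  have "R_mat q h z ** transpose (E2 h 1 z k) = transpose (E2 h z 1 k) ** R_mat q h z"
    using arg_cong[OF R_mat_commutes_E2[OF k], of transpose]
    by (simp add: matrix_transpose_mul transpose_R_mat)
  then show ?thesis unfolding F mult by simp
qed

lemma R_mat_commutes_K2:
  assumes k: "k \<le> 6"
  shows "R_mat q h z ** K2 h k = K2 h k ** R_mat q h z"
proof (rule op2_eqI, unfold matrix_vector_mul_assoc[symmetric])
  fix c d :: nat assume c: "c \<in> {1..27}" and d: "d \<in> {1..27}"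
  note K = K2_vtensor[OF k]
  have q: "q \<noteq> 0" using regular_facts[OF reg] by simp
  show "R_mat q h z *v (K2 h k *v vtensor c d) = K2 h k *v (R_mat q h z *v vtensor c d)"
  proof (cases rule: pair_cases[OF c d])
    case 1
    then show ?thesis using c by (simp add: K vector_scalar_commute R_mat_equal)
  next
    case 2
    then show ?thesis using c d
      by (simp add: K vector_scalar_commute R_mat_free matrix_vector_right_distrib
          vec.scale_right_distrib mult.commute mult.left_commute)
  next
    case (3 s p)
    have "K2 h k *v case_prod vtensor (I_list s ! p') = q powi wt (dual k) s *s case_prod vtensor (I_list s ! p')"
      if "p' < 10" for p'
    proof (cases "I_list s ! p'")
      case (Pair i j)
      have "(i, j) \<in> set (I_list s)" using Pair that 3(1) I_list_length nth_mem by metis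
      from I_list_wt[OF k 3(1) this] have "q powi wt k i * q powi wt k j = q powi wt (dual k) s"
        using q by (simp flip: power_int_add)
      with K[OF I_list_nth_order(1,2)[OF 3(1) that Pair]] show ?thesis by (simp add: Pair h)
    qed
    note K' = this
    have "K2 h k *v (R_mat q h z *v vtensor c d)
       = (\<Sum>p'<10. block_entry q z p' p *s (K2 h k *v case_prod vtensor (I_list s ! p')))"
      using R_mat_block[OF 3(1,2)] 3(3) by (simp add: mult_sum_vec vector_scalar_commute)
    also have "\<dots> = q powi wt (dual k) s *s (\<Sum>p'<10. block_entry q z p' p *s case_prod vtensor (I_list s ! p'))"
      unfolding vec.scale_sum_right by (intro sum.cong refl) (simp add: K' mult.commute)
    finally show ?thesis
      using K'[OF 3(2)] R_mat_block[OF 3(1,2)] 3(3) by (simp add: vector_scalar_commute)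
  qed
qed

lemma R_mat_intertwines:
  assumes "z \<noteq> 0"
  shows "affine_intertwiner h z 1 (R_mat q h z)"
  using R_mat_commutes_E2 R_mat_commutes_F2 R_mat_commutes_K2 assms
  by (auto simp: affine_intertwiner_def)

end

lemma finite_generators:
  assumes "k \<noteq> 0"
  shows "E2 h a b k = E2 h 1 1 k" "F2 h a b k = F2 h 1 1 k"
  using assms by (simp_all add: E2_def F2_def E_op_def F_op_def)

section \<open>The contravariant form\<close>

text \<open>
  The bilinear form with orthonormal basis \<open>v_i \<otimes> v_j\<close>, without complex conjugation. As \<open>F_k\<close> is the
  transpose of \<open>E_k\<close> for \<open>k \<noteq> 0\<close>, the orthogonal complement of a submodule is a submodule.
\<close>

definition bil :: "complex ^ 'n \<Rightarrow> complex ^ 'n \<Rightarrow> complex" where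
  "bil x y = (\<Sum>r\<in>UNIV. x $ r * y $ r)"

lemma bil_add_left: "bil (x + y) w = bil x w + bil y w"
  and bil_add_right: "bil w (x + y) = bil w x + bil w y"
  and bil_scale_left: "bil (c *s x) w = c * bil x w"
  and bil_scale_right: "bil w (c *s x) = c * bil w x"
  and bil_zero_left: "bil 0 w = 0"
  and bil_zero_right: "bil w 0 = 0"
  and bil_diff_left: "bil (x - y) w = bil x w - bil y w"
  and bil_diff_right: "bil w (x - y) = bil w x - bil w y"
  by (simp_all add: bil_def sum.distrib sum_subtractf sum_distrib_left algebra_simps)

lemmas bil_simps = bil_add_left bil_add_right bil_scale_left bil_scale_right bil_zero_left bil_zero_right
  bil_diff_left bil_diff_right

lemma bil_sum_left: "bil (\<Sum>i\<in>S. f i) w = (\<Sum>i\<in>S. bil (f i) w)"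
  by (induction S rule: infinite_finite_induct) (simp_all add: bil_simps)

lemma bil_transpose: "bil (A *v x) y = bil x (transpose A *v y)"
proof -
  have "bil (A *v x) y = (\<Sum>r\<in>UNIV. \<Sum>c\<in>UNIV. A $ r $ c * x $ c * y $ r)"
    by (simp add: bil_def matrix_vector_mult_def sum_distrib_right)
  also have "\<dots> = (\<Sum>c\<in>UNIV. \<Sum>r\<in>UNIV. A $ r $ c * x $ c * y $ r)"
    by (rule sum.swap)
  also have "\<dots> = bil x (transpose A *v y)"
    by (simp add: bil_def matrix_vector_mult_def transpose_def sum_distrib_left mult_ac)
  finally show ?thesis .
qed

lemma bil_vtensor_left:
  assumes "i \<in> {1..27}" "j \<in> {1..27}"
  shows "bil (vtensor i j) y = y $ (of_label i, of_label j)"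
proof -
  have "label (fst r) = i \<and> label (snd r) = j \<longleftrightarrow> r = (of_label i, of_label j)" for r
    by (simp only: label_eq_iff[OF assms(1)] label_eq_iff[OF assms(2)] prod_eq_iff fst_conv snd_conv)
  then have "bil (vtensor i j) y = (\<Sum>r\<in>UNIV. if r = (of_label i, of_label j) then y $ r else 0)"
    unfolding bil_def by (intro sum.cong refl) (simp add: vtensor_nth)
  then show ?thesis by simp
qed

text \<open>
  For a proper subspace there is a nonzero linear map vanishing on it, and each row of its matrix is
  orthogonal to the subspace.
\<close>

lemma subspace_UNIV_if_perp_trivial:
  fixes S :: "(complex ^ 'n) set"
  assumes "vec.subspace S" and "\<And>y. (\<And>x. x \<in> S \<Longrightarrow> bil x y = 0) \<Longrightarrow> y = 0"
  shows "S = UNIV"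
proof (rule ccontr)
  assume "S \<noteq> UNIV"
  then obtain v where v: "v \<notin> S" by blast
  obtain B where B: "B \<subseteq> S" "vec.independent B" "S \<subseteq> vec.span B"
    using vec.maximal_independent_subset by metis
  have "vec.span B \<subseteq> S" using vec.span_minimal[OF B(1) assms(1)] .
  then have "v \<notin> vec.span B" using v by blast
  then have "vec.independent (insert v B)" using B(2) by (rule vec.independent_insertI)
  from vec.linear_independent_extend[OF this, of "\<lambda>x. if x = v then (1 :: complex ^ 'n) else 0"]
  obtain g :: "complex ^ 'n \<Rightarrow> complex ^ 'n" where lin: "Vector_Spaces.linear (*s) (*s) g"
    and g: "\<forall>x\<in>insert v B. g x = (if x = v then 1 else 0)" by blast
  define A where "A = matrix g"
  have A: "A *v x = g x" for x by (simp add: A_def matrix_works[OF lin])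
  have zero: "A *v x = 0" if "x \<in> S" for x
  proof -
    have "vec.subspace {x. A *v x = 0}"
      by (auto simp: vec.subspace_def matrix_vector_right_distrib vector_scalar_commute)
    moreover have "B \<subseteq> {x. A *v x = 0}"
      using g B(1) v by (auto simp: A)
    ultimately show ?thesis using vec.span_minimal B(3) that by blast
  qed
  \<comment> \<open>All rows of the matrix act alike, so that any one of them is a witness.\<close>
  obtain r :: 'n where True by simp
  have "bil x (A $ r) = (A *v x) $ r" for x
    by (simp add: bil_def matrix_vector_mult_def mult.commute)
  then have "A $ r = 0" using assms(2)[of "A $ r"] zero by simp
  moreover have "(A *v v) $ r = 1" using g by (simp add: A)
  ultimately show False by (simp add: matrix_vector_mult_def)
qed

section \<open>Eigenvectors of the R-matrix\<close>

definition weights3 :: "(nat \<Rightarrow> int) set" where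
  "weights3 = {two_omega1, \<omega> 2, \<omega> 5}"

lemma weights3_distinct:
  "two_omega1 \<noteq> \<omega> 2" "two_omega1 \<noteq> \<omega> 5" "\<omega> 2 \<noteq> \<omega> 5"
proof -
  show "two_omega1 \<noteq> \<omega> 2" "two_omega1 \<noteq> \<omega> 5"
    by (auto simp: fun_eq_iff two_omega1_def fund_weight_def intro!: exI[of _ 1])
  show "\<omega> 2 \<noteq> \<omega> 5" by (auto simp: fun_eq_iff fund_weight_def intro!: exI[of _ 2])
qed

text \<open>
  The coefficients of the three projectors in the spectral formula.
\<close>

definition eig :: "complex \<Rightarrow> complex \<Rightarrow> (nat \<Rightarrow> int) \<Rightarrow> complex" where
  "eig q z lam =
     (if lam = two_omega1 then 1
      else if lam = \<omega> 2 then - (q powi (-2) * ((1 - q ^ 2 * z) / (1 - q powi (-2) * z)))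
      else q powi (-10) * (((1 - q ^ 2 * z) * (1 - q ^ 8 * z)) /
            ((1 - q powi (-2) * z) * (1 - q powi (-8) * z))))"

text \<open>
  The vectors that span \<open>L_{\<omega>_5}\<close>.
\<close>

definition block_vec :: "complex \<Rightarrow> nat \<Rightarrow> vec2" where
  "block_vec q s = (\<Sum>p<10. coord q p *s case_prod vtensor (I_list s ! p))"

text \<open>
  The highest weight vectors of the three summands. The pair (1, 2) is free, and 1 is the highest
  of the 27 blocks.
\<close>

definition hw_vec :: "complex \<Rightarrow> (nat \<Rightarrow> int) \<Rightarrow> vec2" where
  "hw_vec q lam =
     (if lam = two_omega1 then vtensor 1 1
      else if lam = \<omega> 2 then vtensor 1 2 - inverse q *s vtensor 2 1
      else block_vec q 1)"

text \<open>
  At \<open>z = 0\<close> the R-matrix is an operator commuting with \<open>U_q(E_6)\<close> that separates the three summands.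
  Its eigenspaces serve as explicit models of these.
\<close>

definition eigspace :: "complex \<Rightarrow> complex \<Rightarrow> (nat \<Rightarrow> int) \<Rightarrow> vec2 set" where
  "eigspace q h lam = {x. R_mat q h 0 *v x = eig q 0 lam *s x}"

lemma R_mat_block_vec:
  assumes reg: "regular q z" and h: "h ^ 2 = q" and s: "s \<in> {1..27}"
  shows "R_mat q h z *v block_vec q s = eig q z (\<omega> 5) *s block_vec q s"
proof -
  let ?w = "\<lambda>p. case_prod vtensor (I_list s ! p)"
  have "R_mat q h z *v block_vec q s = (\<Sum>p<10. coord q p *s (\<Sum>p'<10. block_entry q z p' p *s ?w p'))"
    unfolding block_vec_def mult_sum_vec vector_scalar_commute
    by (intro sum.cong refl) (simp add: R_mat_block[OF reg h s])
  also have "\<dots> = (\<Sum>p'<10. (\<Sum>p<10. block_entry q z p' p * coord q p) *s ?w p')"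
    unfolding vec.scale_sum_right vec.scale_sum_left vec.scale_scale
    by (subst sum.swap) (simp add: mult.commute)
  also have "\<dots> = (\<Sum>p'<10. (eig q z (\<omega> 5) * coord q p') *s ?w p')"
    using weights3_distinct
    by (intro sum.cong refl) (simp add: block_entry_eigenvector[OF reg] eig_def)
  finally show ?thesis by (simp add: block_vec_def vec.scale_sum_right)
qed

lemma R_mat_antisymmetric:
  assumes reg: "regular q z" and h: "h ^ 2 = q" and ij: "i \<in> {1..27}" "j \<in> {1..27}" "i < j" "free i j"
  shows "R_mat q h z *v (vtensor i j - inverse q *s vtensor j i) = eig q z (\<omega> 2) *s (vtensor i j - inverse q *s vtensor j i)"
proof -
  have "R_mat q h z *v (vtensor i j - inverse q *s vtensor j i)
    = (diag_less q z - inverse q * exch q z) *s vtensor i j + (exch q z - inverse q * diag_greater q z) *s vtensor j i"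
    using ij free_sym[of i j]
    by (simp add: matrix_vector_mult_diff_distrib vector_scalar_commute R_mat_free[OF reg h] diag_entry_def
        vec_eq_iff algebra_simps)
  then show ?thesis
    unfolding R_matrix_antisym[OF reg] using weights3_distinct
    by (simp add: eig_def vec.scale_right_diff_distrib)
qed

lemma R_mat_symmetric:
  assumes reg: "regular q z" and h: "h ^ 2 = q" and ij: "i \<in> {1..27}" "j \<in> {1..27}" "i < j" "free i j"
  shows "R_mat q h z *v (vtensor i j + q *s vtensor j i) = vtensor i j + q *s vtensor j i"
proof -
  have "R_mat q h z *v (vtensor i j + q *s vtensor j i)
    = (diag_less q z + q * exch q z) *s vtensor i j + (exch q z + q * diag_greater q z) *s vtensor j i"
    using ij free_sym[of i j]
    by (simp add: matrix_vector_right_distrib vector_scalar_commute R_mat_free[OF reg h] diag_entry_def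
        vec_eq_iff algebra_simps)
  then show ?thesis unfolding R_matrix_sl2[OF reg] by simp
qed

lemma raise_1_2: "raise 1 2 = Some 1"
  by (simp add: raise_table)

lemma R_mat_hw_vec:
  assumes reg: "regular q z" and h: "h ^ 2 = q" and lam: "lam \<in> weights3"
  shows "R_mat q h z *v hw_vec q lam = eig q z lam *s hw_vec q lam"
proof -
  have "free 1 2" using free_arrow[OF _ raise_1_2] free_sym by simp
  with lam show ?thesis
    using weights3_distinct R_mat_equal[OF reg h, of 1] R_mat_antisymmetric[OF reg h, of 1 2]
      R_mat_block_vec[OF reg h, of 1]
    unfolding weights3_def hw_vec_def by (auto simp: eig_def)
qed

lemma block_vec_nth:
  assumes "s \<in> {1..27}" "p < 10" "I_list s ! p = (i, j)"
  shows "block_vec q s $ (of_label i, of_label j) = coord q p"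
proof -
  have e: "case_prod vtensor (I_list s ! p') $ (of_label i, of_label j) = (if p' = p then 1 else 0 :: complex)"
    if "p' < 10" for p'
  proof -
    obtain i' j' where c: "I_list s ! p' = (i', j')" by (cases "I_list s ! p'")
    have "(i, j) = (i', j') \<longleftrightarrow> p' = p"
      using I_list_inj[OF assms(1)] assms(2,3) that c by (auto simp: inj_on_def)
    then show ?thesis
      using I_list_nth_order(1,2)[OF assms] by (auto simp: c vtensor_nth)
  qed
  have "block_vec q s $ (of_label i, of_label j) = (\<Sum>p'<10. coord q p' * (if p' = p then 1 else 0))"
    by (simp add: block_vec_def e)
  then show ?thesis using assms(2) by (simp add: if_distrib cong: if_cong)
qed

lemma block_vec_nth_outside:
  assumes "i \<in> {1..27}" "j \<in> {1..27}" "(i, j) \<notin> set (I_list s)" "s \<in> {1..27}"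
  shows "block_vec q s $ (of_label i, of_label j) = 0"
proof -
  have "case_prod vtensor (I_list s ! p') $ (of_label i, of_label j) = (0 :: complex)"
    if "p' < 10" for p'
  proof -
    obtain i' j' where c: "I_list s ! p' = (i', j')" by (cases "I_list s ! p'")
    have "(i', j') \<in> set (I_list s)" using c that assms(4) I_list_length nth_mem by metis
    with assms(3) show ?thesis using assms(1,2) by (auto simp: c vtensor_nth)
  qed
  then show ?thesis by (simp add: block_vec_def)
qed

lemma bil_block_vec:
  assumes "s \<in> {1..27}"
  shows "bil (block_vec q s) (block_vec q s) = (\<Sum>p<10. coord q p * coord q p)"
proof -
  have "bil (case_prod vtensor (I_list s ! p)) (block_vec q s) = coord q p" if "p < 10" for p
    using block_vec_nth[OF assms that] I_list_nth_order(1,2)[OF assms that]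
    by (cases "I_list s ! p") (simp add: bil_vtensor_left)
  then have "bil (\<Sum>p<10. coord q p *s case_prod vtensor (I_list s ! p)) (block_vec q s) = (\<Sum>p<10. coord q p * coord q p)"
    unfolding bil_sum_left by (simp add: bil_simps)
  then show ?thesis by (simp only: block_vec_def[symmetric])
qed

section \<open>Singular vectors\<close>

lemma E2_entry:
  assumes "k \<in> {1..6}"
  shows "(E2 h 1 1 k *v x) $ (a, b) =
    (\<Sum>c\<in>UNIV. if raise k (label c) = Some (label a) then h powi wt k (label b) * x $ (c, b) else 0)
    + (\<Sum>d\<in>UNIV. if raise k (label d) = Some (label b) then inverse h powi wt k (label a) * x $ (a, d) else 0)"
proof -
  have k: "k \<le> 6" "par k 1 = 1" using assms by (auto simp: par_def)
  have U: "(\<Sum>r\<in>UNIV. f r) = (\<Sum>c\<in>UNIV. \<Sum>d\<in>UNIV. f (c, d))" for f :: "ix \<times> ix \<Rightarrow> complex"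
    by (simp add: sum.cartesian_product)
  have "(E2 h 1 1 k *v x) $ (a, b)
    = (\<Sum>c\<in>UNIV. \<Sum>d\<in>UNIV. (E_op 1 k $ a $ c * K_op h k $ b $ d + K_op (inverse h) k $ a $ c * E_op 1 k $ b $ d) * x $ (c, d))"
    unfolding matrix_vector_mult_def E2_def kron_def
    by (simp add: U)
  also have "\<dots> = (\<Sum>c\<in>UNIV. \<Sum>d\<in>UNIV. if d = b then (if raise k (label c) = Some (label a) then h powi wt k (label b) * x $ (c, b) else 0) else 0)
     + (\<Sum>c\<in>UNIV. \<Sum>d\<in>UNIV. if c = a then (if raise k (label d) = Some (label b) then inverse h powi wt k (label a) * x $ (a, d) else 0) else 0)"
    unfolding sum.distrib[symmetric]
    by (intro sum.cong refl) (auto simp: E_op_entry[OF k(1)] k(2) K_op_def algebra_simps)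
  also have "(\<Sum>c\<in>UNIV. \<Sum>d\<in>UNIV. if c = a then (if raise k (label d) = Some (label b) then inverse h powi wt k (label a) * x $ (a, d) else 0) else 0)
     = (\<Sum>d\<in>UNIV. \<Sum>c\<in>UNIV. if c = a then (if raise k (label d) = Some (label b) then inverse h powi wt k (label a) * x $ (a, d) else 0) else 0)"
    by (rule sum.swap)
  finally show ?thesis by simp
qed

lemma K2_entry:
  "(K2 h k *v x) $ (a, b) = (h ^ 2) powi wt k (label a) * (h ^ 2) powi wt k (label b) * x $ (a, b)"
proof -
  have "(K2 h k *v x) $ (a, b) = (\<Sum>r\<in>UNIV. if r = (a, b) then (h ^ 2) powi wt k (label a) * (h ^ 2) powi wt k (label b) * x $ (a, b) else 0)"
    unfolding matrix_vector_mult_def K2_def kron_def K_op_def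
    by (subst vec_lambda_beta, intro sum.cong refl) (auto simp: prod_eq_iff)
  then show ?thesis by simp
qed

definition singular :: "complex \<Rightarrow> vec2 \<Rightarrow> bool" where
  "singular h x \<longleftrightarrow> (\<forall>k\<in>{1..6}. E2 h 1 1 k *v x = 0)"

lemma raise_exists_unless_1:
  assumes "d \<in> {1..27}" "d \<noteq> 1"
  obtains k b where "k \<in> {1..6}" "raise k d = Some b"
proof -
  have "\<forall>d\<in>{1..27}. d = 1 \<or> list_ex (\<lambda>k. raise k d \<noteq> None) [1,2,3,4,5,6]"
    unfolding all_upto_27 by (simp add: raise_table)
  with assms have "list_ex (\<lambda>k. raise k d \<noteq> None) [1,2,3,4,5,6]" by blast
  then obtain k where k: "k \<in> set [1,2,3,4,5,6]" "raise k d \<noteq> None" unfolding list_ex_iff by blast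
  from k(1) have "k \<in> {1..6}" by auto
  with k(2) show ?thesis using that by blast
qed

lemma raise_exists_unless_1_2_15:
  assumes "i \<in> {1..27}" "i \<notin> {1, 2, 15}"
  obtains k b where "k \<in> {2..6}" "raise k i = Some b"
proof -
  have "\<forall>d\<in>{1..27}. d \<in> {1, 2, 15} \<or> list_ex (\<lambda>k. raise k d \<noteq> None) [2,3,4,5,6]"
    unfolding all_upto_27 by (simp add: raise_table)
  with assms have "list_ex (\<lambda>k. raise k i \<noteq> None) [2,3,4,5,6]" by blast
  then obtain k where k: "k \<in> set [2,3,4,5,6]" "raise k i \<noteq> None" unfolding list_ex_iff by blast
  from k(1) have "k \<in> {2..6}" by auto
  with k(2) show ?thesis using that by blast
qed

lemma raise_to_1:
  assumes "k \<in> {2..6}"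
  shows "raise k d \<noteq> Some 1"
proof -
  have "\<forall>k\<le>6. k < 2 \<or> list_all (\<lambda>(u, v). v \<noteq> 1) (E_arrows k)"
    unfolding all_upto_6 by (simp add: E_arrows_table)
  with assms show ?thesis by (auto simp: raise_eq_Some list_all_iff)
qed

text \<open>
  Write \<open>x = \<Sum> v_i \<otimes> x_i\<close> and take the largest \<open>i\<close> with \<open>x_i \<noteq> 0\<close>. The coefficient of \<open>v_i\<close> in \<open>E_k x\<close> is
  \<open>E_k x_i\<close> up to a nonzero factor, as \<open>v_i\<close> could only be raised from a larger label; hence \<open>x_i\<close> is a
  multiple of \<open>v_1\<close>. If \<open>v_i\<close> were moved by some \<open>E_k\<close> with \<open>k \<noteq> 1\<close>, then \<open>E_k v_i \<otimes> v_1\<close> would have to cancel against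
  a vector whose second factor is in the image of \<open>E_k\<close>, which does not contain \<open>v_1\<close>. So \<open>v_i\<close> is
  annihilated by \<open>E_2, \<dots>, E_6\<close>, which leaves \<open>i = 1, 2, 15\<close>. A singular vector is therefore determined
  by three coordinates.
\<close>

lemma singular_eq_0:
  assumes s: "singular h x" and h: "h \<noteq> 0"
    and 0: "x $ (of_label 1, of_label 1) = 0" "x $ (of_label 2, of_label 1) = 0" "x $ (of_label 15, of_label 1) = 0"
  shows "x = 0"
proof (rule ccontr)
  assume "x \<noteq> 0"
  then obtain a0 b0 where "x $ (a0, b0) \<noteq> 0" by (auto simp: vec_eq_iff)
  define S where "S = {label a |a. \<exists>b. x $ (a, b) \<noteq> 0}"
  have "finite S" by (rule finite_subset[of _ "{1..27}"]) (use label_range in \<open>auto simp: S_def\<close>)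
  moreover have "S \<noteq> {}" using \<open>x $ (a0, b0) \<noteq> 0\<close> by (auto simp: S_def)
  ultimately have m: "Max S \<in> S" "\<And>l. l \<in> S \<Longrightarrow> l \<le> Max S" by auto
  obtain a b1 where a: "label a = Max S" "x $ (a, b1) \<noteq> 0" using m(1) by (auto simp: S_def)
  have big: "x $ (c, b) = 0" if "label a < label c" for c b
  proof (rule ccontr)
    assume "x $ (c, b) \<noteq> 0"
    then have "label c \<in> S" by (auto simp: S_def)
    from m(2)[OF this] that a(1) show False by simp
  qed
  \<comment> \<open>Compare the entries of \<open>E_k x\<close> in the row of the largest label, for the node at which \<open>d\<close> is moved.\<close>
  have row: "x $ (a, d) = 0" if d: "label d \<noteq> 1" for d
  proof -
    from raise_exists_unless_1[OF label_range d] obtain k l where k: "k \<in> {1..6}" "raise k (label d) = Some l" .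
    have k6: "k \<le> 6" "k \<noteq> 0" using k(1) by auto
    define b where "b = of_label l"
    have l: "label b = l" using raise_order(2)[OF k6(1) k(2)] by (simp add: b_def)
    have "0 = (E2 h 1 1 k *v x) $ (a, b)" using s k(1) by (simp add: singular_def)
    also have "\<dots> = (\<Sum>d'\<in>UNIV. if d' = d then inverse h powi wt k (label a) * x $ (a, d') else 0)"
    proof -
      have "(if raise k (label c) = Some (label a) then h powi wt k (label b) * x $ (c, b) else 0) = 0" for c
        using big[of c b] raise_order(3)[OF k6(1), of "label c" "label a"] k6(2) by auto
      moreover have "raise k (label d') = Some (label b) \<longleftrightarrow> d' = d" for d'
        using raise_inj[OF k6(1) k(2), of "label d'"] k(2) l by (auto simp: label_inject)
      ultimately show ?thesis by (simp add: E2_entry[OF k(1)])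
    qed
    also have "\<dots> = inverse h powi wt k (label a) * x $ (a, d)" by simp
    finally show ?thesis using h by simp
  qed
  then have "label b1 = 1" using a(2) by blast
  then have b1: "b1 = of_label 1" by (metis label_inverse)
  \<comment> \<open>Compare the entries of \<open>E_k x\<close> at the pair formed by the raised label and 1.\<close>
  have "label a \<in> {1, 2, 15}"
  proof (rule ccontr)
    assume "label a \<notin> {1, 2, 15}"
    from raise_exists_unless_1_2_15[OF label_range this] obtain k l where k: "k \<in> {2..6}" "raise k (label a) = Some l" .
    have k6: "k \<le> 6" "k \<in> {1..6}" using k(1) by auto
    define i' where "i' = of_label l"
    have l: "label i' = l" using raise_order(2)[OF k6(1) k(2)] by (simp add: i'_def)
    have "0 = (E2 h 1 1 k *v x) $ (i', b1)" using s k6(2) by (simp add: singular_def)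
    also have "\<dots> = (\<Sum>c\<in>UNIV. if c = a then h powi wt k (label b1) * x $ (c, b1) else 0)"
    proof -
      have "raise k (label c) = Some (label i') \<longleftrightarrow> c = a" for c
        using raise_inj[OF k6(1) k(2), of "label c"] k(2) l by (auto simp: label_inject)
      moreover have "raise k (label d) \<noteq> Some (label b1)" for d
        using raise_to_1[OF k(1)] \<open>label b1 = 1\<close> by simp
      ultimately show ?thesis by (simp add: E2_entry[OF k6(2)])
    qed
    also have "\<dots> = h powi wt k (label b1) * x $ (a, b1)" by simp
    finally show False using h a(2) by simp
  qed
  then have "a \<in> {of_label 1, of_label 2, of_label 15}" using label_inverse[of a] by auto
  then show False using a(2) b1 0 by auto
qed

section \<open>Submodules\<close>

definition finite_commute :: "complex \<Rightarrow> complex op2 \<Rightarrow> bool" where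
  "finite_commute h D \<longleftrightarrow> (\<forall>k\<in>{1..6}. D ** E2 h 1 1 k = E2 h 1 1 k ** D \<and>
     D ** F2 h 1 1 k = F2 h 1 1 k ** D \<and> D ** K2 h k = K2 h k ** D)"

lemma finite_commute_apply:
  assumes "finite_commute h D" "k \<in> {1..6}"
  shows "D *v (E2 h 1 1 k *v x) = E2 h 1 1 k *v (D *v x)"
    "D *v (F2 h 1 1 k *v x) = F2 h 1 1 k *v (D *v x)"
    "D *v (K2 h k *v x) = K2 h k *v (D *v x)"
  using assms by (simp_all add: finite_commute_def matrix_vector_mul_assoc)

lemma submodule2_eigenspace:
  assumes "finite_commute h D"
  shows "submodule2 h {x. D *v x = c *s x}"
  using finite_commute_apply[OF assms]
  by (simp add: submodule2_def vec.subspace_def matrix_vector_right_distrib vector_scalar_commute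
      vec.scale_right_distrib mult.commute)

lemma submodule2_Int: "submodule2 h U \<Longrightarrow> submodule2 h V \<Longrightarrow> submodule2 h (U \<inter> V)"
  by (simp add: submodule2_def vec.subspace_inter)

lemma submodule2_sum:
  assumes "submodule2 h U" "submodule2 h V"
  shows "submodule2 h {x + y |x y. x \<in> U \<and> y \<in> V}"
proof -
  let ?S = "{x + y |x y. x \<in> U \<and> y \<in> V}"
  have closed: "A *v w \<in> ?S" if w: "w \<in> ?S"
    and UV: "\<And>x. x \<in> U \<Longrightarrow> A *v x \<in> U" "\<And>x. x \<in> V \<Longrightarrow> A *v x \<in> V" for A w
  proof -
    obtain x y where "w = x + y" "x \<in> U" "y \<in> V" using w by blast
    with UV have "A *v w = A *v x + A *v y" "A *v x \<in> U" "A *v y \<in> V"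
      by (simp_all add: matrix_vector_right_distrib)
    then show ?thesis by blast
  qed
  have "vec.subspace ?S" using assms by (intro vec.subspace_sums) (simp_all add: submodule2_def)
  moreover have "E2 h 1 1 k *v w \<in> ?S \<and> F2 h 1 1 k *v w \<in> ?S \<and> K2 h k *v w \<in> ?S"
    if "k \<in> {1..6}" "w \<in> ?S" for k w
    using assms that(1) by (intro conjI closed[OF that(2)]) (simp_all add: submodule2_def)
  ultimately show ?thesis by (simp only: submodule2_def) blast
qed

lemma E2_transpose: "transpose (E2 h 1 1 k) = F2 h 1 1 k"
  and F2_transpose: "transpose (F2 h 1 1 k) = E2 h 1 1 k"
  and K2_transpose: "transpose (K2 h k) = K2 h k"
proof -
  show "transpose (E2 h 1 1 k) = F2 h 1 1 k" using F2_eq_transpose[of 1 1 h k] by simp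
  then show "transpose (F2 h 1 1 k) = E2 h 1 1 k" by (metis transpose_transpose)
  have K: "transpose (K_op t k) = K_op t k" for t
    by (auto simp: transpose_def K_op_def vec_eq_iff)
  show "transpose (K2 h k) = K2 h k" by (simp add: K2_def transpose_kron K)
qed

lemma submodule2_perp:
  assumes "submodule2 h U"
  shows "submodule2 h {y. \<forall>x\<in>U. bil x y = 0}"
proof -
  have "bil x (E2 h 1 1 k *v y) = bil (F2 h 1 1 k *v x) y"
    "bil x (F2 h 1 1 k *v y) = bil (E2 h 1 1 k *v x) y"
    "bil x (K2 h k *v y) = bil (K2 h k *v x) y" for x y k
    by (simp_all only: bil_transpose E2_transpose F2_transpose K2_transpose)
  with assms show ?thesis
    by (simp add: submodule2_def vec.subspace_def bil_simps)
qed

text \<open>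
  Every \<open>E_k\<close> lowers the sum of the two labels of a basis vector. So a nonzero vector of the submodule for
  which the largest such sum is minimal is singular.
\<close>

lemma submodule2_singular:
  assumes N: "submodule2 h N" and x: "x \<in> N" "x \<noteq> 0"
  shows "\<exists>y\<in>N. y \<noteq> 0 \<and> singular h y"
proof -
  have "\<exists>y\<in>N. y \<noteq> 0 \<and> singular h y"
    if "x \<in> N" "x \<noteq> 0" "\<And>a b. x $ (a, b) \<noteq> 0 \<Longrightarrow> label a + label b < n" for x n
    using that
  proof (induction n arbitrary: x)
    case 0
    then have "x $ (a, b) = 0" for a b by blast
    with 0(2) show ?case by (simp add: vec_eq_iff)
  next
    case (Suc n)
    show ?case
    proof (cases "singular h x")
      case True
      with Suc.prems show ?thesis by blast
    next
      case False
      then obtain k where k: "k \<in> {1..6}" "E2 h 1 1 k *v x \<noteq> 0" by (auto simp: singular_def)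
      show ?thesis
      proof (rule Suc.IH[OF _ k(2)])
        show "E2 h 1 1 k *v x \<in> N" using N k(1) Suc.prems(1) by (simp add: submodule2_def)
        fix a b assume ne: "(E2 h 1 1 k *v x) $ (a, b) \<noteq> 0"
        have down: "label r < label c" if "raise k (label c) = Some (label r)" for c r
          using raise_order(3)[OF _ that] k(1) by auto
        from ne consider c where "raise k (label c) = Some (label a)" "x $ (c, b) \<noteq> 0"
          | d where "raise k (label d) = Some (label b)" "x $ (a, d) \<noteq> 0"
          unfolding E2_entry[OF k(1)]
          by (smt (verit) add.right_neutral mult_zero_right sum.neutral)
        then show "label a + label b < n"
        proof cases
          case (1 c)
          from Suc.prems(3)[OF 1(2)] down[OF 1(1)] show ?thesis by simp
        next
          case (2 d)
          from Suc.prems(3)[OF 2(2)] down[OF 2(1)] show ?thesis by simp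
        qed
      qed
    qed
  qed
  moreover have "label a + label b < 55" for a b
    using label_range[of a] label_range[of b] by simp
  ultimately show ?thesis using x by blast
qed

lemma wt_small:
  assumes "k \<in> {1..6}"
  shows "wt k 1 = \<omega> 1 k" "wt k 1 + wt k 2 = \<omega> 2 k" "wt (dual k) 1 = \<omega> 5 k"
proof -
  have "\<forall>k\<le>6. k = 0 \<or> wt k 1 = \<omega> 1 k \<and> wt k 1 + wt k 2 = \<omega> 2 k \<and> wt (dual k) 1 = \<omega> 5 k"
    unfolding all_upto_6 by (simp add: wt_table dual_table fund_weight_def)
  with assms show "wt k 1 = \<omega> 1 k" "wt k 1 + wt k 2 = \<omega> 2 k" "wt (dual k) 1 = \<omega> 5 k"
    by auto
qed

lemma I_list_1_last: "I_list 1 ! 9 = (15, 1)"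
  by (simp add: I_list_table nth10)

lemma not_in_I_list_1: "(1, 1) \<notin> set (I_list 1)" "(2, 1) \<notin> set (I_list 1)"
  by (simp_all add: I_list_table)

definition next_weight :: "(nat \<Rightarrow> int) \<Rightarrow> nat \<Rightarrow> int" where
  "next_weight lam = (if lam = two_omega1 then \<omega> 2 else if lam = \<omega> 2 then \<omega> 5 else two_omega1)"

text \<open>
  The projector to an eigenspace of the R-matrix at \<open>z = 0\<close>, as a Lagrange interpolation polynomial.
  The cyclic order \<open>next_weight\<close> only serves to name the other two eigenvalues.
\<close>

definition eigproj :: "complex \<Rightarrow> complex \<Rightarrow> (nat \<Rightarrow> int) \<Rightarrow> complex op2" where
  "eigproj q h lam =
     (let m = eig q 0 lam; n = eig q 0 (next_weight lam); k = eig q 0 (next_weight (next_weight lam))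
      in (1 / ((m - n) * (m - k))) *\<^sub>k ((R_mat q h 0 - n *\<^sub>k mat 1) ** (R_mat q h 0 - k *\<^sub>k mat 1)))"

lemma weights3_cyclic:
  "lam \<in> weights3 \<Longrightarrow> weights3 = {lam, next_weight lam, next_weight (next_weight lam)}"
  "lam \<in> weights3 \<Longrightarrow> next_weight lam \<noteq> lam"
  "lam \<in> weights3 \<Longrightarrow> next_weight (next_weight lam) \<noteq> lam"
  using weights3_distinct by (auto simp: weights3_def next_weight_def)

lemma affine_intertwiner_apply:
  assumes "affine_intertwiner h z 1 A" "k \<le> 6"
  shows "A *v (E2 h z 1 k *v x) = E2 h 1 z k *v (A *v x)"
    "A *v (F2 h z 1 k *v x) = F2 h 1 z k *v (A *v x)"
    "A *v (K2 h k *v x) = K2 h k *v (A *v x)"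
  using assms by (simp_all add: affine_intertwiner_def matrix_vector_mul_assoc)

section \<open>Decomposition of the tensor square\<close>

context
  fixes q h :: complex
  assumes q0: "q \<noteq> 0" and root: "\<And>n::nat. n > 0 \<Longrightarrow> q ^ n \<noteq> 1" and h: "h ^ 2 = q"
begin

lemma one_plus_power: "n > 0 \<Longrightarrow> 1 + q ^ n \<noteq> 0"
proof
  assume n: "n > 0" and "1 + q ^ n = 0"
  then have "q ^ n = -1" by (simp add: add_eq_0_iff)
  then have "q ^ (n * 2) = 1" unfolding power_mult by simp
  with root[of "n * 2"] n show False by simp
qed

lemma regular_iff: "regular q z \<longleftrightarrow> z \<noteq> q ^ 2 \<and> z \<noteq> q ^ 8"
  using q0 one_plus_power[of 1] by (auto simp: regular_def)

lemma regular_0: "regular q 0"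
  using q0 by (simp add: regular_iff)

lemma h_not_0: "h \<noteq> 0"
  using q0 h by auto

lemma R_mat_finite_commute:
  assumes "regular q z"
  shows "finite_commute h (R_mat q h z)"
  unfolding finite_commute_def
proof (intro ballI conjI)
  fix k :: nat assume k: "k \<in> {1..6}"
  then have k': "k \<le> 6" "k \<noteq> 0" by auto
  show E: "R_mat q h z ** E2 h 1 1 k = E2 h 1 1 k ** R_mat q h z"
    using R_mat_commutes_E2[OF assms h k'(1)] finite_generators(1)[OF k'(2)] by metis
  show "R_mat q h z ** F2 h 1 1 k = F2 h 1 1 k ** R_mat q h z"
    using arg_cong[OF E, of transpose] by (simp add: matrix_transpose_mul transpose_R_mat E2_transpose)
  show "R_mat q h z ** K2 h k = K2 h k ** R_mat q h z"
    using R_mat_commutes_K2[OF assms h k'(1)] .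
qed

lemma hw_vec_coords:
  "hw_vec q two_omega1 $ (of_label 1, of_label 1) = 1" "hw_vec q two_omega1 $ (of_label 2, of_label 1) = 0"
  "hw_vec q two_omega1 $ (of_label 15, of_label 1) = 0"
  "hw_vec q (\<omega> 2) $ (of_label 1, of_label 1) = 0" "hw_vec q (\<omega> 2) $ (of_label 2, of_label 1) = - inverse q"
  "hw_vec q (\<omega> 2) $ (of_label 15, of_label 1) = 0"
  "hw_vec q (\<omega> 5) $ (of_label 1, of_label 1) = 0" "hw_vec q (\<omega> 5) $ (of_label 2, of_label 1) = 0"
  "hw_vec q (\<omega> 5) $ (of_label 15, of_label 1) = inverse q ^ 4"
  using weights3_distinct block_vec_nth[OF _ _ I_list_1_last] not_in_I_list_1
  by (simp_all add: hw_vec_def vtensor_nth block_vec_nth_outside coord_def)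

lemma hw_vec_nonzero: "lam \<in> weights3 \<Longrightarrow> hw_vec q lam \<noteq> 0"
  using hw_vec_coords(1,5,9) q0 by (auto simp: weights3_def)

text \<open>
  If two pairs of the block are sent to the same vector by \<open>E_k\<close>, their coordinates have the quotient
  \<open>-q^{-1}\<close>, and the powers of \<open>q^{1/2}\<close> in the coproduct compensate for it. The combination of
  \<open>v_1 \<otimes> v_2\<close> and \<open>v_2 \<otimes> v_1\<close> is killed for the same reason.
\<close>

lemma hw_vec_singular:
  assumes "lam \<in> weights3"
  shows "singular h (hw_vec q lam)"
  unfolding singular_def
proof
  fix k :: nat assume k: "k \<in> {1..6}"
  then have k': "k \<le> 6" "k \<noteq> 0" by auto
  have r1: "raise k 1 = None" using raise_order(2,3)[OF k'(1), of 1] k'(2) by (cases "raise k 1") auto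
  have E: "E2 h 1 1 k *v vtensor 1 1 = 0"
    using k' r1 by (simp add: E2_vtensor E2_column_def)
  have r2: "raise k 2 = (if k = 1 then Some 1 else None)"
  proof -
    have "\<forall>k\<le>6. k = 0 \<or> raise k 2 = (if k = 1 then Some 1 else None)"
      unfolding all_upto_6 by (simp add: raise_table)
    with k' show ?thesis by auto
  qed
  have "wt 1 1 = 1" by (simp add: wt_table)
  then have E': "E2 h 1 1 k *v (vtensor 1 2 - inverse q *s vtensor 2 1) = 0"
    using k' r1 r2 h_not_0 h
    by (auto simp: matrix_vector_mult_diff_distrib vector_scalar_commute E2_vtensor E2_column_def par_def
        vec_eq_iff power2_eq_square)
  have E'': "E2 h 1 1 k *v block_vec q 1 = 0"
  proof -
    have e: "{..<10::nat} = {0,1,2,3,4,5,6,7,8,9}" by auto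
    have c: "I_list 1 = [(1,15), (2,12), (3,10), (4,7), (5,6), (6,5), (7,4), (10,3), (12,2), (15,1)]"
      by (simp add: I_list_table)
    have "\<forall>k\<le>6. k = 0 \<or> E2 h 1 1 k *v block_vec q 1 = 0"
      unfolding all_upto_6 block_vec_def mult_sum_vec vector_scalar_commute e c
      using h_not_0 q0
      apply (simp add: nth10 E2_vtensor)
      apply (simp add: E2_column_def raise_table wt_table par_def coord_values[OF regular_0])
      apply (simp add: vec_eq_iff field_simps h[symmetric] power_numeral_reduce)
      done
    with k' show ?thesis by auto
  qed
  show "E2 h 1 1 k *v hw_vec q lam = 0"
    using E E' E'' assms unfolding hw_vec_def weights3_def by auto
qed

lemma hw_vec_weight:
  assumes "lam \<in> weights3" "k \<in> {1..6}"
  shows "K2 h k *v hw_vec q lam = q powi lam k *s hw_vec q lam"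
proof -
  have k: "k \<le> 6" using assms(2) by auto
  note w = wt_small[OF assms(2)]
  have q: "q powi a * q powi b = q powi (a + b)" for a b using q0 by (simp add: power_int_add)
  have 1: "K2 h k *v vtensor 1 1 = q powi two_omega1 k *s vtensor 1 1"
    using k by (simp add: K2_vtensor h q w two_omega1_def)
  have 2: "K2 h k *v (vtensor 1 2 - inverse q *s vtensor 2 1) = q powi \<omega> 2 k *s (vtensor 1 2 - inverse q *s vtensor 2 1)"
    using k w(2) by (simp add: K2_vtensor h q matrix_vector_mult_diff_distrib vector_scalar_commute
        vec.scale_right_diff_distrib add.commute mult.commute)
  have 3: "K2 h k *v block_vec q 1 = q powi \<omega> 5 k *s block_vec q 1"
  proof -
    have "K2 h k *v case_prod vtensor (I_list 1 ! p) = q powi \<omega> 5 k *s case_prod vtensor (I_list 1 ! p)" if "p < 10" for p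
    proof (cases "I_list 1 ! p")
      case (Pair i j)
      have "(i, j) \<in> set (I_list 1)" using Pair that I_list_length[of 1] nth_mem[of p "I_list 1"] by simp
      from I_list_wt[OF k _ this] w(3) have "wt k i + wt k j = \<omega> 5 k" by simp
      with I_list_nth_order(1,2)[OF _ that Pair] show ?thesis by (simp add: Pair K2_vtensor k h q)
    qed
    then show ?thesis
      unfolding block_vec_def mult_sum_vec vector_scalar_commute vec.scale_sum_right
      by (intro sum.cong refl) (simp add: mult.commute)
  qed
  show ?thesis using 1 2 3 assms(1) unfolding hw_vec_def weights3_def by auto
qed

text \<open>
  The three highest weight vectors have triangular, in fact diagonal, coordinates at the three places
  that determine a singular vector. The factors undo the coordinates \<open>1\<close>, \<open>-q^{-1}\<close> and \<open>q^{-4}\<close>.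
\<close>

lemma singular_decomposition:
  assumes "singular h x"
  shows "x = (x $ (of_label 1, of_label 1)) *s hw_vec q two_omega1
     + (- q * x $ (of_label 2, of_label 1)) *s hw_vec q (\<omega> 2)
     + (q ^ 4 * x $ (of_label 15, of_label 1)) *s hw_vec q (\<omega> 5)" (is "x = ?y")
proof -
  have "singular h ?y"
    using hw_vec_singular[of two_omega1] hw_vec_singular[of "\<omega> 2"] hw_vec_singular[of "\<omega> 5"]
    by (simp add: singular_def weights3_def matrix_vector_right_distrib
        matrix_vector_mult_diff_distrib vector_scalar_commute)
  then have "singular h (x - ?y)"
    using assms by (simp add: singular_def matrix_vector_mult_diff_distrib)
  then have "x - ?y = 0"
    by (rule singular_eq_0[OF _ h_not_0]) (use q0 in \<open>simp_all add: hw_vec_coords power_inverse\<close>)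
  then show ?thesis by simp
qed

text \<open>
  The operators \<open>K_1\<close>, \<open>K_2\<close> and \<open>K_5\<close> separate the three weights.
\<close>

lemma singular_of_weight:
  assumes s: "singular h x" and lam: "lam \<in> weights3"
    and w: "\<And>k. k \<in> {1..6} \<Longrightarrow> K2 h k *v x = q powi lam k *s x"
  shows "\<exists>c. x = c *s hw_vec q lam"
proof -
  have e: "q powi (wt k i + wt k j) = q powi lam k" if "x $ (of_label i, of_label j) \<noteq> 0" "k \<in> {1..6}"
    "i \<in> {1..27}" "j \<in> {1..27}" for i j k
    using arg_cong[OF w[OF that(2)], of "\<lambda>v. v $ (of_label i, of_label j)"] that q0
    by (simp add: K2_entry h power_int_add)
  have "q \<noteq> 1" "q ^ 2 \<noteq> 1" using root[of 1] root[of 2] by simp_all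
  have a: "lam = two_omega1" if "x $ (of_label 1, of_label 1) \<noteq> 0"
    using e[OF that, of 1] \<open>q ^ 2 \<noteq> 1\<close> lam by (auto simp: weights3_def two_omega1_def fund_weight_def wt_table)
  have b: "lam = \<omega> 2" if "x $ (of_label 2, of_label 1) \<noteq> 0"
    using e[OF that, of 2] \<open>q \<noteq> 1\<close> lam by (auto simp: weights3_def two_omega1_def fund_weight_def wt_table)
  have c: "lam = \<omega> 5" if "x $ (of_label 15, of_label 1) \<noteq> 0"
    using e[OF that, of 5] \<open>q \<noteq> 1\<close> lam by (auto simp: weights3_def two_omega1_def fund_weight_def wt_table)
  show ?thesis
  proof (cases "x = 0")
    case True
    then show ?thesis by (intro exI[of _ 0]) simp
  next
    case False
    from lam consider "lam = two_omega1" | "lam = \<omega> 2" | "lam = \<omega> 5" by (auto simp: weights3_def)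
    then show ?thesis
      using singular_decomposition[OF s] a b c weights3_distinct
      by cases (metis add.left_neutral add.right_neutral mult_zero_right vec.scale_zero_left)+
  qed
qed

text \<open>
  The norms are 1, \<open>1 + q^{-2}\<close> and \<open>(q^4 + q^{-4}) (q^4 + q^2 + 1 + q^{-2} + q^{-4})\<close>; they do not vanish
  because \<open>q\<close> is not a root of unity.
\<close>

lemma hw_vec_norm:
  assumes "lam \<in> weights3"
  shows "bil (hw_vec q lam) (hw_vec q lam) \<noteq> 0"
proof -
  have 1: "bil (vtensor 1 1) (vtensor 1 1) \<noteq> 0"
    by (simp add: bil_vtensor_left vtensor_nth)
  have "bil (vtensor 1 2 - inverse q *s vtensor 2 1) (vtensor 1 2 - inverse q *s vtensor 2 1) = (1 + q ^ 2) / q ^ 2"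
    using q0 by (simp add: bil_simps bil_vtensor_left vtensor_nth field_simps power2_eq_square)
  with q0 one_plus_power[of 2]
  have 2: "bil (vtensor 1 2 - inverse q *s vtensor 2 1) (vtensor 1 2 - inverse q *s vtensor 2 1) \<noteq> 0" by simp
  have e: "{..<10::nat} = {0,1,2,3,4,5,6,7,8,9}" by auto
  \<comment> \<open>The factor \<open>q^2 - 1\<close> sums the geometric progression in the third norm, and \<open>q^8\<close> clears denominators.\<close>
  have "(\<Sum>p<10. coord q p * coord q p) * (q ^ 8 * (q ^ 2 - 1)) = (1 + q ^ 8) * (q ^ 10 - 1)"
    unfolding e using q0 by (simp add: coord_values[OF regular_0] field_simps power_numeral_reduce)
  moreover have "(1 + q ^ 8) * (q ^ 10 - 1) \<noteq> 0"
    using one_plus_power[of 8] root[of 10] by simp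
  ultimately have 3: "bil (block_vec q 1) (block_vec q 1) \<noteq> 0"
    using bil_block_vec[of 1 q] by auto
  show ?thesis using 1 2 3 assms unfolding hw_vec_def weights3_def by auto
qed

text \<open>
  A nonzero submodule contains a nonzero singular vector. If one of its three components is nonzero, that
  component is obtained from \<open>K_1 - 1\<close>, \<open>K_2 - 1\<close> or \<open>K_5 - 1\<close>, which annihilate the other two.
\<close>

lemma submodule2_contains_hw_vec:
  assumes N: "submodule2 h N" and x: "x \<in> N" "x \<noteq> 0"
  shows "\<exists>lam\<in>weights3. hw_vec q lam \<in> N"
proof -
  obtain y where y: "y \<in> N" "y \<noteq> 0" "singular h y" using submodule2_singular[OF N x] by blast
  define a where "a = y $ (of_label 1, of_label 1)"
  define b where "b = - q * y $ (of_label 2, of_label 1)"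
  define c where "c = q ^ 4 * y $ (of_label 15, of_label 1)"
  have d: "y = a *s hw_vec q two_omega1 + b *s hw_vec q (\<omega> 2) + c *s hw_vec q (\<omega> 5)"
    unfolding a_def b_def c_def using singular_decomposition[OF y(3)] .
  have K: "K2 h k *v hw_vec q two_omega1 = q powi (2 * \<omega> 1 k) *s hw_vec q two_omega1"
    "K2 h k *v hw_vec q (\<omega> 2) = q powi \<omega> 2 k *s hw_vec q (\<omega> 2)"
    "K2 h k *v hw_vec q (\<omega> 5) = q powi \<omega> 5 k *s hw_vec q (\<omega> 5)" if "k \<in> {1..6}" for k
    using hw_vec_weight[OF _ that] by (simp_all add: weights3_def two_omega1_def)
  have sub: "vec.subspace N" using N by (simp add: submodule2_def)
  have shift: "K2 h k *v y - y \<in> N" if "k \<in> {1..6}" for k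
    using N that y(1) by (auto simp: submodule2_def intro: vec.subspace_diff)
  have scale: "v \<in> N" if "t *s v \<in> N" "t \<noteq> 0" for t v
    using vec.subspace_scale[OF sub that(1), of "inverse t"] that(2) by simp
  have fw: "\<omega> 1 1 = 1" "\<omega> 2 1 = 0" "\<omega> 5 1 = 0" "\<omega> 1 2 = 0" "\<omega> 2 2 = 1" "\<omega> 5 2 = 0"
    "\<omega> 1 5 = 0" "\<omega> 2 5 = 0" "\<omega> 5 5 = 1"
    by (simp_all add: fund_weight_def)
  have 1: "K2 h 1 *v y - y = (a * (q ^ 2 - 1)) *s hw_vec q two_omega1"
    by (subst (1 2) d) (simp add: matrix_vector_right_distrib vector_scalar_commute K fw vec_eq_iff algebra_simps)
  have 2: "K2 h 2 *v y - y = (b * (q - 1)) *s hw_vec q (\<omega> 2)"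
    by (subst (1 2) d) (simp add: matrix_vector_right_distrib vector_scalar_commute K fw vec_eq_iff algebra_simps)
  have 3: "K2 h 5 *v y - y = (c * (q - 1)) *s hw_vec q (\<omega> 5)"
    by (subst (1 2) d) (simp add: matrix_vector_right_distrib vector_scalar_commute K fw vec_eq_iff algebra_simps)
  have "q - 1 \<noteq> 0" "q ^ 2 - 1 \<noteq> 0" using root[of 1] root[of 2] by auto
  moreover have "a \<noteq> 0 \<or> b \<noteq> 0 \<or> c \<noteq> 0" using d y(2) by auto
  ultimately consider "a * (q ^ 2 - 1) \<noteq> 0" | "b * (q - 1) \<noteq> 0" | "c * (q - 1) \<noteq> 0" by auto
  then show ?thesis
  proof cases
    case c1: 1
    have "hw_vec q two_omega1 \<in> N" by (rule scale[OF _ c1]) (use shift[of 1] 1 in simp)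
    then show ?thesis by (auto simp: weights3_def)
  next
    case c2: 2
    have "hw_vec q (\<omega> 2) \<in> N" by (rule scale[OF _ c2]) (use shift[of 2] 2 in simp)
    then show ?thesis by (auto simp: weights3_def)
  next
    case c3: 3
    have "hw_vec q (\<omega> 5) \<in> N" by (rule scale[OF _ c3]) (use shift[of 5] 3 in simp)
    then show ?thesis by (auto simp: weights3_def)
  qed
qed

text \<open>
  Otherwise the orthogonal complement would contain a highest weight vector too, which would then be
  orthogonal to itself.
\<close>

lemma submodule2_eq_UNIV:
  assumes N: "submodule2 h N" and hw: "\<And>lam. lam \<in> weights3 \<Longrightarrow> hw_vec q lam \<in> N"
  shows "N = UNIV"
proof (rule subspace_UNIV_if_perp_trivial)
  show "vec.subspace N" using N by (simp add: submodule2_def)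
  fix y assume y: "\<And>x. x \<in> N \<Longrightarrow> bil x y = 0"
  show "y = 0"
  proof (rule ccontr)
    assume "y \<noteq> 0"
    with submodule2_contains_hw_vec[OF submodule2_perp[OF N], of y] y
    obtain lam where "lam \<in> weights3" "\<forall>x\<in>N. bil x (hw_vec q lam) = 0" by auto
    with hw hw_vec_norm show False by blast
  qed
qed

lemma eig_distinct:
  assumes "lam \<in> weights3" "\<mu> \<in> weights3" "lam \<noteq> \<mu>"
  shows "eig q 0 lam \<noteq> eig q 0 \<mu>"
proof -
  have "1 \<noteq> - (q powi (-2))"
  proof
    assume "1 = - (q powi (-2))"
    then have "1 + q ^ 2 = 0" using q0 by (simp add: power_int_minus field_simps add_eq_0_iff)
    with one_plus_power[of 2] show False by simp
  qed
  moreover have "1 \<noteq> q powi (-10)"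
    using root[of 10] q0 by (simp add: power_int_minus field_simps)
  moreover have "- (q powi (-2)) \<noteq> q powi (-10)"
  proof
    assume "- (q powi (-2)) = q powi (-10)"
    then have "1 = - (q ^ 8)" using q0 by (simp add: power_int_minus field_simps power_numeral_reduce)
    then have "1 + q ^ 8 = 0" by (simp only: eq_neg_iff_add_eq_0)
    with one_plus_power[of 8] show False by simp
  qed
  ultimately show ?thesis
    using assms weights3_distinct by (auto simp: weights3_def eig_def)
qed

lemma hw_vec_in_eigspace: "lam \<in> weights3 \<Longrightarrow> hw_vec q lam \<in> eigspace q h lam"
  using R_mat_hw_vec[OF regular_0 h] by (simp add: eigspace_def)

lemma submodule2_eigspace: "submodule2 h (eigspace q h lam)"
  unfolding eigspace_def
  by (rule submodule2_eigenspace[OF R_mat_finite_commute[OF regular_0]])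

lemma eigspace_subspace: "vec.subspace (eigspace q h lam)"
  using submodule2_eigspace by (simp add: submodule2_def)

lemma eigproj_eigspace:
  assumes lam: "lam \<in> weights3" and mu: "\<mu> \<in> weights3" and x: "x \<in> eigspace q h \<mu>"
  shows "eigproj q h lam *v x = (if \<mu> = lam then x else 0)"
proof -
  let ?e = "eig q 0"
  have step: "(R_mat q h 0 - n *\<^sub>k mat 1) *v (c *s x) = (c * (?e \<mu> - n)) *s x" for n c
    using x by (simp add: eigspace_def matrix_vector_mult_diff_rdistrib smult_mat_mult vector_scalar_commute
        vec_eq_iff algebra_simps)
  have step1: "(R_mat q h 0 - n *\<^sub>k mat 1) *v x = (?e \<mu> - n) *s x" for n
    using step[of n 1] by (simp only: vec.scale_one mult_1)
  have "eigproj q h lam *v x = ((1 / ((?e lam - ?e (next_weight lam)) * (?e lam - ?e (next_weight (next_weight lam)))))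
     * ((?e \<mu> - ?e (next_weight (next_weight lam))) * (?e \<mu> - ?e (next_weight lam)))) *s x"
    unfolding eigproj_def Let_def smult_mat_mult matrix_vector_mul_assoc[symmetric] step1 step vec.scale_scale
    by simp
  then show ?thesis
    using weights3_cyclic[OF lam] mu eig_distinct[OF lam, of "next_weight lam"]
      eig_distinct[OF lam, of "next_weight (next_weight lam)"]
    by auto
qed

text \<open>
  The sum of the three submodules contains all highest weight vectors. The submodules need not be the
  eigenspaces themselves: irreducibility is proved by applying this to a submodule of one eigenspace and
  to the other two eigenspaces.
\<close>

lemma eigspace_decomposition:
  assumes "\<And>lam. lam \<in> weights3 \<Longrightarrow> submodule2 h (U lam) \<and> hw_vec q lam \<in> U lam"
  obtains x1 x2 x3 where "x1 \<in> U two_omega1" "x2 \<in> U (\<omega> 2)" "x3 \<in> U (\<omega> 5)" "x = x1 + x2 + x3"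
proof -
  let ?V = "{y + w |y w. y \<in> {y + w |y w. y \<in> U two_omega1 \<and> w \<in> U (\<omega> 2)} \<and> w \<in> U (\<omega> 5)}"
  have w: "two_omega1 \<in> weights3" "\<omega> 2 \<in> weights3" "\<omega> 5 \<in> weights3" by (auto simp: weights3_def)
  note a = assms[OF w(1)] assms[OF w(2)] assms[OF w(3)]
  have 0: "0 \<in> U two_omega1" "0 \<in> U (\<omega> 2)" "0 \<in> U (\<omega> 5)"
    using a by (auto simp: submodule2_def intro: vec.subspace_0)
  have "?V = UNIV"
  proof (rule submodule2_eq_UNIV)
    show "submodule2 h ?V" using a by (intro submodule2_sum) auto
    have mem: "u + v + w \<in> ?V" if "u \<in> U two_omega1" "v \<in> U (\<omega> 2)" "w \<in> U (\<omega> 5)" for u v w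
      using that by blast
    fix lam assume "lam \<in> weights3"
    then consider "lam = two_omega1" | "lam = \<omega> 2" | "lam = \<omega> 5" by (auto simp: weights3_def)
    then show "hw_vec q lam \<in> ?V"
    proof cases
      case 1 then show ?thesis using mem[of "hw_vec q lam" 0 0] a 0 by simp
    next
      case 2 then show ?thesis using mem[of 0 "hw_vec q lam" 0] a 0 by simp
    next
      case 3 then show ?thesis using mem[of 0 0 "hw_vec q lam"] a 0 by simp
    qed
  qed
  then have "x \<in> ?V" by blast
  then show ?thesis using that by auto
qed

lemma eigspace_cases:
  obtains x1 x2 x3 where "x1 \<in> eigspace q h two_omega1" "x2 \<in> eigspace q h (\<omega> 2)"
    "x3 \<in> eigspace q h (\<omega> 5)" "x = x1 + x2 + x3"
  using eigspace_decomposition[of "eigspace q h" x] submodule2_eigspace hw_vec_in_eigspace by blast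

lemma op2_eq_on_eigspaces:
  fixes A B :: "complex op2"
  assumes "\<And>lam x. lam \<in> weights3 \<Longrightarrow> x \<in> eigspace q h lam \<Longrightarrow> A *v x = B *v x"
  shows "A = B"
proof (rule op2_eqI)
  fix i j
  obtain x1 x2 x3 where x: "x1 \<in> eigspace q h two_omega1" "x2 \<in> eigspace q h (\<omega> 2)"
    "x3 \<in> eigspace q h (\<omega> 5)" and d: "vtensor i j = x1 + x2 + x3" using eigspace_cases .
  have "A *v x1 = B *v x1" "A *v x2 = B *v x2" "A *v x3 = B *v x3"
    using assms[OF _ x(1)] assms[OF _ x(2)] assms[OF _ x(3)] by (simp_all add: weights3_def)
  then show "A *v vtensor i j = B *v vtensor i j"
    unfolding d matrix_vector_right_distrib by simp
qed

text \<open>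
  The other two highest weight vectors belong to different eigenvalues.
\<close>

lemma hw_vec_in_submodule_of_eigspace:
  assumes lam: "lam \<in> weights3" and U: "submodule2 h U" "U \<subseteq> eigspace q h lam" "U \<noteq> {0}"
  shows "hw_vec q lam \<in> U"
proof -
  have "0 \<in> U" using U(1) by (auto simp: submodule2_def intro: vec.subspace_0)
  with U(3) obtain x where "x \<in> U" "x \<noteq> 0" by blast
  from submodule2_contains_hw_vec[OF U(1) this] obtain mu where mu: "mu \<in> weights3" "hw_vec q mu \<in> U" by blast
  have "eigproj q h lam *v hw_vec q mu = hw_vec q mu"
    using eigproj_eigspace[OF lam lam, of "hw_vec q mu"] mu U(2) by auto
  with eigproj_eigspace[OF lam mu(1) hw_vec_in_eigspace[OF mu(1)]] hw_vec_nonzero[OF mu(1)]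
  have "mu = lam" by (auto split: if_splits)
  with mu show ?thesis by simp
qed

text \<open>
  A nonzero submodule \<open>U\<close> of the eigenspace contains its highest weight vector. So \<open>U\<close> and the other two
  eigenspaces span everything, and applying the projector to the resulting decomposition of a vector of
  the eigenspace shows that the vector is in \<open>U\<close>.
\<close>

lemma irreducible2_eigspace:
  assumes lam: "lam \<in> weights3"
  shows "irreducible2 h (eigspace q h lam)"
  unfolding irreducible2_def
proof (intro conjI allI impI)
  show "submodule2 h (eigspace q h lam)" by (rule submodule2_eigspace)
  show "eigspace q h lam \<noteq> {0}" using hw_vec_in_eigspace[OF lam] hw_vec_nonzero[OF lam] by auto
  fix U assume U: "submodule2 h U" "U \<subseteq> eigspace q h lam"
  show "U = {0} \<or> U = eigspace q h lam"
  proof (rule disjCI)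
    assume "U \<noteq> eigspace q h lam"
    show "U = {0}"
    proof (rule ccontr)
      assume "U \<noteq> {0}"
      have hw: "hw_vec q lam \<in> U" using hw_vec_in_submodule_of_eigspace[OF lam U \<open>U \<noteq> {0}\<close>] .
      let ?W = "\<lambda>\<mu>. if \<mu> = lam then U else eigspace q h \<mu>"
      have W: "submodule2 h (?W \<mu>) \<and> hw_vec q \<mu> \<in> ?W \<mu>" if "\<mu> \<in> weights3" for \<mu>
        using U(1) hw submodule2_eigspace hw_vec_in_eigspace[OF that] by auto
      have "eigspace q h lam \<subseteq> U"
      proof
        fix x assume x: "x \<in> eigspace q h lam"
        obtain x1 x2 x3 where d: "x1 \<in> ?W two_omega1" "x2 \<in> ?W (\<omega> 2)" "x3 \<in> ?W (\<omega> 5)" "x = x1 + x2 + x3"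
          by (rule eigspace_decomposition[of ?W x, OF W])
        have e: "x1 \<in> eigspace q h two_omega1" "x2 \<in> eigspace q h (\<omega> 2)" "x3 \<in> eigspace q h (\<omega> 5)"
          using d U(2) by (auto split: if_splits)
        have w: "two_omega1 \<in> weights3" "\<omega> 2 \<in> weights3" "\<omega> 5 \<in> weights3" by (auto simp: weights3_def)
        note p = eigproj_eigspace[OF lam w(1) e(1)] eigproj_eigspace[OF lam w(2) e(2)] eigproj_eigspace[OF lam w(3) e(3)]
        have "x = eigproj q h lam *v x" using eigproj_eigspace[OF lam lam x] by simp
        then have "x = (if two_omega1 = lam then x1 else 0) + (if \<omega> 2 = lam then x2 else 0) + (if \<omega> 5 = lam then x3 else 0)"
          using p unfolding d(4) matrix_vector_right_distrib by simp
        then show "x \<in> U" using d lam weights3_distinct by (auto simp: weights3_def)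
      qed
      with U(2) \<open>U \<noteq> eigspace q h lam\<close> show False by blast
    qed
  qed
qed

lemma is_L_eigspace:
  assumes lam: "lam \<in> weights3"
  shows "is_L h lam W \<longleftrightarrow> W = eigspace q h lam"
proof
  have "highest_weight_vector h lam (hw_vec q lam)"
    using hw_vec_nonzero[OF lam] hw_vec_singular[OF lam] hw_vec_weight[OF lam]
    by (simp add: highest_weight_vector_def singular_def h)
  then show "is_L h lam W" if "W = eigspace q h lam"
    using that irreducible2_eigspace[OF lam] hw_vec_in_eigspace[OF lam] by (auto simp: is_L_def)
  assume L: "is_L h lam W"
  then obtain w where w: "w \<in> W" "highest_weight_vector h lam w" and irr: "irreducible2 h W"
    by (auto simp: is_L_def)
  have "singular h w" using w(2) by (simp add: highest_weight_vector_def singular_def)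
  from singular_of_weight[OF this lam] w(2) obtain c where c: "w = c *s hw_vec q lam"
    by (auto simp: highest_weight_vector_def h)
  have sub: "submodule2 h W" using irr by (simp add: irreducible2_def)
  let ?U = "W \<inter> eigspace q h lam"
  have U: "submodule2 h ?U" using submodule2_Int[OF sub submodule2_eigspace] .
  have "w \<in> ?U" using w(1) c hw_vec_in_eigspace[OF lam] vec.subspace_scale[OF eigspace_subspace] by auto
  moreover have "w \<noteq> 0" using w(2) by (simp add: highest_weight_vector_def)
  ultimately have "?U \<noteq> {0}" by blast
  then have "?U = W" "?U = eigspace q h lam"
    using irr irreducible2_eigspace[OF lam] U unfolding irreducible2_def by blast+
  then show "W = eigspace q h lam" by blast
qed

lemma L_sub_eigspace: "lam \<in> weights3 \<Longrightarrow> L_sub h lam = eigspace q h lam"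
  by (simp add: L_sub_def is_L_eigspace)

lemma direct_sum_L_sub: "direct_sum3 (L_sub h two_omega1) (L_sub h (\<omega> 2)) (L_sub h (\<omega> 5))"
proof -
  have w: "two_omega1 \<in> weights3" "\<omega> 2 \<in> weights3" "\<omega> 5 \<in> weights3" by (auto simp: weights3_def)
  have comp: "x1 = eigproj q h two_omega1 *v (x1 + x2 + x3) \<and> x2 = eigproj q h (\<omega> 2) *v (x1 + x2 + x3)
      \<and> x3 = eigproj q h (\<omega> 5) *v (x1 + x2 + x3)"
    if "x1 \<in> eigspace q h two_omega1" "x2 \<in> eigspace q h (\<omega> 2)" "x3 \<in> eigspace q h (\<omega> 5)" for x1 x2 x3
    using eigproj_eigspace[OF _ w(1) that(1)] eigproj_eigspace[OF _ w(2) that(2)] eigproj_eigspace[OF _ w(3) that(3)]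
      w weights3_distinct by (simp add: matrix_vector_right_distrib)
  show ?thesis
    unfolding direct_sum3_def L_sub_eigspace[OF w(1)] L_sub_eigspace[OF w(2)] L_sub_eigspace[OF w(3)]
  proof
    fix x
    obtain x1 x2 x3 where d: "x1 \<in> eigspace q h two_omega1" "x2 \<in> eigspace q h (\<omega> 2)" "x3 \<in> eigspace q h (\<omega> 5)"
      "x = x1 + x2 + x3" using eigspace_cases .
    show "\<exists>!t. fst t \<in> eigspace q h two_omega1 \<and> fst (snd t) \<in> eigspace q h (\<omega> 2) \<and>
        snd (snd t) \<in> eigspace q h (\<omega> 5) \<and> x = fst t + fst (snd t) + snd (snd t)"
    proof (rule ex1I[of _ "(x1, x2, x3)"])
      fix t assume t: "fst t \<in> eigspace q h two_omega1 \<and> fst (snd t) \<in> eigspace q h (\<omega> 2) \<and>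
        snd (snd t) \<in> eigspace q h (\<omega> 5) \<and> x = fst t + fst (snd t) + snd (snd t)"
      obtain y1 y2 y3 where y: "t = (y1, y2, y3)" by (cases t)
      have "y1 = x1 \<and> y2 = x2 \<and> y3 = x3"
        using comp[of y1 y2 y3] comp[OF d(1,2,3)] t d(4) by (simp add: y)
      then show "t = (x1, x2, x3)" by (simp add: y)
    qed (use d in simp)
  qed
qed

lemma proj_eq_eigproj:
  assumes lam: "lam \<in> weights3"
  shows "proj h lam = eigproj q h lam"
  unfolding proj_def weights3_def[symmetric]
proof (rule the_equality)
  show "\<forall>\<mu>\<in>weights3. \<forall>w\<in>L_sub h \<mu>. eigproj q h lam *v w = (if \<mu> = lam then w else 0)"
    using eigproj_eigspace[OF lam] by (auto simp: L_sub_eigspace)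
  fix P assume "\<forall>\<mu>\<in>weights3. \<forall>w\<in>L_sub h \<mu>. P *v w = (if \<mu> = lam then w else 0)"
  then show "P = eigproj q h lam"
    by (intro op2_eq_on_eigspaces) (simp add: eigproj_eigspace[OF lam] L_sub_eigspace)
qed

text \<open>
  Schur's lemma: the vectors on which \<open>D\<close> acts by \<open>c\<close> form a submodule.
\<close>

lemma commuting_scalar_on_eigspace:
  assumes D: "finite_commute h D" and lam: "lam \<in> weights3" and x: "x \<in> eigspace q h lam"
    and c: "D *v hw_vec q lam = c *s hw_vec q lam"
  shows "D *v x = c *s x"
proof -
  let ?U = "{x. D *v x = c *s x} \<inter> eigspace q h lam"
  have "submodule2 h ?U" by (rule submodule2_Int[OF submodule2_eigenspace[OF D] submodule2_eigspace])
  moreover have "?U \<noteq> {0}" using c hw_vec_in_eigspace[OF lam] hw_vec_nonzero[OF lam] by blast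
  ultimately have "?U = eigspace q h lam"
    using irreducible2_eigspace[OF lam] unfolding irreducible2_def by blast
  with x show ?thesis by blast
qed

lemma commuting_scalar_ex:
  assumes D: "finite_commute h D" and lam: "lam \<in> weights3"
  shows "\<exists>c. \<forall>x\<in>eigspace q h lam. D *v x = c *s x"
proof -
  have "singular h (D *v hw_vec q lam)"
    using hw_vec_singular[OF lam] finite_commute_apply(1)[OF D]
    by (metis matrix_vector_mult_0_right singular_def)
  moreover have "K2 h k *v (D *v hw_vec q lam) = q powi lam k *s (D *v hw_vec q lam)" if "k \<in> {1..6}" for k
    using finite_commute_apply(3)[OF D that, of "hw_vec q lam"] hw_vec_weight[OF lam that]
    by (simp add: vector_scalar_commute)
  ultimately obtain c where "D *v hw_vec q lam = c *s hw_vec q lam"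
    using singular_of_weight[OF _ lam] by blast
  then show ?thesis using commuting_scalar_on_eigspace[OF D lam] by blast
qed

text \<open>
  The R-matrix acts by a scalar on each summand, and the scalar can be read off from the highest weight
  vector.
\<close>

lemma R_mat_spectral:
  assumes reg: "regular q z"
  shows "R_mat q h z = eigproj q h two_omega1 + eig q z (\<omega> 2) *\<^sub>k eigproj q h (\<omega> 2)
     + eig q z (\<omega> 5) *\<^sub>k eigproj q h (\<omega> 5)"
proof (rule op2_eq_on_eigspaces)
  fix lam x assume lam: "lam \<in> weights3" and x: "x \<in> eigspace q h lam"
  have "R_mat q h z *v x = eig q z lam *s x"
    by (rule commuting_scalar_on_eigspace[OF R_mat_finite_commute[OF reg] lam x R_mat_hw_vec[OF reg h lam]])
  moreover have "eig q z two_omega1 = 1" by (simp add: eig_def)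
  ultimately show "R_mat q h z *v x = (eigproj q h two_omega1 + eig q z (\<omega> 2) *\<^sub>k eigproj q h (\<omega> 2)
     + eig q z (\<omega> 5) *\<^sub>k eigproj q h (\<omega> 5)) *v x"
    using eigproj_eigspace[OF _ lam x] lam weights3_distinct
    by (auto simp: matrix_vector_mult_add_rdistrib smult_mat_mult weights3_def)
qed

section \<open>Uniqueness of the intertwiner\<close>

lemma eigspaces_orthogonal:
  assumes "lam \<in> weights3" "\<mu> \<in> weights3" "lam \<noteq> \<mu>" "x \<in> eigspace q h lam" "y \<in> eigspace q h \<mu>"
  shows "bil x y = 0"
proof -
  have "eig q 0 lam * bil x y = bil (R_mat q h 0 *v x) y"
    using assms(4) by (simp add: eigspace_def bil_simps)
  also have "\<dots> = bil x (R_mat q h 0 *v y)" by (simp add: bil_transpose transpose_R_mat)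
  also have "\<dots> = eig q 0 \<mu> * bil x y" using assms(5) by (simp add: eigspace_def bil_simps)
  finally show ?thesis using eig_distinct[OF assms(1-3)] by simp
qed

text \<open>
  The difference \<open>D\<close> of two normalized intertwiners acts by scalars on the three summands, and the first
  scalar is 0. As \<open>D\<close> commutes with the action of \<open>E_0\<close>, it kills \<open>E_0 (v_1 \<otimes> v_1)\<close>, which has a nonzero
  component in \<open>L_{\<omega>_2}\<close> unless \<open>z = q^2\<close>, so that the second scalar is 0. Then \<open>D\<close> kills \<open>v_1 \<otimes> v_2\<close>
  and hence \<open>E_0 (v_1 \<otimes> v_2)\<close>, whose component in \<open>L_{\<omega>_5}\<close> is nonzero unless \<open>z = q^8\<close>. Components are
  detected by pairing with a vector of the summand.
\<close>

lemma affine_intertwiner_unique: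
  assumes reg: "regular q z"
    and A: "affine_intertwiner h z 1 A" "A *v vtensor 1 1 = vtensor 1 1"
    and B: "affine_intertwiner h z 1 B" "B *v vtensor 1 1 = vtensor 1 1"
  shows "A = B"
proof -
  define D where "D = A - B"
  have D_apply: "D *v x = A *v x - B *v x" for x by (simp add: D_def matrix_vector_mult_diff_rdistrib)
  have aff: "D *v (E2 h z 1 k *v x) = E2 h 1 z k *v (D *v x)"
    "D *v (F2 h z 1 k *v x) = F2 h 1 z k *v (D *v x)"
    "D *v (K2 h k *v x) = K2 h k *v (D *v x)" if "k \<le> 6" for k x
    using affine_intertwiner_apply[OF A(1) that] affine_intertwiner_apply[OF B(1) that]
    by (simp_all add: D_apply matrix_vector_mult_diff_distrib)
  have fin: "finite_commute h D"
    unfolding finite_commute_def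
  proof (intro ballI conjI)
    fix k :: nat assume "k \<in> {1..6}"
    then have k: "k \<le> 6" "k \<noteq> 0" by auto
    show "D ** E2 h 1 1 k = E2 h 1 1 k ** D" "D ** F2 h 1 1 k = F2 h 1 1 k ** D" "D ** K2 h k = K2 h k ** D"
      using aff[OF k(1)] unfolding matrix_eq matrix_vector_mul_assoc[symmetric]
      by (simp_all add: finite_generators[OF k(2), of h z 1] finite_generators[OF k(2), of h 1 z])
  qed
  from commuting_scalar_ex[OF fin]
  obtain c where c: "\<And>lam x. lam \<in> weights3 \<Longrightarrow> x \<in> eigspace q h lam \<Longrightarrow> D *v x = c lam *s x"
    by metis
  have w: "two_omega1 \<in> weights3" "\<omega> 2 \<in> weights3" "\<omega> 5 \<in> weights3" by (auto simp: weights3_def)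
  have bil_D: "bil (D *v y) x = c lam * bil y x" if lam: "lam \<in> weights3" and x: "x \<in> eigspace q h lam" for lam x y
  proof -
    obtain y1 y2 y3 where y: "y1 \<in> eigspace q h two_omega1" "y2 \<in> eigspace q h (\<omega> 2)"
      "y3 \<in> eigspace q h (\<omega> 5)" "y = y1 + y2 + y3" using eigspace_cases .
    have "c \<mu> * bil y' x = c lam * bil y' x" if "\<mu> \<in> weights3" "y' \<in> eigspace q h \<mu>" for \<mu> y'
      using eigspaces_orthogonal[OF that(1) lam _ that(2) x] by (cases "\<mu> = lam") auto
    note e = this[OF w(1) y(1)] this[OF w(2) y(2)] this[OF w(3) y(3)]
    show ?thesis
      unfolding y(4) matrix_vector_right_distrib c[OF w(1) y(1)] c[OF w(2) y(2)] c[OF w(3) y(3)]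
        bil_simps distrib_left e ..
  qed
  have D11: "D *v vtensor 1 1 = 0" using A(2) B(2) by (simp add: D_apply)
  have r: "raise 0 1 = Some 20" "raise 0 2 = Some 22" by (simp_all add: raise_table)
  have wt0: "wt 0 1 = -1" "wt 0 2 = -1" by (simp_all add: wt_table)
  have c1: "c two_omega1 = 0"
    using c[OF w(1) hw_vec_in_eigspace[OF w(1)]] D11 hw_vec_nonzero[OF w(1)]
    by (simp add: hw_vec_def)
  have c2: "c (\<omega> 2) = 0"
  proof -
    let ?x = "vtensor 1 20 - inverse q *s vtensor 20 1"
    \<comment> \<open>\<open>E_0\<close> sends \<open>v_1\<close> to \<open>v_{20}\<close>, and this pair is free.\<close>
    have "free 1 20" using free_arrow[OF _ r(1)] by simp
    then have x: "?x \<in> eigspace q h (\<omega> 2)"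
      using R_mat_antisymmetric[OF regular_0 h, of 1 20] by (simp add: eigspace_def)
    have "E2 h z 1 0 *v vtensor 1 1 = (z * inverse h) *s vtensor 20 1 + h *s vtensor 1 20"
      using r(1) wt0 by (simp add: E2_vtensor E2_column_def par_def)
    then have "bil (E2 h z 1 0 *v vtensor 1 1) ?x = inverse h * ((q ^ 2 - z) / q)"
      using q0 h_not_0 by (simp add: bil_simps bil_vtensor_left vtensor_nth h[symmetric] field_simps power_numeral_reduce)
    moreover have "bil (D *v (E2 h z 1 0 *v vtensor 1 1)) ?x = 0"
      using aff(1)[of 0 "vtensor 1 1"] D11 by (simp add: bil_simps)
    ultimately show ?thesis
      using bil_D[OF w(2) x, of "E2 h z 1 0 *v vtensor 1 1"] regular_facts[OF reg] h_not_0 by simp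
  qed
  have c3: "c (\<omega> 5) = 0"
  proof -
    have f: "free 1 2" using free_arrow[OF _ raise_1_2] free_sym by simp
    \<comment> \<open>\<open>v_1 \<otimes> v_2\<close> is a combination of two vectors on which \<open>D\<close> is already known to vanish.\<close>
    let ?s = "vtensor 1 2 + q *s vtensor 2 1" and ?a = "vtensor 1 2 - inverse q *s vtensor 2 1"
    have "?s \<in> eigspace q h two_omega1" "?a \<in> eigspace q h (\<omega> 2)"
      using R_mat_symmetric[OF regular_0 h, of 1 2] R_mat_antisymmetric[OF regular_0 h, of 1 2] f
      by (simp_all add: eigspace_def eig_def)
    from c[OF w(1) this(1)] c[OF w(2) this(2)] have "D *v ?s = 0" "D *v ?a = 0" using c1 c2 by simp_all
    then have "D *v (?s + q ^ 2 *s ?a) = 0"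
      by (simp only: matrix_vector_right_distrib vector_scalar_commute vec.scale_zero_right add_0)
    moreover have "?s + q ^ 2 *s ?a = (1 + q ^ 2) *s vtensor 1 2"
      using q0 by (simp add: vec_eq_iff algebra_simps power2_eq_square)
    ultimately have "D *v ((1 + q ^ 2) *s vtensor 1 2) = 0" by (simp only:)
    then have D12: "D *v vtensor 1 2 = 0"
      unfolding vector_scalar_commute vec.scale_eq_0_iff using one_plus_power[of 2] by simp
    let ?x = "block_vec q 5"
    have x: "?x \<in> eigspace q h (\<omega> 5)"
      using R_mat_block_vec[OF regular_0 h, of 5] by (simp add: eigspace_def)
    \<comment> \<open>The two terms of \<open>E_0 (v_1 \<otimes> v_2)\<close> are at the positions 0 and 8 of the fifth block.\<close>
    have I: "I_list 5 ! 0 = (1, 22)" "I_list 5 ! 8 = (20, 2)" by (simp_all add: I_list_table nth10)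
    have co: "?x $ (of_label 1, of_label 22) = q ^ 4" "?x $ (of_label 20, of_label 2) = - (inverse q ^ 3)"
      using block_vec_nth[OF _ _ I(1), of q] block_vec_nth[OF _ _ I(2), of q] by (simp_all add: coord_def)
    have "E2 h z 1 0 *v vtensor 1 2 = (z * inverse h) *s vtensor 20 2 + h *s vtensor 1 22"
      using r wt0 by (simp add: E2_vtensor E2_column_def par_def)
    then have "bil (E2 h z 1 0 *v vtensor 1 2) ?x = h * q ^ 4 - z * inverse h * inverse q ^ 3"
      by (simp add: bil_simps bil_vtensor_left co)
    also have "\<dots> = inverse h * ((q ^ 8 - z) / q ^ 3)"
      using q0 h_not_0 unfolding h[symmetric] by (simp add: field_simps power_numeral_reduce)
    finally have "bil (E2 h z 1 0 *v vtensor 1 2) ?x = \<dots>" .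
    moreover have "bil (D *v (E2 h z 1 0 *v vtensor 1 2)) ?x = 0"
      using aff(1)[of 0 "vtensor 1 2"] D12 by (simp add: bil_simps)
    ultimately show ?thesis
      using bil_D[OF w(3) x, of "E2 h z 1 0 *v vtensor 1 2"] regular_facts[OF reg] h_not_0 q0 by simp
  qed
  have "D = 0"
    by (rule op2_eq_on_eigspaces) (use c c1 c2 c3 in \<open>auto simp: weights3_def\<close>)
  then show ?thesis by (simp add: D_def)
qed

end

section \<open>Values of rational functions\<close>

text \<open>
  The function \<open>f\<close> is regular at \<open>z\<close> with value \<open>v\<close>. As a relation it is preserved by the field operations,
  which gives the values of the entries of composite matrices without computing numerators and
  denominators.
\<close>

definition regular_value :: "complex \<Rightarrow> ratfun \<Rightarrow> complex \<Rightarrow> bool" where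
  "regular_value z f v \<longleftrightarrow> (\<exists>n d. f = Fract n d \<and> poly d z \<noteq> 0 \<and> v = poly n z / poly d z)"

lemma regular_value_unique:
  assumes "regular_value z f v" "regular_value z f w"
  shows "v = w"
proof -
  obtain n d n' d' where f: "f = Fract n d" "f = Fract n' d'" and d: "poly d z \<noteq> 0" "poly d' z \<noteq> 0"
    and v: "v = poly n z / poly d z" "w = poly n' z / poly d' z"
    using assms unfolding regular_value_def by blast
  from d have "d \<noteq> 0" "d' \<noteq> 0" by auto
  with f have "n * d' = n' * d" by (simp add: eq_fract)
  then have "poly n z * poly d' z = poly n' z * poly d z" by (metis poly_mult)
  with v d show ?thesis by (simp add: frac_eq_eq)
qed

lemma reval_eq: "regular_value z f v \<Longrightarrow> reval f z = v"
  unfolding reval_def regular_value_def[symmetric]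
  by (rule the_equality) (blast intro: regular_value_unique)+

lemma regular_value_rconst: "regular_value z (rconst c) c"
  unfolding regular_value_def rconst_def by (intro exI[of _ "[:c:]"] exI[of _ 1]) simp

lemma regular_value_rvar: "regular_value z rvar z"
  unfolding regular_value_def rvar_def by (intro exI[of _ "[:0, 1:]"] exI[of _ 1]) simp

lemma rconst_0: "rconst 0 = 0" and rconst_1: "rconst 1 = 1"
  by (simp_all add: rconst_def Zero_fract_def One_fract_def one_pCons)

lemma regular_value_0: "regular_value z 0 0" and regular_value_1: "regular_value z 1 1"
  using regular_value_rconst[of z 0] regular_value_rconst[of z 1] by (simp_all add: rconst_0 rconst_1)

lemma regular_value_add:
  assumes "regular_value z f v" "regular_value z g w"
  shows "regular_value z (f + g) (v + w)"
proof -
  obtain n d n' d' where f: "f = Fract n d" "g = Fract n' d'" and d: "poly d z \<noteq> 0" "poly d' z \<noteq> 0"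
    and v: "v = poly n z / poly d z" "w = poly n' z / poly d' z"
    using assms unfolding regular_value_def by blast
  from d have "d \<noteq> 0" "d' \<noteq> 0" by auto
  with f have "f + g = Fract (n * d' + n' * d) (d * d')" by simp
  moreover have "v + w = poly (n * d' + n' * d) z / poly (d * d') z"
    using d v by (simp add: add_frac_eq)
  moreover have "poly (d * d') z \<noteq> 0" using d by simp
  ultimately show ?thesis unfolding regular_value_def by blast
qed

lemma regular_value_mult:
  assumes "regular_value z f v" "regular_value z g w"
  shows "regular_value z (f * g) (v * w)"
proof -
  obtain n d n' d' where f: "f = Fract n d" "g = Fract n' d'" and d: "poly d z \<noteq> 0" "poly d' z \<noteq> 0"
    and v: "v = poly n z / poly d z" "w = poly n' z / poly d' z"
    using assms unfolding regular_value_def by blast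
  have "f * g = Fract (n * n') (d * d')" using f by simp
  moreover have "v * w = poly (n * n') z / poly (d * d') z" using v by simp
  moreover have "poly (d * d') z \<noteq> 0" using d by simp
  ultimately show ?thesis unfolding regular_value_def by blast
qed

lemma regular_value_uminus:
  assumes "regular_value z f v"
  shows "regular_value z (- f) (- v)"
proof -
  have "rconst (-1) = - 1" by (simp add: rconst_def One_fract_def one_pCons)
  then show ?thesis
    using regular_value_mult[OF regular_value_rconst[of z "-1"] assms] by simp
qed

lemma regular_value_diff:
  "regular_value z f v \<Longrightarrow> regular_value z g w \<Longrightarrow> regular_value z (f - g) (v - w)"
  using regular_value_add[OF _ regular_value_uminus] by (metis diff_conv_add_uminus)

lemma regular_value_inverse:
  assumes "regular_value z f v" "v \<noteq> 0"
  shows "regular_value z (inverse f) (inverse v)"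
proof -
  obtain n d where f: "f = Fract n d" and d: "poly d z \<noteq> 0" and v: "v = poly n z / poly d z"
    using assms unfolding regular_value_def by blast
  have "inverse f = Fract d n" using f by simp
  moreover have "inverse v = poly d z / poly n z" using v by simp
  moreover have "poly n z \<noteq> 0" using v assms(2) by auto
  ultimately show ?thesis unfolding regular_value_def by blast
qed

lemma regular_value_divide:
  "regular_value z f v \<Longrightarrow> regular_value z g w \<Longrightarrow> w \<noteq> 0 \<Longrightarrow> regular_value z (f / g) (v / w)"
  unfolding divide_inverse by (intro regular_value_mult regular_value_inverse)

lemma regular_value_power: "regular_value z f v \<Longrightarrow> regular_value z (f ^ n) (v ^ n)"
  by (induction n) (simp_all add: regular_value_1 regular_value_mult)

lemma regular_value_power_int:
  assumes "regular_value z f v" "v \<noteq> 0"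
  shows "regular_value z (f powi n) (v powi n)"
  using assms by (auto simp: power_int_def intro: regular_value_power regular_value_inverse)

lemma regular_value_sum:
  "(\<And>i. i \<in> S \<Longrightarrow> regular_value z (f i) (g i)) \<Longrightarrow> regular_value z (\<Sum>i\<in>S. f i) (\<Sum>i\<in>S. g i)"
  by (induction S rule: infinite_finite_induct) (simp_all add: regular_value_0 regular_value_add)

text \<open>
  The numerator of the difference is a polynomial with infinitely many zeros.
\<close>

lemma ratfun_eqI:
  assumes "\<forall>\<^sub>F z in cofinite. reval f z = reval g z"
  shows "f = g"
proof -
  obtain n d where f: "f = Fract n d" "d \<noteq> 0" by (cases f) auto
  obtain n' d' where g: "g = Fract n' d'" "d' \<noteq> 0" by (cases g) auto
  let ?p = "n * d' - n' * d"
  have fin: "finite ({z. poly d z = 0} \<union> {z. poly d' z = 0} \<union> {z. reval f z \<noteq> reval g z})"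
    using f(2) g(2) assms by (simp add: poly_roots_finite eventually_cofinite)
  have "poly ?p z = 0" if "z \<notin> {z. poly d z = 0} \<union> {z. poly d' z = 0} \<union> {z. reval f z \<noteq> reval g z}" for z
  proof -
    from that have d: "poly d z \<noteq> 0" "poly d' z \<noteq> 0" and e: "reval f z = reval g z" by auto
    have "regular_value z f (poly n z / poly d z)" "regular_value z g (poly n' z / poly d' z)"
      using d f(1) g(1) unfolding regular_value_def by blast+
    with e have "poly n z / poly d z = poly n' z / poly d' z" by (simp add: reval_eq)
    with d show ?thesis by (simp add: frac_eq_eq)
  qed
  then have "UNIV - ({z. poly d z = 0} \<union> {z. poly d' z = 0} \<union> {z. reval f z \<noteq> reval g z}) \<subseteq> {z. poly ?p z = 0}"
    by blast
  moreover have "infinite (UNIV - ({z. poly d z = 0} \<union> {z. poly d' z = 0} \<union> {z. reval f z \<noteq> reval g z}))"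
    using fin by (intro Diff_infinite_finite infinite_UNIV_char_0)
  ultimately have "infinite {z. poly ?p z = 0}" using finite_subset by blast
  then have "?p = 0" using poly_roots_finite by blast
  then show ?thesis using f g by (simp add: eq_fract)
qed

definition regular_values :: "complex \<Rightarrow> ratfun op2 \<Rightarrow> complex op2 \<Rightarrow> bool" where
  "regular_values z A B \<longleftrightarrow> (\<forall>r c. regular_value z (A $ r $ c) (B $ r $ c))"

lemma map_matrix_reval: "regular_values z A B \<Longrightarrow> map_matrix (\<lambda>f. reval f z) A = B"
  by (simp add: regular_values_def map_matrix_def vec_eq_iff reval_eq)

lemma ratfun_op2_eqI:
  assumes "\<forall>\<^sub>F z in cofinite. map_matrix (\<lambda>f. reval f z) A = map_matrix (\<lambda>f. reval f z) B"
  shows "A = B"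
proof -
  have "A $ r $ c = B $ r $ c" for r c
  proof (rule ratfun_eqI)
    show "\<forall>\<^sub>F z in cofinite. reval (A $ r $ c) z = reval (B $ r $ c) z"
      using assms by (rule eventually_mono) (simp add: map_matrix_def vec_eq_iff)
  qed
  then show ?thesis by (simp add: vec_eq_iff)
qed

lemma regular_values_add: "regular_values z A B \<Longrightarrow> regular_values z A' B' \<Longrightarrow> regular_values z (A + A') (B + B')"
  and regular_values_diff: "regular_values z A B \<Longrightarrow> regular_values z A' B' \<Longrightarrow> regular_values z (A - A') (B - B')"
  and regular_values_smult: "regular_value z f v \<Longrightarrow> regular_values z A B \<Longrightarrow> regular_values z (f *\<^sub>k A) (v *\<^sub>k B)"
  and regular_values_sum: "(\<And>i. i \<in> S \<Longrightarrow> regular_values z (G i) (H i)) \<Longrightarrow> regular_values z (\<Sum>i\<in>S. G i) (\<Sum>i\<in>S. H i)"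
  and regular_values_rconst: "regular_values z (map_matrix rconst B) B"
  by (simp_all add: regular_values_def regular_value_add regular_value_diff smult_mat_def regular_value_mult
      sum_component regular_value_sum map_matrix_def regular_value_rconst)

lemma regular_values_munit: "regular_values z (munit i j \<otimes>\<^sub>k munit k l) (munit i j \<otimes>\<^sub>k munit k l)"
  by (simp add: regular_values_def kron_def munit_def regular_value_0 regular_value_1)

lemma regular_values_T_sum:
  assumes "q \<noteq> 0"
  shows "regular_values z (T_sum rel (rconst q) s) (T_sum rel q s)"
proof -
  have e: "regular_value z (eps (rconst q) s x) (eps q s x)" for x
    using assms
    by (auto simp: eps_def case_prod_unfold intro!: regular_value_power_int regular_value_uminus
        regular_value_inverse regular_value_rconst)
  show ?thesis
    unfolding T_sum_def case_prod_unfold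
    by (intro regular_values_sum regular_values_smult regular_value_mult e regular_values_munit)
qed

lemma regular_values_R_mat:
  assumes reg: "regular q z" and h: "h ^ 2 = q"
  shows "regular_values z (R_mat (rconst q) (rconst h) rvar) (R_mat q h z)"
proof -
  note r = regular_facts[OF reg]
  have h_not_0: "h \<noteq> 0" using h_nonzero[OF reg h] .
  have d1: "q - inverse q * z \<noteq> 0"
    using r(1,3) by (simp add: field_simps power2_eq_square)
  have d2: "q ^ 4 - q powi (-4) * z \<noteq> 0"
    using r(1,4) by (simp add: field_simps power_int_minus power_numeral_reduce)
  have d3: "h + inverse h \<noteq> 0"
    using r(2) h_not_0 unfolding h[symmetric] by (simp add: field_simps power2_eq_square)
  have d4: "(q - inverse q * z) * (q ^ 4 - q powi (-4) * z) \<noteq> 0" using d1 d2 by simp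
  note intros = regular_value_add regular_value_diff regular_value_mult regular_value_divide regular_value_inverse
    regular_value_power regular_value_power_int regular_value_rconst regular_value_rvar regular_value_1
  show ?thesis
    unfolding R_mat_def R_sl27_def T_op_def case_prod_unfold
    by (intro regular_values_add regular_values_diff regular_values_smult regular_values_sum
        regular_values_munit regular_values_T_sum intros r(1) h_not_0 d1 d3 d4)
qed

lemma cofinite_regular: "\<forall>\<^sub>F z in cofinite. regular q z \<and> z \<noteq> 0" if "q \<noteq> 0" "1 + q \<noteq> 0"
proof -
  have "{z. \<not> (regular q z \<and> z \<noteq> 0)} \<subseteq> {0, q ^ 2, q ^ 8}" using that by (auto simp: regular_def)
  then show ?thesis unfolding eventually_cofinite by (rule finite_subset) simp
qed

section \<open>The two formulas\<close>

theorem theorem5p2: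
  fixes q qh :: complex
  assumes "q \<noteq> 0"
    and "\<And>n::nat. n > 0 \<Longrightarrow> q ^ n \<noteq> 1"
    and "qh ^ 2 = q"
  shows
    "let Q = rconst q; H = rconst qh; z = rvar in
     (\<exists>!R. normalized_intertwiner qh R) \<and>
     (\<forall>lam\<in>{two_omega1, \<omega> 2, \<omega> 5}. \<exists>!W. is_L qh lam W) \<and>
     direct_sum3 (L_sub qh two_omega1) (L_sub qh (\<omega> 2)) (L_sub qh (\<omega> 5)) \<and>
     R_check qh =
       rproj qh two_omega1
       - (Q powi (-2) * ((1 - Q ^ 2 * z) / (1 - Q powi (-2) * z))) *\<^sub>k rproj qh (\<omega> 2)
       + (Q powi (-10) * (((1 - Q ^ 2 * z) * (1 - Q ^ 8 * z)) /
            ((1 - Q powi (-2) * z) * (1 - Q powi (-8) * z)))) *\<^sub>k rproj qh (\<omega> 5) \<and>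
     R_check qh =
       R_sl27 Q z
       - ((Q - inverse Q) * (1 - z) / ((Q - inverse Q * z) * (Q ^ 4 - Q powi (-4) * z)))
           *\<^sub>k T_op Q H z"
proof -
  note hyps = assms
  note q0 = assms(1) and h = assms(3)
  \<comment> \<open>\<open>R\<close> is the matrix unit formula over \<open>\<complex>(z)\<close> and \<open>S\<close> the spectral formula; their values agree.\<close>
  define R where "R = R_mat (rconst q) (rconst qh) rvar"
  define S where "S = rproj qh two_omega1
       - (rconst q powi (-2) * ((1 - rconst q ^ 2 * rvar) / (1 - rconst q powi (-2) * rvar))) *\<^sub>k rproj qh (\<omega> 2)
       + (rconst q powi (-10) * (((1 - rconst q ^ 2 * rvar) * (1 - rconst q ^ 8 * rvar)) /
            ((1 - rconst q powi (-2) * rvar) * (1 - rconst q powi (-8) * rvar)))) *\<^sub>k rproj qh (\<omega> 5)"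
  have w: "two_omega1 \<in> weights3" "\<omega> 2 \<in> weights3" "\<omega> 5 \<in> weights3" by (auto simp: weights3_def)
  have cof: "\<forall>\<^sub>F z in cofinite. regular q z \<and> z \<noteq> 0"
    using cofinite_regular[OF q0] one_plus_power[OF hyps, of 1] by simp
  have R_eval: "map_matrix (\<lambda>f. reval f z) R = R_mat q qh z" if "regular q z" for z
    unfolding R_def by (rule map_matrix_reval[OF regular_values_R_mat[OF that h]])
  have S_eval: "map_matrix (\<lambda>f. reval f z) S = R_mat q qh z" if reg: "regular q z" for z
  proof -
    have "1 - q powi (-2) * z = (q ^ 2 - z) / q ^ 2" "1 - q powi (-8) * z = (q ^ 8 - z) / q ^ 8"
      using q0 by (simp_all add: power_int_minus field_simps)
    then have d: "1 - q powi (-2) * z \<noteq> 0" "(1 - q powi (-2) * z) * (1 - q powi (-8) * z) \<noteq> 0"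
      using regular_facts[OF reg] by simp_all
    have "regular_values z S (proj qh two_omega1
       - (q powi (-2) * ((1 - q ^ 2 * z) / (1 - q powi (-2) * z))) *\<^sub>k proj qh (\<omega> 2)
       + (q powi (-10) * (((1 - q ^ 2 * z) * (1 - q ^ 8 * z)) /
            ((1 - q powi (-2) * z) * (1 - q powi (-8) * z)))) *\<^sub>k proj qh (\<omega> 5))"
      unfolding S_def
      by (intro regular_values_add regular_values_diff regular_values_smult regular_values_rconst
          regular_value_add regular_value_diff regular_value_mult regular_value_divide regular_value_inverse
          regular_value_power regular_value_power_int regular_value_rconst regular_value_rvar regular_value_1 q0 d)
    moreover have "\<dots> = eigproj q qh two_omega1 + eig q z (\<omega> 2) *\<^sub>k eigproj q qh (\<omega> 2)
        + eig q z (\<omega> 5) *\<^sub>k eigproj q qh (\<omega> 5)"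
      using weights3_distinct proj_eq_eigproj[OF hyps w(1)] proj_eq_eigproj[OF hyps w(2)] proj_eq_eigproj[OF hyps w(3)]
      by (simp add: eig_def vec_eq_iff smult_mat_def)
    moreover have "\<dots> = R_mat q qh z" using R_mat_spectral[OF hyps reg] by simp
    ultimately show ?thesis using map_matrix_reval by metis
  qed
  have R_norm: "normalized_intertwiner qh R"
    unfolding normalized_intertwiner_def
  proof (rule eventually_mono[OF cof])
    fix z assume z: "regular q z \<and> z \<noteq> 0"
    then show "affine_intertwiner qh z 1 (map_matrix (\<lambda>f. reval f z) R)
        \<and> map_matrix (\<lambda>f. reval f z) R *v vtensor 1 1 = vtensor 1 1"
      using R_mat_intertwines[of q z qh] R_mat_equal[of q z qh 1] h by (simp add: R_eval)
  qed
  have R_unique: "R' = R" if R': "normalized_intertwiner qh R'" for R'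
  proof (rule ratfun_op2_eqI)
    show "\<forall>\<^sub>F z in cofinite. map_matrix (\<lambda>f. reval f z) R' = map_matrix (\<lambda>f. reval f z) R"
      using cof R'[unfolded normalized_intertwiner_def] R_norm[unfolded normalized_intertwiner_def]
    proof eventually_elim
      case (elim z)
      then show ?case using affine_intertwiner_unique[OF hyps, of z] by blast
    qed
  qed
  have "S = R"
  proof (rule ratfun_op2_eqI)
    show "\<forall>\<^sub>F z in cofinite. map_matrix (\<lambda>f. reval f z) S = map_matrix (\<lambda>f. reval f z) R"
      by (rule eventually_mono[OF cof]) (simp add: R_eval S_eval)
  qed
  moreover have "\<exists>!R. normalized_intertwiner qh R" using R_norm R_unique by blast
  moreover have "R_check qh = R" unfolding R_check_def using R_norm R_unique by (rule the_equality)
  moreover have "\<forall>lam\<in>weights3. \<exists>!W. is_L qh lam W" by (simp add: is_L_eigspace[OF hyps])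
  moreover note direct_sum_L_sub[OF hyps]
  ultimately show ?thesis
    unfolding Let_def weights3_def[symmetric] S_def[symmetric] R_mat_def[symmetric] R_def[symmetric] by simp
qed

end
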